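(* Let $x(t)$, $t\ge 0$, be the solution of the stochastic system $$dx(t)=f(x(t),u(t))\,dt+g(x(t))\,dW(t),\quad t>0,\qquad x(0)=\phi\in\mathbf{R}^n,$$ driven by the switching control $$u(t)=\begin{cases}k_1(x(t)), & t\in[t_i,s_i),\\ k_2(x(t)), & t\in[s_i,t_{i+1}),\end{cases}\qquad i=0,1,2,\ldots,$$ where $t_0=0$ and the switching times are generated by the double-event-triggering mechanism $$s_i=\inf\{t>t_i+\tau : |x(t)|^2\le M_2e^{-\lambda t}\},\qquad t_{i+1}=\inf\{t>s_i : |x(t)|^2\ge M_1e^{-\lambda t}\},$$ with constants $\tau>0$, $\lambda>0$, $0<M_2\le M_1$ and $M_2<|x(0)|^2$. Assume: (Assumption 1) There exist a function $V\in \mathbf{C}^2(\mathbf{R}^n;\mathbf{R}^+)$ and constants $c_1,c_2>0$ such that $c_1|x|^2\le V(x)\le c_2|x|^2$ for all $x\in\mathbf{R}^n$. (Assumption 2) The mappings $k_1,k_2:\mathbf{R}^n\to\mathbf{U}$ are locally Lipschitz with $k_1(0)=0$, $k_2(0)=0$, and there are constants $\mu>0$, $\bar M\ge 0$, $\bar\lambda<\frac{\mu}{c_2}$ and $c_3\in\mathbf{R}$ such that, for all $x\in\mathbf{R}^n$ and $t\ge 0$, $$\mathcal{L}V(x,k_1(x))\le -\mu|x|^2+\bar M e^{-\bar\lambda t},\qquad \mathcal{L}V(x,k_2(x))\le c_3|x|^2.$$ (Assumption 3) $\lambda<\bar\lambda<\frac{\mu}{c_2}$ if $\bar M>0$, and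 $\lambda<\frac{\mu}{c_2}$ if $\bar M=0$. Then the solution $x(t)$ is mean square exponentially stabilized by the switching control; that is, there exist constants $K>0$ and $\theta>0$ such that $\mathbf{E}|x(t)|^2\le Ke^{-\theta t}$ for all $t\ge 0$.
   Context: $\mathbf{R}^+=[0,\infty)$; $|\cdot|$ is the Euclidean norm. $(\Omega,\mathcal F,\{\mathcal F_t\}_{t\ge0},P)$ is a complete probability space whose filtration satisfies the usual conditions (right continuous, $\mathcal F_0$ contains all $P$-null sets), and $W(t)$ is an $m$-dimensional standard Wiener process adapted to $\{\mathcal F_t\}$. $\mathbf{C}^2(\mathbf{R}^n;\mathbf{R}^+)$ is the space of twice continuously differentiable functions from $\mathbf{R}^n$ to $\mathbf{R}^+$. Standing assumptions on the system: $x\in\mathbf{R}^n$; the control input $u$ takes values in $\mathbf{U}\subset\mathbf{R}^l$, a compact set with $0\in\mathbf{U}$; $f:\mathbf{R}^n\times\mathbf{R}^l\to\mathbf{R}^n$ and $g:\mathbf{R}^n\to\mathbf{R}^{n\times m}$ are continuous, locally Lipschitz, with $f(0,0)=0$ and $g(0)=0$; the system is taken to admit a unique global solution. For $V\in\mathbf{C}^2(\mathbf{R}^n;\mathbf{R}^+)$ the It\^o operator is $$\mathcal{L}V(x,u)=\frac{\partial V}{\partial x}(x) f(x,u)+\frac12\operatorname{trace}\Big(g^T(x)\frac{\partial^2V}{\partial x^2}(x)\,g(x)\Big),$$ where $\frac{\partial V}{\partial x}$ is the row gradient and $\frac{\partial^2V}{\partial x^2}$ the Hessian of $V$. Convention: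 $\inf\emptyset=+\infty$; if some switching time is $+\infty$, the control active before it is used for all later times. The switching times $t_i,s_i$ are in general random (stopping times). The constants $K$ and $\theta$ in mean square exponential stabilization may depend on the initial value and on the parameters of the triggering mechanism. *)

theory Defs
  imports "HOL-Probability.Probability"
begin

section \<open>Filtered probability space and Wiener process\<close>

text \<open>Time is indexed by \<^typ>\<open>real\<close>, but only times \<open>t \<ge> 0\<close> matter: a filtration
  given on \<open>[0,\<infinity>)\<close> extends to negative times by \<open>F 0\<close>, and right continuity is
  required on \<open>[0,\<infinity>)\<close> only.\<close>

locale usual_filtration =
  prob_space M + complete_measure M + filtration "space M" F
  for M :: "'w measure" and F :: "real \<Rightarrow> 'w measure" +
  assumes sets_F_subset: "0 \<le> t \<Longrightarrow> sets (F t) \<subseteq> sets M"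
    and right_continuous: "0 \<le> t \<Longrightarrow> sets (F t) = (\<Inter>s\<in>{t<..}. sets (F s))"
    and null_sets_F0: "null_sets M \<subseteq> sets (F 0)"

definition adapted :: "(real \<Rightarrow> 'w measure) \<Rightarrow> (real \<Rightarrow> 'w \<Rightarrow> 'b::topological_space) \<Rightarrow> bool" where
  "adapted F X \<longleftrightarrow> (\<forall>t\<ge>0. X t \<in> borel_measurable (F t))"

definition as_continuous :: "'w measure \<Rightarrow> (real \<Rightarrow> 'w \<Rightarrow> 'b::topological_space) \<Rightarrow> bool" where
  "as_continuous M X \<longleftrightarrow> (AE \<omega> in M. continuous_on {0..} (\<lambda>t. X t \<omega>))"

locale wiener_process = usual_filtration M F
  for M :: "'w measure" and F :: "real \<Rightarrow> 'w measure" +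
  fixes W :: "real \<Rightarrow> 'w \<Rightarrow> real^'m"
  assumes W_adapted: "adapted F W"
    and W_continuous: "as_continuous M W"
    and W_zero: "AE \<omega> in M. W 0 \<omega> = 0"
    and W_increment_indep:
      "0 \<le> s \<Longrightarrow> s < t \<Longrightarrow>
        indep_set (sets (F s)) (sets (vimage_algebra (space M) (\<lambda>\<omega>. W t \<omega> - W s \<omega>) borel))"
    and W_components_indep:
      "0 \<le> s \<Longrightarrow> s < t \<Longrightarrow> indep_vars (\<lambda>_. borel) (\<lambda>j \<omega>. (W t \<omega> - W s \<omega>) $ j) UNIV"
    and W_increment_normal:
      "0 \<le> s \<Longrightarrow> s < t \<Longrightarrow>
        distributed M lborel (\<lambda>\<omega>. (W t \<omega> - W s \<omega>) $ j) (normal_density 0 (sqrt (t - s)))"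

section \<open>It\^o integral\<close>

text \<open>Simple integrands \<open>\<Sum>j<N. \<xi> j \<cdot> 1\<^bsub>(p j, p (j+1)]\<^esub>\<close> with \<open>\<xi> j\<close> bounded and
  \<open>F (p j)\<close>-measurable, and their elementary stochastic integrals over \<open>[0,t]\<close>.\<close>

definition simple_integrand ::
  "'w measure \<Rightarrow> (real \<Rightarrow> 'w measure) \<Rightarrow> nat \<Rightarrow> (nat \<Rightarrow> real) \<Rightarrow> (nat \<Rightarrow> 'w \<Rightarrow> real^'m^'n) \<Rightarrow> bool" where
  "simple_integrand M F N p \<xi> \<longleftrightarrow>
    0 \<le> p 0 \<and> (\<forall>j<N. p j \<le> p (Suc j)) \<and>
    (\<forall>j<N. \<xi> j \<in> borel_measurable (F (p j)) \<and> (\<exists>B. \<forall>\<omega>\<in>space M. norm (\<xi> j \<omega>) \<le> B))"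

definition simple_process ::
  "nat \<Rightarrow> (nat \<Rightarrow> real) \<Rightarrow> (nat \<Rightarrow> 'w \<Rightarrow> real^'m^'n) \<Rightarrow> real \<Rightarrow> 'w \<Rightarrow> real^'m^'n" where
  "simple_process N p \<xi> t \<omega> = (\<Sum>j<N. indicator {p j<..p (Suc j)} t *\<^sub>R \<xi> j \<omega>)"

definition simple_integral ::
  "(real \<Rightarrow> 'w \<Rightarrow> real^'m) \<Rightarrow> nat \<Rightarrow> (nat \<Rightarrow> real) \<Rightarrow> (nat \<Rightarrow> 'w \<Rightarrow> real^'m^'n) \<Rightarrow>
    real \<Rightarrow> 'w \<Rightarrow> real^'n" where
  "simple_integral W N p \<xi> t \<omega> =
    (\<Sum>j<N. \<xi> j \<omega> *v (W (min t (p (Suc j))) \<omega> - W (min t (p j)) \<omega>))"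

text \<open>Measurability is part of the notion, since \<^const>\<open>measure\<close> vanishes on non-measurable sets.\<close>

definition tendsto_0_in_prob :: "'w measure \<Rightarrow> (nat \<Rightarrow> 'w \<Rightarrow> ennreal) \<Rightarrow> bool" where
  "tendsto_0_in_prob M Z \<longleftrightarrow>
    (\<forall>k. Z k \<in> borel_measurable M) \<and>
    (\<forall>\<epsilon>>0. (\<lambda>k. measure M {\<omega> \<in> space M. Z k \<omega> > ennreal \<epsilon>}) \<longlonglongrightarrow> 0)"

text \<open>\<open>is_ito_integral M F W H I\<close>: the continuous adapted process \<open>I\<close> is
  \<open>\<integral>\<^sub>0\<^sup>t H dW\<close>, i.e. the limit, uniformly on compact time intervals in probability, of the
  elementary integrals of simple integrands \<open>H\<^sub>k\<close> with \<open>\<integral>\<^sub>0\<^sup>T |H\<^sub>k - H|\<^sup>2 ds \<rightarrow> 0\<close> in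
  probability for every \<open>T\<close>. The norm on matrices is the Frobenius norm.\<close>

definition is_ito_integral ::
  "'w measure \<Rightarrow> (real \<Rightarrow> 'w measure) \<Rightarrow> (real \<Rightarrow> 'w \<Rightarrow> real^'m) \<Rightarrow>
    (real \<Rightarrow> 'w \<Rightarrow> real^'m^'n) \<Rightarrow> (real \<Rightarrow> 'w \<Rightarrow> real^'n) \<Rightarrow> bool" where
  "is_ito_integral M F W H I \<longleftrightarrow>
    adapted F H \<and> (AE \<omega> in M. set_borel_measurable lborel {0..} (\<lambda>s. H s \<omega>)) \<and>
    adapted F I \<and> as_continuous M I \<and>
    (\<exists>N p \<xi>. (\<forall>k. simple_integrand M F (N k) (p k) (\<xi> k)) \<and>
      (\<forall>T\<ge>0.
        tendsto_0_in_prob M (\<lambda>k \<omega>. \<integral>\<^sup>+s\<in>{0..T}.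
          ennreal ((norm (simple_process (N k) (p k) (\<xi> k) s \<omega> - H s \<omega>))\<^sup>2) \<partial>lborel) \<and>
        tendsto_0_in_prob M (\<lambda>k \<omega>. SUP t\<in>{0..T}.
          ennreal (norm (simple_integral W (N k) (p k) (\<xi> k) t \<omega> - I t \<omega>)))))"

section \<open>Controlled stochastic differential equation\<close>

text \<open>\<open>x\<close> is a global (strong) solution of \<open>dx = f(x,u) dt + g(x) dW\<close>, \<open>x(0) = \<phi>\<close>.\<close>

definition sde_solution ::
  "'w measure \<Rightarrow> (real \<Rightarrow> 'w measure) \<Rightarrow> (real \<Rightarrow> 'w \<Rightarrow> real^'m) \<Rightarrow>
    (real^'n \<Rightarrow> real^'l \<Rightarrow> real^'n) \<Rightarrow> (real^'n \<Rightarrow> real^'m^'n) \<Rightarrow> real^'n \<Rightarrow>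
    (real \<Rightarrow> 'w \<Rightarrow> real^'l) \<Rightarrow> (real \<Rightarrow> 'w \<Rightarrow> real^'n) \<Rightarrow> bool" where
  "sde_solution M F W f g \<phi> u x \<longleftrightarrow>
    adapted F x \<and> as_continuous M x \<and>
    (AE \<omega> in M. \<forall>t\<ge>0. set_integrable lborel {0..t} (\<lambda>s. f (x s \<omega>) (u s \<omega>))) \<and>
    (\<exists>I. is_ito_integral M F W (\<lambda>s \<omega>. g (x s \<omega>)) I \<and>
      (AE \<omega> in M. \<forall>t\<ge>0. x t \<omega> = \<phi> + (LINT s:{0..t}|lborel. f (x s \<omega>) (u s \<omega>)) + I t \<omega>))"

text \<open>Event times of a path \<open>y\<close>, with values in \<^typ>\<open>ereal\<close> so that \<^prop>\<open>Inf {} = (\<infinity>::ereal)\<close>: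
  \<open>start_time \<dots> i\<close> is \<open>t\<^sub>i\<close> and \<open>stop_time \<dots> i\<close> is \<open>s\<^sub>i\<close>.\<close>

definition next_stop :: "real \<Rightarrow> real \<Rightarrow> real \<Rightarrow> (real \<Rightarrow> real^'n) \<Rightarrow> ereal \<Rightarrow> ereal" where
  "next_stop \<tau> lam M2 y a =
    Inf {ereal t |t. ereal t > a + ereal \<tau> \<and> (norm (y t))\<^sup>2 \<le> M2 * exp (- lam * t)}"

definition next_start :: "real \<Rightarrow> real \<Rightarrow> (real \<Rightarrow> real^'n) \<Rightarrow> ereal \<Rightarrow> ereal" where
  "next_start lam M1 y a =
    Inf {ereal t |t. ereal t > a \<and> (norm (y t))\<^sup>2 \<ge> M1 * exp (- lam * t)}"

primrec start_time ::
  "real \<Rightarrow> real \<Rightarrow> real \<Rightarrow> real \<Rightarrow> (real \<Rightarrow> real^'n) \<Rightarrow> nat \<Rightarrow> ereal" where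
  "start_time \<tau> lam M1 M2 y 0 = 0"
| "start_time \<tau> lam M1 M2 y (Suc i) =
    next_start lam M1 y (next_stop \<tau> lam M2 y (start_time \<tau> lam M1 M2 y i))"

definition stop_time ::
  "real \<Rightarrow> real \<Rightarrow> real \<Rightarrow> real \<Rightarrow> (real \<Rightarrow> real^'n) \<Rightarrow> nat \<Rightarrow> ereal" where
  "stop_time \<tau> lam M1 M2 y i = next_stop \<tau> lam M2 y (start_time \<tau> lam M1 M2 y i)"

text \<open>For \<open>\<tau> > 0\<close> the intervals below partition \<open>[0,\<infinity>)\<close>, because
  \<open>t\<^sub>i\<^sub>+\<^sub>1 \<ge> s\<^sub>i \<ge> t\<^sub>i + \<tau>\<close>; so \<open>u\<close> is determined by \<open>x\<close> at all times \<open>t \<ge> 0\<close>.\<close>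

definition switching_control ::
  "'w measure \<Rightarrow> (real^'n \<Rightarrow> real^'l) \<Rightarrow> (real^'n \<Rightarrow> real^'l) \<Rightarrow>
    real \<Rightarrow> real \<Rightarrow> real \<Rightarrow> real \<Rightarrow>
    (real \<Rightarrow> 'w \<Rightarrow> real^'n) \<Rightarrow> (real \<Rightarrow> 'w \<Rightarrow> real^'l) \<Rightarrow> bool" where
  "switching_control M k1 k2 \<tau> lam M1 M2 x u \<longleftrightarrow>
    (\<forall>\<omega>\<in>space M. \<forall>t\<ge>0. \<forall>i.
      let y = (\<lambda>s. x s \<omega>) in
      (start_time \<tau> lam M1 M2 y i \<le> ereal t \<and> ereal t < stop_time \<tau> lam M1 M2 y i
        \<longrightarrow> u t \<omega> = k1 (x t \<omega>)) \<and>
      (stop_time \<tau> lam M1 M2 y i \<le> ereal t \<and> ereal t < start_time \<tau> lam M1 M2 y (Suc i)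
        \<longrightarrow> u t \<omega> = k2 (x t \<omega>)))"

definition closed_loop_solution ::
  "'w measure \<Rightarrow> (real \<Rightarrow> 'w measure) \<Rightarrow> (real \<Rightarrow> 'w \<Rightarrow> real^'m) \<Rightarrow>
    (real^'n \<Rightarrow> real^'l \<Rightarrow> real^'n) \<Rightarrow> (real^'n \<Rightarrow> real^'m^'n) \<Rightarrow> real^'n \<Rightarrow>
    (real^'n \<Rightarrow> real^'l) \<Rightarrow> (real^'n \<Rightarrow> real^'l) \<Rightarrow> real \<Rightarrow> real \<Rightarrow> real \<Rightarrow> real \<Rightarrow>
    (real \<Rightarrow> 'w \<Rightarrow> real^'n) \<Rightarrow> bool" where
  "closed_loop_solution M F W f g \<phi> k1 k2 \<tau> lam M1 M2 x \<longleftrightarrow>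
    (\<exists>u. switching_control M k1 k2 \<tau> lam M1 M2 x u \<and> sde_solution M F W f g \<phi> u x)"

definition mean_square_exp_stable :: "'w measure \<Rightarrow> (real \<Rightarrow> 'w \<Rightarrow> real^'n) \<Rightarrow> bool" where
  "mean_square_exp_stable M x \<longleftrightarrow>
    (\<exists>K>0. \<exists>\<theta>>0. \<forall>t\<ge>0.
      integrable M (\<lambda>\<omega>. (norm (x t \<omega>))\<^sup>2) \<and>
      (\<integral>\<omega>. (norm (x t \<omega>))\<^sup>2 \<partial>M) \<le> K * exp (- \<theta> * t))"

section \<open>Smooth functions and the It\^o operator\<close>

abbreviation locally_lipschitz :: "('a::metric_space \<Rightarrow> 'b::metric_space) \<Rightarrow> bool" where
  "locally_lipschitz h \<equiv> local_lipschitz (UNIV :: real set) UNIV (\<lambda>_. h)"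

definition gradient :: "(real^'n \<Rightarrow> real) \<Rightarrow> real^'n \<Rightarrow> real^'n" where
  "gradient V x = (\<chi> i. frechet_derivative V (at x) (axis i 1))"

definition hessian :: "(real^'n \<Rightarrow> real) \<Rightarrow> real^'n \<Rightarrow> real^'n^'n" where
  "hessian V x = jacobian (gradient V) (at x)"

definition C2 :: "(real^'n \<Rightarrow> real) \<Rightarrow> bool" where
  "C2 V \<longleftrightarrow> (\<forall>x. V differentiable (at x)) \<and> (\<forall>x. gradient V differentiable (at x)) \<and>
    continuous_on UNIV (hessian V)"

definition ito_operator ::
  "(real^'n \<Rightarrow> real^'l \<Rightarrow> real^'n) \<Rightarrow> (real^'n \<Rightarrow> real^'m^'n) \<Rightarrow> (real^'n \<Rightarrow> real) \<Rightarrow>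
    real^'n \<Rightarrow> real^'l \<Rightarrow> real" where
  "ito_operator f g V x u =
    gradient V x \<bullet> f x u + 1/2 * trace (transpose (g x) ** hessian V x ** g x)"

end

theory Submission
  imports Defs
begin

text \<open>Both modes obey one and the same dissipation inequality. While \<open>k1\<close> is active it is the first
assumption on \<open>V\<close>. While \<open>k2\<close> is active, \<open>V\<close> may grow, but the triggering rule keeps
\<open>|x(t)|\<^sup>2 \<le> M1 exp (- lam t)\<close>, so the growth rate \<open>c3 |x|\<^sup>2\<close> is itself exponentially small and
equals a dissipation \<open>- \<mu> |x|\<^sup>2\<close> up to an error \<open>(c3 + \<mu>) |x|\<^sup>2\<close> of order \<open>exp (- lam t)\<close>. Since
\<open>lam \<le> \<mu> / c2\<close> and, if \<open>Mbar > 0\<close>, \<open>lam \<le> lbar\<close>, along every path and at every time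
\<open>L V (x(t), u(t)) + lam V (x(t)) \<le> C exp (- lam t)\<close> (\<open>closed_loop_generator_bound\<close>).
The switching times do not occur in this inequality, so no conditioning on them is required.
Heuristically, Ito's formula for \<open>exp (lam t) V (x(t))\<close> now gives
\<open>E V (x(t)) \<le> exp (- lam t) (V \<phi> + C t)\<close>; the linear factor is absorbed by halving the rate,
and \<open>c1 |x|\<^sup>2 \<le> V\<close> transfers the bound to the second moment.\<close>

text \<open>The expectation bound (\<open>lyapunov_expectation_bound\<close>) is derived from the definition of the stochastic
integral, without Ito's formula. Let \<open>J\<close> be the elementary integral of a simple integrand \<open>H\<close> close to
\<open>g (x)\<close>, and let \<open>Y = x - I + J\<close>, which has the drift of \<open>x\<close> but the noise of \<open>H\<close>. On a
grid that refines the partition of \<open>H\<close>, each increment of \<open>J\<close> is a matrix \<open>\<eta>\<close> known at the left end point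
times an increment of \<open>W\<close> independent of the past. A second-order Taylor expansion of \<open>V\<close> over one grid cell then
uses only the Gaussian moments of that increment: the linear noise term has mean zero, the
quadratic one has mean \<open>trace (transpose \<eta> ** hessian V ** \<eta>)\<close> times the cell length, and
the remainder is of higher order (\<open>step_pointwise\<close>, \<open>step_expectation\<close>).\<close>

text \<open>Localisation replaces stopping times. The event \<open>\<Gamma> j\<close>, measurable at the \<open>j\<close>-th grid time and
decreasing in \<open>j\<close>, says that until then \<open>x\<close> is bounded and oscillates little on the cells, \<open>J\<close> is
close to \<open>I\<close>, and \<open>H\<close> is close to \<open>g (x)\<close> in mean square over time. As \<open>V \<ge> 0\<close>, multiplying
\<open>V (Y)\<close> by the indicator of \<open>\<Gamma> j\<close> can only lower later values, which is the right direction for an upper bound,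
and on \<open>\<Gamma> j\<close> the point \<open>Y\<close> is close to \<open>x\<close>, so that the dissipation inequality can be
used at \<open>Y\<close>. A discrete Gronwall argument adds up the cells; finally the last event has probability
close to 1 when the bound on \<open>x\<close>, the integrand \<open>H\<close> and the mesh are chosen in this order
(\<open>truncated_bound\<close>), and monotone convergence removes the truncation of \<open>V\<close>.\<close>

section \<open>Switching times and the closed-loop generator\<close>

text \<open>The dwell time makes the \<open>i\<close>-th start time at least \<open>i \<tau>\<close>, which rules out an accumulation of switches.\<close>

lemma start_stop_bounds:
  assumes "\<tau> > 0"
  shows "ereal (real i * \<tau>) \<le> start_time \<tau> lam M1 M2 y i"
    and "start_time \<tau> lam M1 M2 y i + ereal \<tau> \<le> stop_time \<tau> lam M1 M2 y i"
proof -
  have stop: "start_time \<tau> lam M1 M2 y i + ereal \<tau> \<le> stop_time \<tau> lam M1 M2 y i" for i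
    unfolding stop_time_def next_stop_def by (rule Inf_greatest) auto
  then show "start_time \<tau> lam M1 M2 y i + ereal \<tau> \<le> stop_time \<tau> lam M1 M2 y i" .
  show "ereal (real i * \<tau>) \<le> start_time \<tau> lam M1 M2 y i"
  proof (induction i)
    case (Suc i)
    have "ereal (real (Suc i) * \<tau>) = ereal (real i * \<tau>) + ereal \<tau>"
      by (simp add: algebra_simps)
    also have "\<dots> \<le> start_time \<tau> lam M1 M2 y i + ereal \<tau>"
      using Suc by (rule add_right_mono)
    also have "\<dots> \<le> stop_time \<tau> lam M1 M2 y i" by (rule stop)
    also have "\<dots> \<le> start_time \<tau> lam M1 M2 y (Suc i)"
      unfolding start_time.simps next_start_def stop_time_def by (rule Inf_greatest) auto
    finally show ?case .
  qed simp
qed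

text \<open>Since the start times tend to infinity, there is a last one not exceeding \<open>t\<close>; the mode at time \<open>t\<close>
then depends on whether the following stop time has already passed.\<close>

lemma ex_current_mode:
  assumes "\<tau> > 0" "t \<ge> 0"
  shows "\<exists>i. (start_time \<tau> lam M1 M2 y i \<le> ereal t \<and> ereal t < stop_time \<tau> lam M1 M2 y i) \<or>
    (stop_time \<tau> lam M1 M2 y i \<le> ereal t \<and> ereal t < start_time \<tau> lam M1 M2 y (Suc i))"
proof -
  let ?P = "\<lambda>i. start_time \<tau> lam M1 M2 y i \<le> ereal t"
  obtain n where n: "t / \<tau> < real n" using reals_Archimedean2 by blast
  have "\<not> ?P n"
  proof -
    have "t < real n * \<tau>" using n assms by (simp add: field_simps)
    then show ?thesis
      using start_stop_bounds(1)[OF assms(1), of n lam M1 M2 y]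
      by (metis ereal_less_eq(3) linorder_not_less order_trans)
  qed
  then have ex: "\<exists>n. \<not> ?P n" by blast
  define m where "m = (LEAST n. \<not> ?P n)"
  have m: "\<not> ?P m" unfolding m_def using LeastI_ex[OF ex] .
  have "?P 0" using assms by simp
  with m obtain i where i: "m = Suc i" by (cases m) auto
  have "?P i" using not_less_Least[of i "\<lambda>n. \<not> ?P n"] i unfolding m_def by auto
  then show ?thesis using m unfolding i by (meson not_le)
qed

text \<open>Strictly after the stop time the bound is the negation of the starting criterion. At the stop time itself it
needs continuity: the infimum is a limit of times at which the stopping criterion holds, so the criterion, being a
closed condition, holds there with \<open>M2 \<le> M1\<close>.\<close>

lemma off_mode_small:
  fixes y :: "real \<Rightarrow> real^'n"
  assumes cont: "continuous_on {0..} y" and "\<tau> > 0" "M2 \<le> M1"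
    and s: "stop_time \<tau> lam M1 M2 y i \<le> ereal t" and t: "ereal t < start_time \<tau> lam M1 M2 y (Suc i)"
  shows "(norm (y t))\<^sup>2 \<le> M1 * exp (- lam * t)"
proof (cases "stop_time \<tau> lam M1 M2 y i < ereal t")
  case True
  have "\<not> (norm (y t))\<^sup>2 \<ge> M1 * exp (- lam * t)"
  proof
    assume "(norm (y t))\<^sup>2 \<ge> M1 * exp (- lam * t)"
    then have "start_time \<tau> lam M1 M2 y (Suc i) \<le> ereal t"
      using True unfolding start_time.simps next_start_def stop_time_def
      by (intro Inf_lower) auto
    with t show False by simp
  qed
  then show ?thesis by simp
next
  case False
  with s have eq: "stop_time \<tau> lam M1 M2 y i = ereal t" by simp
  define S where "S = {r. ereal r > start_time \<tau> lam M1 M2 y i + ereal \<tau> \<and> (norm (y r))\<^sup>2 \<le> M2 * exp (- lam * r)}"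
  have Inf_S: "Inf (ereal ` S) = ereal t"
  proof -
    have "ereal ` S = {ereal r |r. ereal r > start_time \<tau> lam M1 M2 y i + ereal \<tau> \<and>
        (norm (y r))\<^sup>2 \<le> M2 * exp (- lam * r)}"
      unfolding S_def by blast
    then show ?thesis using eq unfolding stop_time_def next_stop_def by presburger
  qed
  have pos: "r \<ge> 0" if "r \<in> S" for r
  proof -
    have "ereal 0 \<le> start_time \<tau> lam M1 M2 y i + ereal \<tau>"
    proof -
      have "ereal 0 \<le> ereal (real i * \<tau>) + ereal \<tau>" using assms(2) by simp
      also have "\<dots> \<le> start_time \<tau> lam M1 M2 y i + ereal \<tau>"
        using start_stop_bounds(1)[OF assms(2)] by (rule add_right_mono)
      finally show ?thesis .
    qed
    also have "\<dots> < ereal r" using that unfolding S_def by simp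
    finally show ?thesis by simp
  qed
  have "\<exists>r\<in>S. r \<ge> t \<and> r < t + inverse (real (Suc n))" for n
  proof -
    have "Inf (ereal ` S) < ereal (t + inverse (real (Suc n)))" unfolding Inf_S by simp
    then obtain r where r: "r \<in> S" "r < t + inverse (real (Suc n))"
      unfolding Inf_less_iff by auto
    have "ereal t \<le> ereal r" unfolding Inf_S[symmetric] using r by (intro Inf_lower) auto
    with r show ?thesis by auto
  qed
  then obtain r where r: "\<And>n. r n \<in> S" "\<And>n. r n \<ge> t" "\<And>n. r n < t + inverse (real (Suc n))"
    by metis
  have r_lim: "r \<longlonglongrightarrow> t"
  proof (rule tendsto_sandwich[of "\<lambda>_. t" r sequentially "\<lambda>n. t + inverse (real (Suc n))"])
    show "(\<lambda>n. t + inverse (real (Suc n))) \<longlonglongrightarrow> t"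
      using LIMSEQ_inverse_real_of_nat_add[of t] by simp
  qed (use r in \<open>auto intro!: always_eventually less_imp_le\<close>)
  have t0: "t \<ge> 0" using r_lim r(1) pos by (meson LIMSEQ_le_const)
  have y_lim: "(\<lambda>n. y (r n)) \<longlonglongrightarrow> y t"
    using continuous_on_tendsto_compose[OF cont r_lim] t0 r(1) pos by auto
  have "(norm (y t))\<^sup>2 \<le> M2 * exp (- lam * t)"
  proof (rule LIMSEQ_le)
    show "(\<lambda>n. (norm (y (r n)))\<^sup>2) \<longlonglongrightarrow> (norm (y t))\<^sup>2"
      by (intro tendsto_intros y_lim)
    show "(\<lambda>n. M2 * exp (- lam * r n)) \<longlonglongrightarrow> M2 * exp (- lam * t)"
      by (intro tendsto_intros r_lim)
    show "\<exists>N. \<forall>n\<ge>N. (norm (y (r n)))\<^sup>2 \<le> M2 * exp (- lam * r n)"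
      using r(1) unfolding S_def by auto
  qed
  also have "\<dots> \<le> M1 * exp (- lam * t)" using assms(3) by simp
  finally show ?thesis .
qed

text \<open>In the first mode the dissipation \<open>\<mu> |x|\<^sup>2\<close> dominates \<open>lam V\<close> because \<open>V \<le> c2 |x|\<^sup>2\<close> and \<open>lam \<le> \<mu> / c2\<close>. In the
second mode \<open>c3 |x|\<^sup>2\<close> and \<open>lam V\<close> together are at most \<open>(c3 + \<mu>) |x|\<^sup>2\<close>, and \<open>|x|\<^sup>2\<close> is exponentially small.
The constants enter through \<open>\<bar>c3\<bar>\<close> and \<open>\<bar>M1\<bar>\<close> so that one nonnegative coefficient serves both modes.\<close>

lemma closed_loop_generator_bound:
  fixes V :: "real^'n \<Rightarrow> real" and f :: "real^'n \<Rightarrow> real^'l \<Rightarrow> real^'n" and g :: "real^'n \<Rightarrow> real^'m^'n"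
  assumes "\<tau> > 0" "M2 \<le> M1"
    and cont: "continuous_on {0..} y" and t: "0 \<le> t"
    and on: "\<And>i. start_time \<tau> lam M1 M2 y i \<le> ereal t \<Longrightarrow> ereal t < stop_time \<tau> lam M1 M2 y i \<Longrightarrow> v = k1 (y t)"
    and off: "\<And>i. stop_time \<tau> lam M1 M2 y i \<le> ereal t \<Longrightarrow> ereal t < start_time \<tau> lam M1 M2 y (Suc i) \<Longrightarrow> v = k2 (y t)"
    and V: "c2 > 0" "\<And>x. 0 \<le> V x" "\<And>x. V x \<le> c2 * (norm x)\<^sup>2"
    and \<mu>: "\<mu> > 0" and Mbar: "Mbar \<ge> 0" "Mbar > 0 \<Longrightarrow> lam \<le> lbar" and rate: "lam \<le> \<mu> / c2"
    and gen: "\<And>x. ito_operator f g V x (k1 x) \<le> - \<mu> * (norm x)\<^sup>2 + Mbar * exp (- lbar * t)"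
      "\<And>x. ito_operator f g V x (k2 x) \<le> c3 * (norm x)\<^sup>2"
  shows "ito_operator f g V (y t) v + lam * V (y t) \<le> (Mbar + (\<bar>c3\<bar> + \<mu>) * \<bar>M1\<bar>) * exp (- lam * t)"
    and "v = k1 (y t) \<or> v = k2 (y t)"
proof -
  have decay: "lam * V x \<le> \<mu> * (norm x)\<^sup>2" for x
  proof -
    have "lam * V x \<le> \<mu> / c2 * V x" using rate V by (intro mult_right_mono) auto
    also have "\<dots> \<le> \<mu> / c2 * (c2 * (norm x)\<^sup>2)" using \<mu> V by (intro mult_left_mono) auto
    finally show ?thesis using V(1) by simp
  qed
  have e: "0 \<le> (\<bar>c3\<bar> + \<mu>) * \<bar>M1\<bar> * exp (- lam * t)" using \<mu> by auto
  obtain i where "(start_time \<tau> lam M1 M2 y i \<le> ereal t \<and> ereal t < stop_time \<tau> lam M1 M2 y i) \<or>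
    (stop_time \<tau> lam M1 M2 y i \<le> ereal t \<and> ereal t < start_time \<tau> lam M1 M2 y (Suc i))"
    using ex_current_mode[OF assms(1) t] by blast
  then have "ito_operator f g V (y t) v + lam * V (y t) \<le> (Mbar + (\<bar>c3\<bar> + \<mu>) * \<bar>M1\<bar>) * exp (- lam * t)
    \<and> (v = k1 (y t) \<or> v = k2 (y t))"
  proof
    assume mode: "start_time \<tau> lam M1 M2 y i \<le> ereal t \<and> ereal t < stop_time \<tau> lam M1 M2 y i"
    have "Mbar * exp (- lbar * t) \<le> Mbar * exp (- lam * t)"
      using Mbar t by (cases "Mbar = 0") (auto intro!: mult_left_mono mult_right_mono)
    then show ?thesis
      using gen(1)[of "y t"] decay[of "y t"] on[of i] mode e by (simp add: distrib_right)
  next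
    assume mode: "stop_time \<tau> lam M1 M2 y i \<le> ereal t \<and> ereal t < start_time \<tau> lam M1 M2 y (Suc i)"
    have small: "(norm (y t))\<^sup>2 \<le> M1 * exp (- lam * t)"
      using off_mode_small[OF cont assms(1,2)] mode by blast
    have "ito_operator f g V (y t) v + lam * V (y t) \<le> (c3 + \<mu>) * (norm (y t))\<^sup>2"
      using gen(2)[of "y t"] decay[of "y t"] off[of i] mode by (simp add: distrib_right)
    also have "\<dots> \<le> (\<bar>c3\<bar> + \<mu>) * (norm (y t))\<^sup>2" by (intro mult_right_mono) auto
    also have "\<dots> \<le> (\<bar>c3\<bar> + \<mu>) * (\<bar>M1\<bar> * exp (- lam * t))"
    proof (intro mult_left_mono order_trans[OF small] mult_right_mono)
      show "0 \<le> \<bar>c3\<bar> + \<mu>" using \<mu> by simp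
    qed auto
    also have "\<dots> \<le> (Mbar + (\<bar>c3\<bar> + \<mu>) * \<bar>M1\<bar>) * exp (- lam * t)"
      using Mbar(1) by (simp add: distrib_right)
    finally show ?thesis using off[of i] mode by blast
  qed
  then show "ito_operator f g V (y t) v + lam * V (y t) \<le> (Mbar + (\<bar>c3\<bar> + \<mu>) * \<bar>M1\<bar>) * exp (- lam * t)"
    and "v = k1 (y t) \<or> v = k2 (y t)" by auto
qed

section \<open>Quadratic forms and second-order Taylor bounds\<close>

lemma norm_matrix_vector_mult_le:
  fixes A :: "real^'m^'n"
  shows "norm (A *v z) \<le> norm A * norm z"
proof -
  have "norm (A *v z) = L2_set (\<lambda>i. norm ((A *v z) $ i)) UNIV" by (simp add: norm_vec_def)
  also have "\<dots> \<le> L2_set (\<lambda>i. norm (A $ i) * norm z) UNIV"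
    by (intro L2_set_mono) (auto simp: matrix_vector_mul_component Cauchy_Schwarz_ineq2)
  also have "\<dots> = norm A * norm z"
    by (simp add: norm_vec_def L2_set_left_distrib)
  finally show ?thesis .
qed

lemma inner_matrix_vector_le:
  fixes A :: "real^'m^'n"
  shows "\<bar>u \<bullet> (A *v z)\<bar> \<le> norm A * norm u * norm z"
proof -
  have "\<bar>u \<bullet> (A *v z)\<bar> \<le> norm u * norm (A *v z)" by (rule Cauchy_Schwarz_ineq2)
  also have "\<dots> \<le> norm u * (norm A * norm z)"
    by (intro mult_left_mono norm_matrix_vector_mult_le) auto
  finally show ?thesis by (simp add: ac_simps)
qed

lemma norm_column_le:
  fixes A :: "real^'m^'n"
  shows "norm (column j A) \<le> norm A"
proof -
  have "norm (column j A) = L2_set (\<lambda>i. norm (A $ i $ j)) UNIV" by (simp add: norm_vec_def column_def)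
  also have "\<dots> \<le> L2_set (\<lambda>i. norm (A $ i)) UNIV"
    by (intro L2_set_mono) (auto simp: component_le_norm_cart)
  finally show ?thesis by (simp add: norm_vec_def)
qed

lemma column_diff: "column j (A - B) = column j A - column j (B :: 'a::ab_group_add^'m^'n)"
  by (simp add: column_def vec_eq_iff)

text \<open>The columns of \<open>A\<close> are the directions excited by the single noise components, so this writes the second-order
term of the generator as a sum of second directional derivatives.\<close>

lemma trace_quadratic_eq_columns:
  fixes A :: "real^'m^'n" and H :: "real^'n^'n"
  shows "trace (transpose A ** H ** A) = (\<Sum>j\<in>UNIV. column j A \<bullet> (H *v column j A))"
proof -
  have "(transpose A ** H ** A) $ j $ j = column j A \<bullet> (H *v column j A)" for j
    unfolding matrix_mul_assoc[symmetric]
    by (simp add: matrix_matrix_mult_def transpose_def inner_vec_def column_def matrix_vector_mult_def)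
  then show ?thesis by (simp add: trace_def)
qed

lemma abs_trace_quadratic_le:
  fixes A :: "real^'m^'n" and H :: "real^'n^'n"
  shows "\<bar>trace (transpose A ** H ** A)\<bar> \<le> real CARD('m) * (norm H * (norm A)\<^sup>2)"
proof -
  have "\<bar>trace (transpose A ** H ** A)\<bar> \<le> (\<Sum>j\<in>(UNIV::'m set). norm H * (norm A)\<^sup>2)"
    unfolding trace_quadratic_eq_columns
  proof (rule order_trans[OF sum_abs], rule sum_mono)
    fix j :: 'm
    have "\<bar>column j A \<bullet> (H *v column j A)\<bar> \<le> norm H * norm (column j A) * norm (column j A)"
      by (rule inner_matrix_vector_le)
    also have "\<dots> \<le> norm H * norm A * norm A"
      by (intro mult_mono norm_column_le mult_nonneg_nonneg) auto
    finally show "\<bar>column j A \<bullet> (H *v column j A)\<bar> \<le> norm H * (norm A)\<^sup>2"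
      by (simp add: power2_eq_square ac_simps)
  qed
  then show ?thesis by simp
qed

lemma matrix_vector_mult_columns:
  fixes A :: "real^'k^'n"
  shows "A *v v = (\<Sum>k\<in>UNIV. (v $ k) *\<^sub>R column k A)"
  by (simp add: matrix_mult_sum scalar_mult_eq_scaleR)

lemma column_measurable[measurable (raw)]:
  "f \<in> borel_measurable N \<Longrightarrow> (\<lambda>\<omega>. column k (f \<omega> :: real^'k^'n)) \<in> borel_measurable N"
  by (rule measurable_compose[of f N borel], assumption, rule borel_measurable_continuous_onI)
    (auto simp: column_def intro!: continuous_intros)

lemma matrix_vector_mult_measurable[measurable (raw)]:
  fixes f :: "'a \<Rightarrow> real^'k^'n"
  assumes "f \<in> borel_measurable N" "v \<in> borel_measurable N"
  shows "(\<lambda>\<omega>. f \<omega> *v v \<omega>) \<in> borel_measurable N"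
proof -
  have "(\<lambda>p. fst p *v snd p :: real^'n) \<in> borel_measurable (borel \<Otimes>\<^sub>M borel)"
    unfolding borel_prod by (rule borel_measurable_continuous_onI)
      (auto simp: matrix_vector_mult_def intro!: continuous_intros)
  then show ?thesis using assms
    by (auto intro!: measurable_compose[of "\<lambda>\<omega>. (f \<omega>, v \<omega>)" N "borel \<Otimes>\<^sub>M borel" "\<lambda>p. fst p *v snd p" borel, simplified])
qed

context
  fixes V :: "real^'n \<Rightarrow> real"
  assumes C2: "C2 V"
begin

lemma C2_has_derivative: "(V has_derivative (\<lambda>h. gradient V x \<bullet> h)) (at x)"
proof -
  let ?D = "frechet_derivative V (at x)"
  have D: "(V has_derivative ?D) (at x)"
    using C2 unfolding C2_def by (simp add: frechet_derivative_works[symmetric])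
  then have lin: "linear ?D" by (rule has_derivative_linear)
  have "?D = (\<lambda>h. gradient V x \<bullet> h)"
  proof
    fix h :: "real^'n"
    have "?D h = ?D (\<Sum>i\<in>UNIV. (h $ i) *\<^sub>R axis i 1)"
      by (simp add: basis_expansion[of h, unfolded scalar_mult_eq_scaleR])
    also have "\<dots> = (\<Sum>i\<in>UNIV. h $ i * ?D (axis i 1))"
      by (simp add: linear_sum[OF lin] linear_scale[OF lin])
    finally show "?D h = gradient V x \<bullet> h"
      by (simp add: gradient_def inner_vec_def mult.commute)
  qed
  with D show ?thesis by simp
qed

lemma C2_gradient_has_derivative: "(gradient V has_derivative (\<lambda>h. hessian V x *v h)) (at x)"
  using C2 unfolding C2_def hessian_def by (simp add: jacobian_works[symmetric])

lemma C2_continuous: "continuous_on S V" "continuous_on S (gradient V)" "continuous_on S (hessian V)"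
  using C2 continuous_on_subset[of UNIV "hessian V" S] unfolding C2_def
  by (auto intro!: continuous_at_imp_continuous_on differentiable_imp_continuous_within)

lemma C2_Taylor:
  "\<exists>s. 0 < s \<and> s < 1 \<and> V (y + z) = V y + gradient V y \<bullet> z + (z \<bullet> (hessian V (y + s *\<^sub>R z) *v z)) / 2"
proof -
  define D :: "nat \<Rightarrow> real \<Rightarrow> real" where "D = (\<lambda>m s. if m = 0 then V (y + s *\<^sub>R z)
    else if m = 1 then gradient V (y + s *\<^sub>R z) \<bullet> z else z \<bullet> (hessian V (y + s *\<^sub>R z) *v z))"
  have line: "((\<lambda>s. y + s *\<^sub>R z) has_derivative (\<lambda>h. h *\<^sub>R z)) (at s)" for s
    by (auto intro!: derivative_eq_intros)
  have D0: "DERIV (D 0) s :> D 1 s" for s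
    using has_derivative_compose[OF line[of s] C2_has_derivative]
    by (simp add: D_def has_field_derivative_def mult_commute_abs)
  have D1: "DERIV (D 1) s :> D 2 s" for s
    using has_derivative_inner_left[OF has_derivative_compose[OF line[of s] C2_gradient_has_derivative], of z]
    by (simp add: D_def has_field_derivative_def mult_commute_abs inner_commute
        matrix_vector_mult_scaleR)
  have "\<exists>s. 0 < s \<and> s < 1 \<and> V (y + 1 *\<^sub>R z) = (\<Sum>m<2. D m 0 / fact m * 1 ^ m) + D 2 s / fact 2 * 1 ^ 2"
  proof (rule Maclaurin[of 1 2 D "\<lambda>s. V (y + s *\<^sub>R z)"])
    show "\<forall>m s. m < 2 \<and> 0 \<le> s \<and> s \<le> 1 \<longrightarrow> DERIV (D m) s :> D (Suc m) s"
    proof (intro allI impI)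
      fix m :: nat and s :: real assume "m < 2 \<and> 0 \<le> s \<and> s \<le> 1"
      then have "m = 0 \<or> m = 1" by auto
      then show "DERIV (D m) s :> D (Suc m) s"
        using D0[of s] D1[of s] by (auto simp: numeral_2_eq_2)
    qed
  qed (auto simp: D_def)
  then show ?thesis by (simp add: D_def numeral_2_eq_2)
qed

lemma C2_bounded_on_cball:
  obtains b where "b \<ge> 0" "\<And>y. norm y \<le> R \<Longrightarrow> norm (V y) \<le> b \<and> norm (gradient V y) \<le> b \<and> norm (hessian V y) \<le> b"
proof -
  have "bounded (V ` cball 0 R)" "bounded (gradient V ` cball 0 R)" "bounded (hessian V ` cball 0 R)"
    by (intro compact_imp_bounded compact_continuous_image C2_continuous compact_cball)+
  then obtain b1 b2 b3 where "\<forall>y\<in>V ` cball 0 R. norm y \<le> b1"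
    "\<forall>y\<in>gradient V ` cball 0 R. norm y \<le> b2" "\<forall>y\<in>hessian V ` cball 0 R. norm y \<le> b3"
    unfolding bounded_iff by metis
  then show ?thesis by (intro that[of "max 0 (max b1 (max b2 b3))"]) (auto simp: le_max_iff_disj simp del: real_norm_def)
qed

text \<open>Small increments are controlled by uniform continuity of the Hessian on a ball. Increments of length at least
some \<open>\<delta> > 0\<close> are not small in any sense, but \<open>V\<close> grows at most quadratically, so everything is bounded by a
multiple of the fourth power of the increment; Gaussian fourth moments make that term of second order in time.\<close>

lemma C2_Taylor_upper_bound:
  assumes growth: "\<And>x. 0 \<le> V x \<and> V x \<le> c2 * (norm x)\<^sup>2" and "\<epsilon> > 0"
  shows "\<exists>K\<ge>0. \<forall>y z. norm y \<le> R \<longrightarrow>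
    V (y + z) \<le> V y + gradient V y \<bullet> z + (z \<bullet> (hessian V y *v z)) / 2 + \<epsilon> * (norm z)\<^sup>2 + K * norm z ^ 4"
proof -
  have c2: "c2 \<ge> 0"
  proof -
    have "0 \<le> c2 * (norm (axis undefined 1 :: real^'n))\<^sup>2" using growth order_trans by blast
    then show ?thesis by (simp add: norm_axis_1)
  qed
  have "uniformly_continuous_on (cball 0 (R + 1)) (hessian V)"
    by (intro compact_uniformly_continuous C2_continuous compact_cball)
  then obtain \<delta>0 where \<delta>0: "\<delta>0 > 0" "\<And>y y'. norm y \<le> R + 1 \<Longrightarrow> norm y' \<le> R + 1 \<Longrightarrow> dist y' y < \<delta>0 \<Longrightarrow>
      dist (hessian V y') (hessian V y) < \<epsilon>"
    using \<open>\<epsilon> > 0\<close> unfolding uniformly_continuous_on_def by (auto simp: mem_cball_0)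
  obtain b where b: "b \<ge> 0" "\<And>y. norm y \<le> R \<Longrightarrow>
      norm (V y) \<le> b \<and> norm (gradient V y) \<le> b \<and> norm (hessian V y) \<le> b"
    using C2_bounded_on_cball by metis
  define \<delta> where "\<delta> = min \<delta>0 1"
  have \<delta>: "0 < \<delta>" "\<delta> \<le> 1" "\<delta> \<le> \<delta>0" using \<delta>0 unfolding \<delta>_def by auto
  define K where "K = (2 * c2 * R\<^sup>2 + 2 * c2 + b + b) / \<delta> ^ 4"
  have K: "K \<ge> 0" unfolding K_def using c2 b \<delta> by auto
  have "V (y + z) \<le> V y + gradient V y \<bullet> z + (z \<bullet> (hessian V y *v z)) / 2 + \<epsilon> * (norm z)\<^sup>2 + K * norm z ^ 4"
    if y: "norm y \<le> R" for y z
  proof (cases "norm z < \<delta>")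
    case True
    obtain s where s: "0 < s" "s < 1"
      "V (y + z) = V y + gradient V y \<bullet> z + (z \<bullet> (hessian V (y + s *\<^sub>R z) *v z)) / 2"
      using C2_Taylor by blast
    have sz: "norm (s *\<^sub>R z) \<le> norm z" using s by (simp add: mult_left_le_one_le)
    have "norm (y + s *\<^sub>R z) \<le> R + 1" using y sz True \<delta> norm_triangle_ineq[of y "s *\<^sub>R z"] by linarith
    moreover have "dist (y + s *\<^sub>R z) y < \<delta>0" using sz True \<delta> by (simp add: dist_norm)
    ultimately have "norm (hessian V (y + s *\<^sub>R z) - hessian V y) \<le> \<epsilon>"
      using \<delta>0(2)[of y "y + s *\<^sub>R z"] y by (simp add: dist_norm)
    then have "norm (hessian V (y + s *\<^sub>R z) - hessian V y) * norm z * norm z \<le> \<epsilon> * norm z * norm z"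
      by (intro mult_right_mono) auto
    then have "z \<bullet> ((hessian V (y + s *\<^sub>R z) - hessian V y) *v z) \<le> \<epsilon> * (norm z)\<^sup>2"
      using inner_matrix_vector_le[of z "hessian V (y + s *\<^sub>R z) - hessian V y" z]
      by (simp add: power2_eq_square)
    then have "z \<bullet> (hessian V (y + s *\<^sub>R z) *v z) \<le> z \<bullet> (hessian V y *v z) + \<epsilon> * (norm z)\<^sup>2"
      by (simp add: matrix_vector_mult_diff_rdistrib inner_diff_right)
    moreover have "K * norm z ^ 4 \<ge> 0" "\<epsilon> * (norm z)\<^sup>2 \<ge> 0" using K \<open>\<epsilon> > 0\<close> by auto
    ultimately show ?thesis unfolding s(3) by linarith
  next
    case False
    \<comment> \<open>in units of \<open>\<delta>\<close> the increment has length \<open>r \<ge> 1\<close>, and every lower power of \<open>r\<close> is at most \<open>r ^ 4\<close>\<close>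
    define r where "r = norm z / \<delta>"
    have r: "r \<ge> 1" using False \<delta> unfolding r_def by simp
    have zr: "norm z = \<delta> * r" unfolding r_def using \<delta> by simp
    have pw: "1 \<le> r ^ 4" "r \<le> r ^ 4" "r\<^sup>2 \<le> r ^ 4"
      using r by (auto intro: power_increasing[of 1 4 r, simplified] power_increasing)
    have zle: "norm z \<le> r" "(norm z)\<^sup>2 \<le> r\<^sup>2" 
      using \<delta> r by (auto simp: zr mult_left_le_one_le power_mult_distrib power_le_one)
    have "(norm (y + z))\<^sup>2 \<le> 2 * (norm y)\<^sup>2 + 2 * (norm z)\<^sup>2"
    proof -
      have "(norm (y + z))\<^sup>2 \<le> (norm y + norm z)\<^sup>2" by (intro power_mono norm_triangle_ineq) auto
      also have "\<dots> \<le> 2 * (norm y)\<^sup>2 + 2 * (norm z)\<^sup>2" using sum_squares_bound[of "norm y" "norm z"]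
        by (simp add: power2_sum)
      finally show ?thesis .
    qed
    also have "\<dots> \<le> 2 * R\<^sup>2 + 2 * r\<^sup>2" using y zle by (intro add_mono mult_left_mono power_mono) auto
    also have "\<dots> \<le> 2 * R\<^sup>2 * r ^ 4 + 2 * r ^ 4"
      using pw mult_left_mono[OF pw(1), of "2 * R\<^sup>2"] by simp
    finally have "c2 * (norm (y + z))\<^sup>2 \<le> c2 * (2 * R\<^sup>2 * r ^ 4 + 2 * r ^ 4)"
      using c2 by (rule mult_left_mono)
    then have "V (y + z) \<le> (2 * c2 * R\<^sup>2 + 2 * c2) * r ^ 4"
      using growth[of "y + z"] by (simp add: algebra_simps)
    moreover have "- (gradient V y \<bullet> z) \<le> b * r ^ 4"
    proof -
      have "- (gradient V y \<bullet> z) \<le> norm (gradient V y) * norm z"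
        using Cauchy_Schwarz_ineq2[of "gradient V y" z] by linarith
      also have "\<dots> \<le> b * r" using b y zle by (intro mult_mono) auto
      also have "\<dots> \<le> b * r ^ 4" using b pw by (intro mult_left_mono) auto
      finally show ?thesis .
    qed
    moreover have "- (z \<bullet> (hessian V y *v z)) / 2 \<le> b * r ^ 4"
    proof -
      have "\<bar>z \<bullet> (hessian V y *v z)\<bar> \<le> norm (hessian V y) * (norm z)\<^sup>2"
        using inner_matrix_vector_le[of z "hessian V y" z] by (simp add: power2_eq_square)
      also have "\<dots> \<le> b * r\<^sup>2" using b y zle by (intro mult_mono) auto
      also have "\<dots> \<le> b * r ^ 4" using b pw by (intro mult_left_mono) auto
      finally have "\<bar>z \<bullet> (hessian V y *v z)\<bar> \<le> b * r ^ 4" .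
      moreover have "0 \<le> b * r ^ 4" using b by simp
      ultimately show ?thesis by linarith
    qed
    moreover have "K * norm z ^ 4 = (2 * c2 * R\<^sup>2 + 2 * c2 + b + b) * r ^ 4"
      unfolding K_def zr using \<delta> by (simp add: power_mult_distrib)
    moreover have "0 \<le> V y" "0 \<le> \<epsilon> * (norm z)\<^sup>2" using growth \<open>\<epsilon> > 0\<close> by auto
    ultimately show ?thesis by (simp add: algebra_simps)
  qed
  with K show ?thesis by blast
qed

text \<open>The increment over a time step of length \<open>D\<close> splits into a drift part \<open>d\<close> of order \<open>D\<close> and a noise part \<open>G\<close>. The mixed
terms are split by Young's inequality, which puts an arbitrarily small weight on \<open>|G|\<^sup>2\<close> (whose mean is of order \<open>D\<close>)
at the price of a large weight on \<open>|d|\<^sup>2 \<le> B\<^sup>2 D\<^sup>2\<close>. The case \<open>d = 0\<close>, \<open>V \<ge> 0\<close> also bounds the right-hand side from below.\<close>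

lemma C2_Taylor_drift_noise:
  assumes growth: "\<And>x. 0 \<le> V x \<and> V x \<le> c2 * (norm x)\<^sup>2" and "\<epsilon> > 0" "B \<ge> 0"
  shows "\<exists>K\<ge>0. \<forall>y d G D. norm y \<le> R \<and> 0 \<le> D \<and> D \<le> 1 \<and> norm d \<le> B * D \<longrightarrow>
    V (y + d + G) \<le> V y + gradient V y \<bullet> d + gradient V y \<bullet> G + (G \<bullet> (hessian V y *v G)) / 2
      + \<epsilon> * (norm G)\<^sup>2 + K * norm G ^ 4 + K * D\<^sup>2"
proof -
  obtain K0 where K0: "K0 \<ge> 0" "\<And>y z. norm y \<le> R \<Longrightarrow>
      V (y + z) \<le> V y + gradient V y \<bullet> z + (z \<bullet> (hessian V y *v z)) / 2 + \<epsilon> / 4 * (norm z)\<^sup>2 + K0 * norm z ^ 4"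
    using C2_Taylor_upper_bound[OF growth, of "\<epsilon> / 4" R] \<open>\<epsilon> > 0\<close> by (auto simp del: times_divide_eq_left)
  obtain b where b: "b \<ge> 0" "\<And>y. norm y \<le> R \<Longrightarrow> norm (hessian V y) \<le> b"
    using C2_bounded_on_cball by metis
  define \<beta> where "\<beta> = b\<^sup>2 / (2 * \<epsilon>)"
  have \<beta>: "\<beta> \<ge> 0" unfolding \<beta>_def using \<open>\<epsilon> > 0\<close> by simp
  define K where "K = 8 * K0 + (\<beta> + b + \<epsilon> / 2) * B\<^sup>2 + 8 * K0 * B ^ 4"
  have K: "K \<ge> 0" unfolding K_def using K0 b \<beta> \<open>\<epsilon> > 0\<close> by auto
  have "V (y + d + G) \<le> V y + gradient V y \<bullet> d + gradient V y \<bullet> G + (G \<bullet> (hessian V y *v G)) / 2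
      + \<epsilon> * (norm G)\<^sup>2 + K * norm G ^ 4 + K * D\<^sup>2"
    if "norm y \<le> R" "0 \<le> D" "D \<le> 1" "norm d \<le> B * D" for y d G D
  proof -
    let ?H = "hessian V y" and ?z = "d + G"
    have d2: "(norm d)\<^sup>2 \<le> B\<^sup>2 * D\<^sup>2" using that(4) by (metis norm_ge_zero power_mono power_mult_distrib)
    have d4: "norm d ^ 4 \<le> B ^ 4 * D\<^sup>2"
    proof -
      have "norm d ^ 4 \<le> (B * D) ^ 4" using that(4) by (intro power_mono) auto
      also have "\<dots> = B ^ 4 * D ^ 4" by (simp add: power_mult_distrib)
      also have "\<dots> \<le> B ^ 4 * D\<^sup>2" using that \<open>B \<ge> 0\<close> by (intro mult_left_mono power_decreasing) auto
      finally show ?thesis .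
    qed
    have z2: "(norm ?z)\<^sup>2 \<le> 2 * (norm d)\<^sup>2 + 2 * (norm G)\<^sup>2"
    proof -
      have "(norm ?z)\<^sup>2 \<le> (norm d + norm G)\<^sup>2" by (intro power_mono norm_triangle_ineq) auto
      also have "\<dots> \<le> 2 * (norm d)\<^sup>2 + 2 * (norm G)\<^sup>2" using sum_squares_bound[of "norm d" "norm G"]
        by (simp add: power2_sum)
      finally show ?thesis .
    qed
    have z4: "norm ?z ^ 4 \<le> 8 * norm d ^ 4 + 8 * norm G ^ 4"
    proof -
      have "norm ?z ^ 4 = ((norm ?z)\<^sup>2)\<^sup>2" by (simp flip: power_mult)
      also have "\<dots> \<le> (2 * (norm d)\<^sup>2 + 2 * (norm G)\<^sup>2)\<^sup>2" by (intro power_mono z2) auto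
      also have "\<dots> = 4 * (((norm d)\<^sup>2)\<^sup>2 + ((norm G)\<^sup>2)\<^sup>2 + 2 * (norm d)\<^sup>2 * (norm G)\<^sup>2)"
        by (simp add: power2_eq_square algebra_simps)
      also have "\<dots> \<le> 8 * ((norm d)\<^sup>2)\<^sup>2 + 8 * ((norm G)\<^sup>2)\<^sup>2"
        using sum_squares_bound[of "(norm d)\<^sup>2" "(norm G)\<^sup>2"] by simp
      finally show ?thesis by (simp flip: power_mult)
    qed
    have Hb: "norm ?H * s \<le> b * s" if "s \<ge> 0" for s using b(2)[OF \<open>norm y \<le> R\<close>] that by (intro mult_right_mono) auto
    have dG: "d \<bullet> (?H *v G) \<le> b * (norm d * norm G)" "G \<bullet> (?H *v d) \<le> b * (norm d * norm G)" "d \<bullet> (?H *v d) \<le> b * (norm d)\<^sup>2"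
      using inner_matrix_vector_le[of d ?H G] inner_matrix_vector_le[of G ?H d] inner_matrix_vector_le[of d ?H d]
        Hb[of "norm d * norm G"] Hb[of "norm d * norm d"]
      by (auto simp: ac_simps power2_eq_square)
    have cross: "b * (norm d * norm G) \<le> \<epsilon> / 2 * (norm G)\<^sup>2 + \<beta> * (norm d)\<^sup>2"
    proof -
      have "0 \<le> (\<epsilon> * norm G - b * norm d)\<^sup>2 / (2 * \<epsilon>)" using \<open>\<epsilon> > 0\<close> by simp
      also have "\<dots> = \<epsilon> / 2 * (norm G)\<^sup>2 + \<beta> * (norm d)\<^sup>2 - b * (norm d * norm G)"
        using \<open>\<epsilon> > 0\<close> by (simp add: power2_eq_square field_simps \<beta>_def)
      finally show ?thesis by simp
    qed
    have "?z \<bullet> (?H *v ?z) = G \<bullet> (?H *v G) + d \<bullet> (?H *v G) + G \<bullet> (?H *v d) + d \<bullet> (?H *v d)"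
      by (simp add: matrix_vector_right_distrib inner_add_left inner_add_right)
    then have "(?z \<bullet> (?H *v ?z)) / 2 \<le> (G \<bullet> (?H *v G)) / 2 + \<epsilon> / 2 * (norm G)\<^sup>2 + \<beta> * (norm d)\<^sup>2 + b * (norm d)\<^sup>2 / 2"
    proof -
      define Q where "Q = \<beta> * (norm d)\<^sup>2"
      show ?thesis
        using dG cross \<open>?z \<bullet> (?H *v ?z) = _\<close> unfolding Q_def[symmetric] by linarith
    qed
    moreover have "0 \<le> b * (norm d)\<^sup>2" using b by simp
    ultimately have zz: "(?z \<bullet> (?H *v ?z)) / 2 \<le> (G \<bullet> (?H *v G)) / 2 + \<epsilon> / 2 * (norm G)\<^sup>2 + (\<beta> + b) * (norm d)\<^sup>2"
      by (simp add: algebra_simps)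
    have "V (y + ?z) \<le> V y + gradient V y \<bullet> ?z + (?z \<bullet> (?H *v ?z)) / 2 + \<epsilon> / 4 * (norm ?z)\<^sup>2 + K0 * norm ?z ^ 4"
      using K0(2) that by blast
    also have "\<epsilon> / 4 * (norm ?z)\<^sup>2 \<le> \<epsilon> / 4 * (2 * (norm d)\<^sup>2 + 2 * (norm G)\<^sup>2)"
      using \<open>\<epsilon> > 0\<close> by (intro mult_left_mono z2) auto
    also have "K0 * norm ?z ^ 4 \<le> K0 * (8 * norm d ^ 4 + 8 * norm G ^ 4)"
      using K0 by (intro mult_left_mono z4) auto
    finally have Vz: "V (y + ?z) \<le> V y + gradient V y \<bullet> ?z + (?z \<bullet> (?H *v ?z)) / 2
        + \<epsilon> / 4 * (2 * (norm d)\<^sup>2 + 2 * (norm G)\<^sup>2) + K0 * (8 * norm d ^ 4 + 8 * norm G ^ 4)" by simp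
    then have "V (y + ?z) \<le> V y + gradient V y \<bullet> d + gradient V y \<bullet> G + (G \<bullet> (?H *v G)) / 2 + \<epsilon> * (norm G)\<^sup>2
        + (\<beta> + b + \<epsilon> / 2) * (norm d)\<^sup>2 + 8 * K0 * norm d ^ 4 + 8 * K0 * norm G ^ 4"
    proof -
      have "gradient V y \<bullet> ?z = gradient V y \<bullet> d + gradient V y \<bullet> G" by (rule inner_add_right)
      moreover have "\<epsilon> / 4 * (2 * (norm d)\<^sup>2 + 2 * (norm G)\<^sup>2) = \<epsilon> / 2 * (norm d)\<^sup>2 + \<epsilon> / 2 * (norm G)\<^sup>2"
        "K0 * (8 * norm d ^ 4 + 8 * norm G ^ 4) = 8 * K0 * norm d ^ 4 + 8 * K0 * norm G ^ 4"
        "(\<beta> + b + \<epsilon> / 2) * (norm d)\<^sup>2 = (\<beta> + b) * (norm d)\<^sup>2 + \<epsilon> / 2 * (norm d)\<^sup>2"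
        "\<epsilon> * (norm G)\<^sup>2 = \<epsilon> / 2 * (norm G)\<^sup>2 + \<epsilon> / 2 * (norm G)\<^sup>2"
        "y + d + G = y + ?z"
        by (simp_all add: algebra_simps)
      ultimately show ?thesis using add_mono[OF Vz zz] by (simp only: add.assoc)
    qed
    also have "(\<beta> + b + \<epsilon> / 2) * (norm d)\<^sup>2 \<le> (\<beta> + b + \<epsilon> / 2) * (B\<^sup>2 * D\<^sup>2)"
      using b \<beta> \<open>\<epsilon> > 0\<close> by (intro mult_left_mono d2) auto
    also have "8 * K0 * norm d ^ 4 \<le> 8 * K0 * (B ^ 4 * D\<^sup>2)" using K0 by (intro mult_left_mono d4) auto
    also have "8 * K0 * norm G ^ 4 \<le> K * norm G ^ 4"
      unfolding K_def using K0 b \<beta> \<open>\<epsilon> > 0\<close> by (intro mult_right_mono) auto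
    finally have *: "V (y + ?z) \<le> V y + gradient V y \<bullet> d + gradient V y \<bullet> G + (G \<bullet> (?H *v G)) / 2 + \<epsilon> * (norm G)\<^sup>2
        + ((\<beta> + b + \<epsilon> / 2) * B\<^sup>2 + 8 * K0 * B ^ 4) * D\<^sup>2 + K * norm G ^ 4"
      by (simp add: algebra_simps)
    have "((\<beta> + b + \<epsilon> / 2) * B\<^sup>2 + 8 * K0 * B ^ 4) * D\<^sup>2 \<le> K * D\<^sup>2"
      unfolding K_def using K0 by (intro mult_right_mono) auto
    with * show ?thesis by (simp add: add.assoc)
  qed
  with K show ?thesis by blast
qed

text \<open>This is what allows the dissipation inequality, valid at \<open>x\<close> with diffusion matrix \<open>g x\<close>, to be used at a nearby
point \<open>y\<close> with an approximate matrix \<open>\<eta>\<close>. The drift \<open>b\<close> stays the same on both sides. As \<open>\<eta>\<close> is not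
bounded uniformly, its deviation from \<open>g z\<close> enters quadratically, a quantity that is small after summation over time.\<close>

lemma generator_uniformly_close:
  fixes g :: "real^'n \<Rightarrow> real^'m^'n"
  assumes g: "continuous_on UNIV g" and "\<epsilon> > 0"
  shows "\<exists>\<delta>>0. \<exists>K\<ge>0. \<forall>x y z b \<eta>. norm x \<le> R \<and> norm z \<le> R \<and> dist y z \<le> \<delta> \<and> dist x z \<le> \<delta> \<and> norm b \<le> B \<longrightarrow>
    gradient V y \<bullet> b + trace (transpose \<eta> ** hessian V y ** \<eta>) / 2 + lam * V y
    \<le> gradient V x \<bullet> b + trace (transpose (g x) ** hessian V x ** g x) / 2 + lam * V x + \<epsilon> + K * (norm (\<eta> - g z))\<^sup>2"
proof -
  define S where "S = cball (0::real^'n) (R + 1)"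
  \<comment> \<open>with \<open>g z\<close> in place of \<open>\<eta>\<close> everything is continuous on a compact set\<close>
  define \<Phi> where "\<Phi> = (\<lambda>(y, z, b). gradient V y \<bullet> b
    + (\<Sum>j\<in>UNIV. column j (g z) \<bullet> (hessian V y *v column j (g z))) / 2 + lam * V y)"
  define P where "P = S \<times> S \<times> cball (0::real^'n) B"
  have gS: "continuous_on S g" using g continuous_on_subset by blast
  have col: "continuous_on Q (\<lambda>p. column j (G p))" if "continuous_on Q G" for Q :: "'q::topological_space set" and G :: "'q \<Rightarrow> real^'m^'n" and j
    unfolding column_def using that by (intro continuous_intros)
  have mv: "continuous_on Q (\<lambda>p. A p *v v p)" if "continuous_on Q A" "continuous_on Q v"
    for Q :: "'q::topological_space set" and A :: "'q \<Rightarrow> real^'n^'n" and v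
    unfolding matrix_vector_mult_def using that by (intro continuous_intros)
  have cont: "continuous_on P \<Phi>"
    unfolding \<Phi>_def P_def split_def
    by (intro continuous_intros col mv continuous_on_compose2[OF gS] continuous_on_compose2[OF C2_continuous(1)[of S]]
        continuous_on_compose2[OF C2_continuous(2)[of S]] continuous_on_compose2[OF C2_continuous(3)[of S]]) auto
  have "compact P" unfolding P_def S_def by (intro compact_Times compact_cball)
  then have "uniformly_continuous_on P \<Phi>" using cont by (intro compact_uniformly_continuous)
  then obtain \<delta>0 where \<delta>0: "\<delta>0 > 0" "\<And>p p'. p \<in> P \<Longrightarrow> p' \<in> P \<Longrightarrow> dist p' p < \<delta>0 \<Longrightarrow> dist (\<Phi> p') (\<Phi> p) < \<epsilon> / 2"
    using \<open>\<epsilon> > 0\<close> unfolding uniformly_continuous_on_def by (meson half_gt_zero)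
  have "bounded (g ` S)" unfolding S_def using g
    by (intro compact_imp_bounded compact_continuous_image compact_cball) (auto intro: continuous_on_subset)
  then obtain b1 where b1: "\<And>z. z \<in> S \<Longrightarrow> norm (g z) \<le> b1" unfolding bounded_iff by auto
  obtain b2 where b2: "b2 \<ge> 0" "\<And>y. norm y \<le> R + 1 \<Longrightarrow> norm (hessian V y) \<le> b2"
    using C2_bounded_on_cball by metis
  define m where "m = real CARD('m)"
  have m: "m > 0" unfolding m_def by simp
  define \<epsilon>' where "\<epsilon>' = \<epsilon> / m"
  have \<epsilon>': "\<epsilon>' > 0" unfolding \<epsilon>'_def using m \<open>\<epsilon> > 0\<close> by simp
  define K where "K = m * ((b2 * b1)\<^sup>2 / \<epsilon>' + b2)"
  have K: "K \<ge> 0" unfolding K_def using m \<epsilon>' b2 by auto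
  define \<delta> where "\<delta> = min 1 (\<delta>0 / 4)"
  have \<delta>: "\<delta> > 0" "\<delta> \<le> 1" "4 * \<delta> \<le> \<delta>0" unfolding \<delta>_def using \<delta>0 by auto
  have "gradient V y \<bullet> b + trace (transpose \<eta> ** hessian V y ** \<eta>) / 2 + lam * V y
    \<le> gradient V x \<bullet> b + trace (transpose (g x) ** hessian V x ** g x) / 2 + lam * V x + \<epsilon> + K * (norm (\<eta> - g z))\<^sup>2"
    if h: "norm x \<le> R" "norm z \<le> R" "dist y z \<le> \<delta>" "dist x z \<le> \<delta>" "norm b \<le> B" for x y z b \<eta>
  proof -
    have y: "norm y \<le> R + 1" using h \<delta> norm_triangle_ineq[of z "y - z"] by (simp add: dist_norm)
    have inP: "(y, z, b) \<in> P" "(x, x, b) \<in> P" using h y unfolding P_def S_def by auto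
    have "dist (y, z, b) (x, x, b) \<le> dist y x + dist z x"
      using sqrt_sum_squares_le_sum_abs[of "dist y x" "dist z x"] by (simp add: dist_Pair_Pair)
    also have "\<dots> \<le> 3 * \<delta>" using h dist_triangle[of y x z] by (simp add: dist_commute)
    also have "\<dots> < \<delta>0" using \<delta> by linarith
    finally have "dist (\<Phi> (y, z, b)) (\<Phi> (x, x, b)) < \<epsilon> / 2" using \<delta>0(2) inP by blast
    then have close: "\<Phi> (y, z, b) \<le> \<Phi> (x, x, b) + \<epsilon> / 2" unfolding dist_real_def by linarith
    let ?H = "hessian V y"
    have col_le: "column j \<eta> \<bullet> (?H *v column j \<eta>) \<le> column j (g z) \<bullet> (?H *v column j (g z)) + (\<epsilon>' + ((b2 * b1)\<^sup>2 / \<epsilon>' + b2) * (norm (\<eta> - g z))\<^sup>2)" for j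
    proof -
      define s where "s = column j (g z)"
      define e where "e = column j \<eta> - s"
      have en: "norm e \<le> norm (\<eta> - g z)" using norm_column_le[of j "\<eta> - g z"] by (simp add: e_def s_def column_diff)
      have sn: "norm s \<le> b1" using norm_column_le[of j "g z"] b1[of z] h unfolding s_def S_def by simp
      have Hb: "norm ?H * r \<le> b2 * r" if "r \<ge> 0" for r using b2(2)[OF y] that by (intro mult_right_mono) auto
      have es: "norm e * norm s \<le> norm e * b1" using sn by (intro mult_left_mono) auto
      have "column j \<eta> \<bullet> (?H *v column j \<eta>) = (s + e) \<bullet> (?H *v (s + e))" unfolding e_def by simp
      also have "\<dots> = s \<bullet> (?H *v s) + s \<bullet> (?H *v e) + e \<bullet> (?H *v s) + e \<bullet> (?H *v e)"
        by (simp add: matrix_vector_right_distrib inner_add_left inner_add_right)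
      also have "\<dots> \<le> s \<bullet> (?H *v s) + 2 * (b2 * (norm e * b1)) + b2 * (norm e)\<^sup>2"
        using inner_matrix_vector_le[of s ?H e] inner_matrix_vector_le[of e ?H s] inner_matrix_vector_le[of e ?H e]
          Hb[of "norm e * norm s"] Hb[of "norm e * norm e"] mult_left_mono[OF es b2(1)]
        by (simp add: ac_simps power2_eq_square)
      also have "2 * (b2 * (norm e * b1)) \<le> \<epsilon>' + (b2 * b1)\<^sup>2 / \<epsilon>' * (norm e)\<^sup>2"
      proof -
        have "0 \<le> (\<epsilon>' - b2 * b1 * norm e)\<^sup>2 / \<epsilon>'" using \<epsilon>' by simp
        also have "\<dots> = \<epsilon>' + (b2 * b1)\<^sup>2 / \<epsilon>' * (norm e)\<^sup>2 - 2 * (b2 * (norm e * b1))"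
          using \<epsilon>' by (simp add: power2_eq_square field_simps)
        finally show ?thesis by simp
      qed
      finally have "column j \<eta> \<bullet> (?H *v column j \<eta>) \<le> s \<bullet> (?H *v s) + (\<epsilon>' + ((b2 * b1)\<^sup>2 / \<epsilon>' + b2) * (norm e)\<^sup>2)"
        by (simp add: algebra_simps)
      also have "((b2 * b1)\<^sup>2 / \<epsilon>' + b2) * (norm e)\<^sup>2 \<le> ((b2 * b1)\<^sup>2 / \<epsilon>' + b2) * (norm (\<eta> - g z))\<^sup>2"
        using \<epsilon>' b2 en by (intro mult_left_mono power_mono) auto
      finally show ?thesis unfolding s_def by simp
    qed
    have "(\<Sum>j\<in>UNIV. column j \<eta> \<bullet> (?H *v column j \<eta>))
        \<le> (\<Sum>j\<in>UNIV. column j (g z) \<bullet> (?H *v column j (g z)) + (\<epsilon>' + ((b2 * b1)\<^sup>2 / \<epsilon>' + b2) * (norm (\<eta> - g z))\<^sup>2))"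
      by (intro sum_mono col_le)
    also have "\<dots> = (\<Sum>j\<in>UNIV. column j (g z) \<bullet> (?H *v column j (g z)))
        + m * (\<epsilon>' + ((b2 * b1)\<^sup>2 / \<epsilon>' + b2) * (norm (\<eta> - g z))\<^sup>2)"
      by (simp add: sum.distrib m_def)
    also have "m * (\<epsilon>' + ((b2 * b1)\<^sup>2 / \<epsilon>' + b2) * (norm (\<eta> - g z))\<^sup>2) = \<epsilon> + K * (norm (\<eta> - g z))\<^sup>2"
      unfolding K_def using m by (simp add: \<epsilon>'_def distrib_left mult.assoc)
    finally have tr: "trace (transpose \<eta> ** ?H ** \<eta>)
        \<le> (\<Sum>j\<in>UNIV. column j (g z) \<bullet> (?H *v column j (g z))) + (\<epsilon> + K * (norm (\<eta> - g z))\<^sup>2)"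
      unfolding trace_quadratic_eq_columns .
    have "K * (norm (\<eta> - g z))\<^sup>2 \<ge> 0" using K by simp
    then show ?thesis using tr close unfolding \<Phi>_def trace_quadratic_eq_columns by simp
  qed
  with \<delta>(1) K show ?thesis by blast
qed

end

section \<open>Grids adapted to simple integrands\<close>

text \<open>The sorted list of all relevant points, namely the end points, the points of \<open>P\<close> in between and the multiples of \<open>h\<close>, is
such a grid.\<close>

lemma refining_grid_exists:
  fixes T h :: real
  assumes "0 \<le> T" "h > 0" "finite P"
  obtains N :: nat and q :: "nat \<Rightarrow> real" where
    "q 0 = 0" "q N = T" "\<And>j. j < N \<Longrightarrow> q j < q (Suc j)" "\<And>j. j < N \<Longrightarrow> q (Suc j) - q j \<le> h"
    "\<And>j p. j < N \<Longrightarrow> p \<in> P \<Longrightarrow> p \<le> q j \<or> q (Suc j) \<le> p"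
    "\<And>j. j \<le> N \<Longrightarrow> q j \<in> {0..T}"
proof -
  define S where "S = insert 0 (insert T ((P \<union> (\<lambda>i. real i * h) ` {..nat \<lceil>T / h\<rceil>}) \<inter> {0..T}))"
  have fin: "finite S" unfolding S_def using assms by auto
  have S_sub: "S \<subseteq> {0..T}" unfolding S_def using assms by auto
  define L where "L = sorted_list_of_set S"
  have L: "set L = S" "sorted L" "distinct L" unfolding L_def using fin by auto
  have len: "length L > 0" using L(1) unfolding S_def by (cases L) auto
  define N where "N = length L - 1"
  define q where "q j = L ! j" for j
  have q_in: "q j \<in> S" if "j \<le> N" for j
    using that len L(1) unfolding q_def N_def by (metis One_nat_def Suc_pred less_Suc_eq_le nth_mem)
  have q_less: "q i < q j" if "i < j" "j \<le> N" for i j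
    using that len sorted_wrt_nth_less[of "(<)" L i j] unfolding q_def N_def
    by (metis L_def One_nat_def Suc_pred less_Suc_eq_le strict_sorted_list_of_set)
  have q_mono: "q i \<le> q j" if "i \<le> j" "j \<le> N" for i j
    using that q_less[of i j] by (cases "i = j") auto
  have surj: "\<exists>i\<le>N. p = q i" if "p \<in> S" for p
  proof -
    obtain i where "i < length L" "L ! i = p" using \<open>p \<in> S\<close> L(1) by (metis in_set_conv_nth)
    then show ?thesis unfolding q_def N_def by (intro exI[of _ i]) auto
  qed
  have gap: "p \<le> q j \<or> q (Suc j) \<le> p" if "j < N" "p \<in> S" for j p
  proof -
    obtain i where i: "i \<le> N" "p = q i" using surj \<open>p \<in> S\<close> by blast
    show ?thesis
    proof (cases "i \<le> j")
      case True then show ?thesis using q_mono[of i j] that i by auto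
    next
      case False then show ?thesis using q_mono[of "Suc j" i] that i by auto
    qed
  qed
  have q0: "q 0 = 0"
  proof -
    obtain i where i: "i \<le> N" "0 = q i" using surj[of 0] unfolding S_def by auto
    have "q 0 \<le> 0" using q_mono[of 0 i] i by auto
    moreover have "q 0 \<ge> 0" using q_in[of 0] S_sub by auto
    ultimately show ?thesis by simp
  qed
  have qN: "q N = T"
  proof -
    obtain i where i: "i \<le> N" "T = q i" using surj[of T] unfolding S_def by auto
    have "T \<le> q N" using q_mono[of i N] i by auto
    moreover have "q N \<le> T" using q_in[of N] S_sub by auto
    ultimately show ?thesis by simp
  qed
  have bnd: "q j \<in> {0..T}" if "j \<le> N" for j using q_in[OF that] S_sub by auto
  have mesh: "q (Suc j) - q j \<le> h" if j: "j < N" for j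
  proof (rule ccontr)
    assume "\<not> q (Suc j) - q j \<le> h"
    then have gt: "q j + h < q (Suc j)" by simp
    define i where "i = nat \<lfloor>q j / h\<rfloor> + 1"
    have q_ge: "q j \<ge> 0" using bnd j by auto
    have ri: "real i = of_int \<lfloor>q j / h\<rfloor> + 1" unfolding i_def using q_ge assms(2) by simp
    have fl: "of_int \<lfloor>q j / h\<rfloor> \<le> q j / h" "q j / h < of_int \<lfloor>q j / h\<rfloor> + 1" by linarith+
    have up: "real i * h \<le> q j + h"
      using mult_right_mono[OF fl(1), of h] assms(2) unfolding ri by (simp add: algebra_simps)
    have lo: "q j < real i * h"
      using fl(2) assms(2) unfolding ri by (simp add: field_simps)
    have T: "real i * h \<le> T" using up gt bnd[of "Suc j"] j by auto
    then have "real i \<le> T / h" using assms(2) by (simp add: field_simps)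
    then have "i \<le> nat \<lceil>T / h\<rceil>" by linarith
    then have "real i * h \<in> S" unfolding S_def using T lo q_ge by auto
    from gap[OF j this] show False using up lo gt by linarith
  qed
  have "p \<le> q j \<or> q (Suc j) \<le> p" if "j < N" "p \<in> P" for j p
  proof (cases "p \<in> {0..T}")
    case True
    then show ?thesis using gap[OF that(1), of p] that(2) unfolding S_def by auto
  next
    case False
    then show ?thesis using bnd[of j] bnd[of "Suc j"] that(1) by auto
  qed
  with that[of q N] q0 qN q_less mesh bnd show ?thesis by auto
qed

text \<open>A cell contains no partition point in its interior, so each summand of the simple integrand is either
active on the whole cell or not at all; \<open>\<eta>\<close> collects the active ones and is known at the left end point \<open>a\<close>.\<close>

lemma simple_integrand_on_cell:
  fixes W :: "real \<Rightarrow> 'w \<Rightarrow> real^'m" and \<xi> :: "nat \<Rightarrow> 'w \<Rightarrow> real^'m^'n"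
  assumes pq: "\<And>i. i \<le> N \<Longrightarrow> p i \<le> a \<or> b \<le> p i" and mono: "\<And>i. i < N \<Longrightarrow> p i \<le> p (Suc i)" and "a < b"
  defines "\<eta> \<equiv> \<lambda>\<omega>. \<Sum>i<N. if p i \<le> a \<and> b \<le> p (Suc i) then \<xi> i \<omega> else 0"
  shows "simple_integral W N p \<xi> b \<omega> - simple_integral W N p \<xi> a \<omega> = \<eta> \<omega> *v (W b \<omega> - W a \<omega>)"
    and "\<And>r. a < r \<Longrightarrow> r \<le> b \<Longrightarrow> simple_process N p \<xi> r \<omega> = \<eta> \<omega>"
proof -
  have mv_sum: "(\<Sum>i\<in>J. A i) *v v = (\<Sum>i\<in>J. A i *v v)" if "finite J" for A :: "nat \<Rightarrow> real^'m^'n" and J v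
    using that by (induction J) (auto simp: matrix_vector_mult_add_rdistrib)
  have "\<xi> i \<omega> *v (W (min b (p (Suc i))) \<omega> - W (min b (p i)) \<omega>)
      - \<xi> i \<omega> *v (W (min a (p (Suc i))) \<omega> - W (min a (p i)) \<omega>)
      = (if p i \<le> a \<and> b \<le> p (Suc i) then \<xi> i \<omega> else 0) *v (W b \<omega> - W a \<omega>)" if "i < N" for i
  proof -
    have "p i \<le> a \<or> b \<le> p i" "p (Suc i) \<le> a \<or> b \<le> p (Suc i)" using pq[of i] pq[of "Suc i"] that by auto
    then consider "p (Suc i) \<le> a" | "b \<le> p i" | "p i \<le> a" "b \<le> p (Suc i)"
      by blast
    then show ?thesis
    proof cases
      case 1
      then show ?thesis using mono[OF that] \<open>a < b\<close> by (auto simp: min_def)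
    next
      case 2
      then show ?thesis using mono[OF that] \<open>a < b\<close> by (auto simp: min_def)
    next
      case 3
      then have "min b (p (Suc i)) = b" "min b (p i) = p i" "min a (p (Suc i)) = a" "min a (p i) = p i"
        using \<open>a < b\<close> by auto
      then show ?thesis using 3 by (simp add: matrix_vector_mult_diff_distrib)
    qed
  qed
  then show "simple_integral W N p \<xi> b \<omega> - simple_integral W N p \<xi> a \<omega> = \<eta> \<omega> *v (W b \<omega> - W a \<omega>)"
    unfolding simple_integral_def \<eta>_def mv_sum[OF finite_lessThan] sum_subtractf[symmetric]
    by (intro sum.cong) auto
  fix r assume r: "a < r" "r \<le> b"
  have "indicator {p i<..p (Suc i)} r *\<^sub>R \<xi> i \<omega> = (if p i \<le> a \<and> b \<le> p (Suc i) then \<xi> i \<omega> else 0)" if "i < N" for i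
    using pq[of i] pq[of "Suc i"] r that by (auto simp: indicator_def)
  then show "simple_process N p \<xi> r \<omega> = \<eta> \<omega>"
    unfolding simple_process_def \<eta>_def by (intro sum.cong) auto
qed

text \<open>Multiplication by \<open>exp (lam * q j)\<close> turns the contraction factor \<open>1 - lam * D j\<close> into a factor at most 1. The source
\<open>exp (- lam * q j)\<close> then contributes a bounded amount per unit of time, which is where the linear term in \<open>q n\<close>
comes from; \<open>exp lam\<close> pays for evaluating the weight at the right end of a cell of length at most 1.\<close>

lemma discrete_gronwall:
  fixes z q D e :: "nat \<Rightarrow> real"
  assumes step: "\<And>j. j < N \<Longrightarrow> z (Suc j) \<le> (1 - lam * D j) * z j + C * D j * exp (- lam * q j) + e j"
    and q: "q 0 = 0" "\<And>j. j < N \<Longrightarrow> q (Suc j) = q j + D j" "\<And>j. j \<le> N \<Longrightarrow> q j \<le> T"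
    and D: "\<And>j. j < N \<Longrightarrow> 0 \<le> D j \<and> D j \<le> 1"
    and nonneg: "\<And>j. j \<le> N \<Longrightarrow> 0 \<le> z j" "\<And>j. j < N \<Longrightarrow> 0 \<le> e j" "0 \<le> C" "0 \<le> lam"
    and n: "n \<le> N"
  shows "exp (lam * q n) * z n \<le> z 0 + C * exp lam * q n + exp (lam * T) * (\<Sum>j<n. e j)"
  using n
proof (induction n)
  case 0
  then show ?case using q by simp
next
  case (Suc n)
  then have n: "n < N" by simp
  have "exp (lam * q (Suc n)) * z (Suc n)
      \<le> exp (lam * q (Suc n)) * ((1 - lam * D n) * z n + C * D n * exp (- lam * q n) + e n)"
    by (intro mult_left_mono step n) auto
  also have "\<dots> = exp (lam * q n) * (exp (lam * D n) * (1 - lam * D n)) * z n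
      + C * D n * exp (lam * D n) + exp (lam * q (Suc n)) * e n"
    by (simp add: q(2)[OF n] algebra_simps exp_add[symmetric])
  also have "\<dots> \<le> exp (lam * q n) * 1 * z n + C * D n * exp lam + exp (lam * T) * e n"
  proof -
    have "1 - lam * D n \<le> exp (- (lam * D n))" using exp_ge_add_one_self[of "- (lam * D n)"] by simp
    then have "exp (lam * D n) * (1 - lam * D n) \<le> exp (lam * D n) * exp (- (lam * D n))"
      by (intro mult_left_mono) auto
    then have "exp (lam * D n) * (1 - lam * D n) \<le> 1" by (simp add: exp_minus)
    moreover have "exp (lam * D n) \<le> exp lam" using D[OF n] nonneg(4) by (simp add: mult_left_le)
    moreover have "exp (lam * q (Suc n)) \<le> exp (lam * T)" using q(3)[OF Suc.prems] nonneg(4) by (simp add: mult_left_mono)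
    ultimately show ?thesis using nonneg(1)[of n] nonneg(2)[OF n] nonneg(3) D[OF n] n
      by (intro add_mono mult_right_mono mult_left_mono mult_nonneg_nonneg) auto
  qed
  also have "\<dots> \<le> (z 0 + C * exp lam * q n + exp (lam * T) * (\<Sum>j<n. e j)) + C * D n * exp lam + exp (lam * T) * e n"
    using Suc n by simp
  also have "\<dots> = z 0 + C * exp lam * q (Suc n) + exp (lam * T) * (\<Sum>j<Suc n. e j)"
    by (simp add: q(2)[OF n] algebra_simps)
  finally show ?case .
qed

section \<open>Wiener increments and path events\<close>

context wiener_process
begin

lemma subalgebra_F: "0 \<le> t \<Longrightarrow> subalgebra M (F t)"
  unfolding subalgebra_def using sets_F_subset space_F by auto

lemma subalgebra_F_F: "s \<le> t \<Longrightarrow> subalgebra (F t) (F s)"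
  unfolding subalgebra_def using sets_F_mono space_F by auto

lemma measurable_F_imp_M: "0 \<le> t \<Longrightarrow> f \<in> measurable (F t) N \<Longrightarrow> f \<in> measurable M N"
  using subalgebra_F measurable_from_subalg by blast

lemma measurable_F_mono: "s \<le> t \<Longrightarrow> f \<in> measurable (F s) N \<Longrightarrow> f \<in> measurable (F t) N"
  using subalgebra_F_F measurable_from_subalg by blast

lemma W_measurable: "0 \<le> t \<Longrightarrow> W t \<in> borel_measurable M"
  using W_adapted measurable_F_imp_M unfolding adapted_def by blast

text \<open>Independence of the past and the increment is given for sigma-algebras; the sets generated by \<open>Y\<close> and by \<open>h\<close>
of the increment form smaller ones.\<close>

lemma indep_past_increment:
  fixes Y :: "'w \<Rightarrow> real"
  assumes "0 \<le> s" "s < t" and Y: "Y \<in> borel_measurable (F s)" and h: "h \<in> borel_measurable borel"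
  shows "indep_var borel Y borel (\<lambda>\<omega>. h (W t \<omega> - W s \<omega>) :: real)"
proof -
  let ?D = "\<lambda>\<omega>. W t \<omega> - W s \<omega>"
  have D: "?D \<in> borel_measurable M" using assms W_measurable by auto
  have sigma_Y: "sigma_sets (space M) {Y -` A \<inter> space M |A. A \<in> sets borel} \<subseteq> sets (F s)"
  proof (rule sets.sigma_sets_subset')
    show "{Y -` A \<inter> space M |A. A \<in> sets borel} \<subseteq> sets (F s)"
      using measurable_sets[OF Y] space_F[of s] by auto
  qed (use space_F[of s] sets.top[of "F s"] in auto)
  have sigma_D: "sigma_sets (space M) {(\<lambda>\<omega>. h (?D \<omega>)) -` A \<inter> space M |A. A \<in> sets borel}
      \<subseteq> sets (vimage_algebra (space M) ?D borel)"
  proof -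
    let ?G = "vimage_algebra (space M) ?D borel"
    have "?D \<in> borel_measurable ?G" by (intro measurable_vimage_algebra1) auto
    then have "(\<lambda>\<omega>. h (?D \<omega>)) \<in> borel_measurable ?G" using h by measurable
    then show ?thesis
      using measurable_sets[of "\<lambda>\<omega>. h (?D \<omega>)" ?G borel] sets.top[of ?G]
      by (intro sets.sigma_sets_subset') auto
  qed
  have "indep_set (sigma_sets (space M) {Y -` A \<inter> space M |A. A \<in> sets borel})
      (sigma_sets (space M) {(\<lambda>\<omega>. h (?D \<omega>)) -` A \<inter> space M |A. A \<in> sets borel})"
    using W_increment_indep[OF assms(1,2)] unfolding indep_set_def
    by (rule indep_sets_mono_sets) (use sigma_Y sigma_D in \<open>auto split: bool.split\<close>)
  then show ?thesis
    unfolding indep_var_eq using D h measurable_F_imp_M[OF assms(1) Y] by auto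
qed

lemma past_increment_expectation:
  fixes Y :: "'w \<Rightarrow> real"
  assumes "0 \<le> s" "s < t" and Y: "Y \<in> borel_measurable (F s)" "\<And>\<omega>. \<omega> \<in> space M \<Longrightarrow> \<bar>Y \<omega>\<bar> \<le> K"
    and h: "h \<in> borel_measurable borel" "integrable M (\<lambda>\<omega>. h (W t \<omega> - W s \<omega>) :: real)"
  shows "integrable M (\<lambda>\<omega>. Y \<omega> * h (W t \<omega> - W s \<omega>))"
    and "(\<integral>\<omega>. Y \<omega> * h (W t \<omega> - W s \<omega>) \<partial>M) = (\<integral>\<omega>. Y \<omega> \<partial>M) * (\<integral>\<omega>. h (W t \<omega> - W s \<omega>) \<partial>M)"
proof -
  have "integrable M Y"
    using Y measurable_F_imp_M[OF assms(1) Y(1)] by (intro integrable_const_bound[of _ K]) auto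
  then show "integrable M (\<lambda>\<omega>. Y \<omega> * h (W t \<omega> - W s \<omega>))"
    "(\<integral>\<omega>. Y \<omega> * h (W t \<omega> - W s \<omega>) \<partial>M) = (\<integral>\<omega>. Y \<omega> \<partial>M) * (\<integral>\<omega>. h (W t \<omega> - W s \<omega>) \<partial>M)"
    using indep_var_integrable[OF indep_past_increment[OF assms(1,2) Y(1) h(1)]]
      indep_var_lebesgue_integral[OF indep_past_increment[OF assms(1,2) Y(1) h(1)]] h(2) by auto
qed

lemma increment_moment:
  assumes "0 \<le> s" "s < t"
  shows "integrable M (\<lambda>\<omega>. ((W t \<omega> - W s \<omega>) $ j) ^ k)"
    and "(\<integral>\<omega>. (W t \<omega> - W s \<omega>) $ j \<partial>M) = 0"
    and "(\<integral>\<omega>. ((W t \<omega> - W s \<omega>) $ j)\<^sup>2 \<partial>M) = t - s"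
    and "(\<integral>\<omega>. ((W t \<omega> - W s \<omega>) $ j) ^ 4 \<partial>M) = 3 * (t - s)\<^sup>2"
proof -
  let ?\<sigma> = "sqrt (t - s)" and ?X = "\<lambda>\<omega>. (W t \<omega> - W s \<omega>) $ j"
  have \<sigma>: "?\<sigma> > 0" using assms by simp
  have D: "distributed M lborel ?X (normal_density 0 ?\<sigma>)" using W_increment_normal[OF assms] .
  show "integrable M (\<lambda>\<omega>. (?X \<omega>) ^ k)"
    using integrable_normal_moment[OF \<sigma>, of 0 k] distributed_integrable[OF D, of "\<lambda>x. x ^ k"] by simp
  show "(\<integral>\<omega>. ?X \<omega> \<partial>M) = 0"
    using normal_distributed_expectation[OF \<sigma> D] .
  show "(\<integral>\<omega>. (?X \<omega>)\<^sup>2 \<partial>M) = t - s"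
    using integral_normal_moment_even[OF \<sigma>, of 0 1] distributed_integral[OF D, of "\<lambda>x. x\<^sup>2"] assms
    by (simp add: fact_numeral)
  show "(\<integral>\<omega>. (?X \<omega>) ^ 4 \<partial>M) = 3 * (t - s)\<^sup>2"
    using integral_normal_moment_even[OF \<sigma>, of 0 2] distributed_integral[OF D, of "\<lambda>x. x ^ 4"] assms
    by (simp add: fact_numeral power_divide)
qed

lemma increment_cross_moment:
  assumes "0 \<le> s" "s < t"
  shows "integrable M (\<lambda>\<omega>. (W t \<omega> - W s \<omega>) $ i * (W t \<omega> - W s \<omega>) $ j)"
    and "(\<integral>\<omega>. (W t \<omega> - W s \<omega>) $ i * (W t \<omega> - W s \<omega>) $ j \<partial>M) = (if i = j then t - s else 0)"
proof -
  let ?X = "\<lambda>j \<omega>. (W t \<omega> - W s \<omega>) $ j"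
  have int: "integrable M (?X j)" for j using increment_moment(1)[OF assms, of j 1] by simp
  have "integrable M (\<lambda>\<omega>. ?X i \<omega> * ?X j \<omega>) \<and> (\<integral>\<omega>. ?X i \<omega> * ?X j \<omega> \<partial>M) = (if i = j then t - s else 0)"
  proof (cases "i = j")
    case True
    then show ?thesis
      using increment_moment(1)[OF assms, of j 2] increment_moment(3)[OF assms, of j]
      by (simp add: power2_eq_square)
  next
    case False
    have "indep_var borel (?X i) borel (?X j)"
      using indep_vars_sum[of "{j}" i ?X] indep_vars_subset[OF W_components_indep[OF assms], of "{i, j}"] False
      by simp
    then show ?thesis
      using indep_var_integrable[OF _ int int] indep_var_lebesgue_integral[OF _ int int]
        increment_moment(2)[OF assms] False by auto
  qed
  then show "integrable M (\<lambda>\<omega>. ?X i \<omega> * ?X j \<omega>)"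
    "(\<integral>\<omega>. ?X i \<omega> * ?X j \<omega> \<partial>M) = (if i = j then t - s else 0)" by auto
qed

lemma increment_norm_moments:
  fixes s t :: real
  assumes "0 \<le> s" "s < t"
  shows "integrable M (\<lambda>\<omega>. (norm (W t \<omega> - W s \<omega>))\<^sup>2)"
    and "(\<integral>\<omega>. (norm (W t \<omega> - W s \<omega>))\<^sup>2 \<partial>M) = real CARD('m) * (t - s)"
    and "integrable M (\<lambda>\<omega>. norm (W t \<omega> - W s \<omega>) ^ 4)"
    and "(\<integral>\<omega>. norm (W t \<omega> - W s \<omega>) ^ 4 \<partial>M) \<le> 3 * (real CARD('m))\<^sup>2 * (t - s)\<^sup>2"
proof -
  let ?X = "\<lambda>j \<omega>. (W t \<omega> - W s \<omega>) $ j" and ?D = "\<lambda>\<omega>. W t \<omega> - W s \<omega>"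
  have n2: "(norm (?D \<omega>))\<^sup>2 = (\<Sum>j\<in>UNIV. (?X j \<omega>)\<^sup>2)" for \<omega>
    unfolding power2_norm_eq_inner inner_vec_def by (simp add: power2_eq_square)
  show "integrable M (\<lambda>\<omega>. (norm (?D \<omega>))\<^sup>2)" "(\<integral>\<omega>. (norm (?D \<omega>))\<^sup>2 \<partial>M) = real CARD('m) * (t - s)"
    unfolding n2 using increment_moment(1,3)[OF assms] by (auto simp: Bochner_Integration.integral_sum)
  have n4: "norm (?D \<omega>) ^ 4 \<le> real CARD('m) * (\<Sum>j\<in>UNIV. ?X j \<omega> ^ 4)" for \<omega>
  proof -
    have "norm (?D \<omega>) ^ 4 = ((norm (?D \<omega>))\<^sup>2)\<^sup>2" by (simp flip: power_mult)
    also have "\<dots> = (\<Sum>j\<in>(UNIV::'m set). 1 * (?X j \<omega>)\<^sup>2)\<^sup>2" unfolding n2 by simp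
    also have "\<dots> \<le> (\<Sum>j\<in>(UNIV::'m set). 1\<^sup>2) * (\<Sum>j\<in>UNIV. ((?X j \<omega>)\<^sup>2)\<^sup>2)"
      by (rule Cauchy_Schwarz_ineq_sum)
    finally show ?thesis by (simp flip: power_mult)
  qed
  have int: "integrable M (\<lambda>\<omega>. real CARD('m) * (\<Sum>j\<in>UNIV. ?X j \<omega> ^ 4))"
    using increment_moment(1)[OF assms] by auto
  have meas: "?D \<in> borel_measurable M" using W_measurable assms by auto
  show int4: "integrable M (\<lambda>\<omega>. norm (?D \<omega>) ^ 4)"
    by (rule Bochner_Integration.integrable_bound[OF int])
      (use meas n4 in \<open>auto intro!: AE_I2 order_trans[OF _ abs_ge_self]\<close>)
  have "(\<integral>\<omega>. norm (?D \<omega>) ^ 4 \<partial>M) \<le> (\<integral>\<omega>. real CARD('m) * (\<Sum>j\<in>UNIV. ?X j \<omega> ^ 4) \<partial>M)"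
    by (intro integral_mono int4 int n4)
  also have "\<dots> = real CARD('m) * (\<Sum>j\<in>(UNIV::'m set). 3 * (t - s)\<^sup>2)"
    using increment_moment(1,4)[OF assms] by (simp add: Bochner_Integration.integral_sum)
  finally show "(\<integral>\<omega>. norm (?D \<omega>) ^ 4 \<partial>M) \<le> 3 * (real CARD('m))\<^sup>2 * (t - s)\<^sup>2"
    by (simp add: power2_eq_square ac_simps)
qed

text \<open>Expanding in the noise components reduces everything to products of a bounded past factor and a moment of
the increment. Distinct components are uncorrelated, so only the diagonal of the quadratic form survives, and that diagonal sums to
the trace in the generator.\<close>

lemma noise_step_expectations:
  fixes a :: "'w \<Rightarrow> real^'n" and \<eta> :: "'w \<Rightarrow> real^'m^'n" and A :: "'w \<Rightarrow> real^'n^'n"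
  assumes st: "0 \<le> s" "s < t"
    and meas: "a \<in> borel_measurable (F s)" "\<eta> \<in> borel_measurable (F s)" "A \<in> borel_measurable (F s)"
    and bnd: "\<And>\<omega>. \<omega> \<in> space M \<Longrightarrow> norm (a \<omega>) \<le> Ka" "\<And>\<omega>. \<omega> \<in> space M \<Longrightarrow> norm (\<eta> \<omega>) \<le> K\<eta>"
      "\<And>\<omega>. \<omega> \<in> space M \<Longrightarrow> norm (A \<omega>) \<le> KA"
  defines "G \<equiv> \<lambda>\<omega>. \<eta> \<omega> *v (W t \<omega> - W s \<omega>)"
  shows "integrable M (\<lambda>\<omega>. a \<omega> \<bullet> G \<omega>)" "(\<integral>\<omega>. a \<omega> \<bullet> G \<omega> \<partial>M) = 0"
    and "integrable M (\<lambda>\<omega>. G \<omega> \<bullet> (A \<omega> *v G \<omega>))"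
    and "integrable M (\<lambda>\<omega>. trace (transpose (\<eta> \<omega>) ** A \<omega> ** \<eta> \<omega>))"
    and "(\<integral>\<omega>. G \<omega> \<bullet> (A \<omega> *v G \<omega>) \<partial>M) = (t - s) * (\<integral>\<omega>. trace (transpose (\<eta> \<omega>) ** A \<omega> ** \<eta> \<omega>) \<partial>M)"
    and "integrable M (\<lambda>\<omega>. (norm (G \<omega>))\<^sup>2)" "(\<integral>\<omega>. (norm (G \<omega>))\<^sup>2 \<partial>M) \<le> K\<eta>\<^sup>2 * real CARD('m) * (t - s)"
    and "integrable M (\<lambda>\<omega>. norm (G \<omega>) ^ 4)" "(\<integral>\<omega>. norm (G \<omega>) ^ 4 \<partial>M) \<le> K\<eta> ^ 4 * (3 * (real CARD('m))\<^sup>2) * (t - s)\<^sup>2"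
proof -
  let ?D = "\<lambda>\<omega>. W t \<omega> - W s \<omega>"
  note [measurable] = meas
  obtain \<omega>0 where "\<omega>0 \<in> space M" using not_empty by blast
  then have K0: "Ka \<ge> 0" "K\<eta> \<ge> 0" "KA \<ge> 0" using bnd norm_ge_zero order_trans by blast+
  have Dm: "?D \<in> borel_measurable M" using W_measurable st by auto
  have \<eta>M: "\<eta> \<in> borel_measurable M" "A \<in> borel_measurable M" using measurable_F_imp_M[OF st(1) meas(2)] measurable_F_imp_M[OF st(1) meas(3)] by auto
  have Gm: "G \<in> borel_measurable M" unfolding G_def using Dm \<eta>M by measurable
  have h1: "(\<lambda>v::real^'m. v $ k) \<in> borel_measurable borel" for k by measurable
  have int1: "integrable M (\<lambda>\<omega>. ?D \<omega> $ k)" for k using increment_moment(1)[OF st, of k 1] by simp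
  have aG: "a \<omega> \<bullet> G \<omega> = (\<Sum>k\<in>UNIV. (a \<omega> \<bullet> column k (\<eta> \<omega>)) * ?D \<omega> $ k)" for \<omega>
    unfolding G_def matrix_vector_mult_columns by (simp add: inner_sum_right mult.commute)
  have coef1: "(\<lambda>\<omega>. a \<omega> \<bullet> column k (\<eta> \<omega>)) \<in> borel_measurable (F s)" for k by measurable
  have coef1_bnd: "\<bar>a \<omega> \<bullet> column k (\<eta> \<omega>)\<bar> \<le> Ka * K\<eta>" if "\<omega> \<in> space M" for \<omega> k
  proof -
    have "\<bar>a \<omega> \<bullet> column k (\<eta> \<omega>)\<bar> \<le> norm (a \<omega>) * norm (column k (\<eta> \<omega>))" by (rule Cauchy_Schwarz_ineq2)
    also have "\<dots> \<le> Ka * K\<eta>" using bnd[OF that] K0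
      by (intro mult_mono order_trans[OF norm_column_le]) auto
    finally show ?thesis .
  qed
  note E1 = past_increment_expectation[OF st coef1 coef1_bnd h1 int1]
  show "integrable M (\<lambda>\<omega>. a \<omega> \<bullet> G \<omega>)" unfolding aG using E1(1) by auto
  show "(\<integral>\<omega>. a \<omega> \<bullet> G \<omega> \<partial>M) = 0" unfolding aG
    using E1 increment_moment(2)[OF st] by (simp add: Bochner_Integration.integral_sum)
  have h2: "(\<lambda>v::real^'m. v $ k * v $ l) \<in> borel_measurable borel" for k l by measurable
  note int2 = increment_cross_moment[OF st]
  let ?c = "\<lambda>k l \<omega>. column k (\<eta> \<omega>) \<bullet> (A \<omega> *v column l (\<eta> \<omega>))"
  have GAG: "G \<omega> \<bullet> (A \<omega> *v G \<omega>) = (\<Sum>k\<in>UNIV. \<Sum>l\<in>UNIV. ?c k l \<omega> * (?D \<omega> $ k * ?D \<omega> $ l))" for \<omega>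
  proof -
    have "A \<omega> *v G \<omega> = (\<Sum>l\<in>UNIV. (?D \<omega> $ l) *\<^sub>R (A \<omega> *v column l (\<eta> \<omega>)))"
      unfolding G_def matrix_vector_mult_columns[of "\<eta> \<omega>"]
      by (simp add: linear_sum[OF matrix_vector_mul_linear] matrix_vector_mult_scaleR)
    then show ?thesis
      unfolding G_def matrix_vector_mult_columns[of "\<eta> \<omega>"]
      by (simp add: inner_sum_right inner_sum_left sum_distrib_left ac_simps) (subst sum.swap, intro sum.cong refl mult.left_commute)
  qed
  have coef2: "?c k l \<in> borel_measurable (F s)" for k l by measurable
  have coef2_bnd: "\<bar>?c k l \<omega>\<bar> \<le> KA * K\<eta> * K\<eta>" if "\<omega> \<in> space M" for \<omega> k l
  proof -
    have "\<bar>?c k l \<omega>\<bar> \<le> norm (A \<omega>) * norm (column k (\<eta> \<omega>)) * norm (column l (\<eta> \<omega>))" by (rule inner_matrix_vector_le)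
    also have "\<dots> \<le> KA * K\<eta> * K\<eta>" using bnd[OF that] K0
      by (intro mult_mono order_trans[OF norm_column_le] mult_nonneg_nonneg) auto
    finally show ?thesis .
  qed
  note E2 = past_increment_expectation[OF st coef2 coef2_bnd h2 int2(1)]
  have int_c: "integrable M (?c k l)" for k l
    using coef2_bnd measurable_F_imp_M[OF st(1) coef2] by (intro integrable_const_bound[of _ "KA * K\<eta> * K\<eta>"]) auto
  show "integrable M (\<lambda>\<omega>. G \<omega> \<bullet> (A \<omega> *v G \<omega>))" unfolding GAG using E2(1) by auto
  show "integrable M (\<lambda>\<omega>. trace (transpose (\<eta> \<omega>) ** A \<omega> ** \<eta> \<omega>))"
    unfolding trace_quadratic_eq_columns using int_c by auto
  have "(\<integral>\<omega>. G \<omega> \<bullet> (A \<omega> *v G \<omega>) \<partial>M) = (\<Sum>k\<in>UNIV. \<Sum>l\<in>UNIV. (\<integral>\<omega>. ?c k l \<omega> \<partial>M) * (if k = l then t - s else 0))"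
    unfolding GAG using E2 int2(2) by (simp add: Bochner_Integration.integral_sum)
  also have "\<dots> = (\<Sum>k\<in>UNIV. (\<integral>\<omega>. ?c k k \<omega> \<partial>M) * (t - s))"
    by (simp add: if_distrib[of "\<lambda>r. _ * r"] cong: if_cong)
  also have "\<dots> = (t - s) * (\<integral>\<omega>. trace (transpose (\<eta> \<omega>) ** A \<omega> ** \<eta> \<omega>) \<partial>M)"
    unfolding trace_quadratic_eq_columns using int_c
    by (simp add: Bochner_Integration.integral_sum sum_distrib_left mult.commute)
  finally show "(\<integral>\<omega>. G \<omega> \<bullet> (A \<omega> *v G \<omega>) \<partial>M) = (t - s) * (\<integral>\<omega>. trace (transpose (\<eta> \<omega>) ** A \<omega> ** \<eta> \<omega>) \<partial>M)" .
  have Gn: "norm (G \<omega>) \<le> K\<eta> * norm (?D \<omega>)" if "\<omega> \<in> space M" for \<omega>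
    unfolding G_def using bnd(2)[OF that]
    by (intro order_trans[OF norm_matrix_vector_mult_le] mult_right_mono) auto
  have G2: "(norm (G \<omega>))\<^sup>2 \<le> K\<eta>\<^sup>2 * (norm (?D \<omega>))\<^sup>2" if "\<omega> \<in> space M" for \<omega>
    using power_mono[OF Gn[OF that], of 2] by (simp add: power_mult_distrib)
  have G4: "norm (G \<omega>) ^ 4 \<le> K\<eta> ^ 4 * norm (?D \<omega>) ^ 4" if "\<omega> \<in> space M" for \<omega>
    using power_mono[OF Gn[OF that], of 4] by (simp add: power_mult_distrib)
  note N = increment_norm_moments[OF st]
  have I2: "integrable M (\<lambda>\<omega>. K\<eta>\<^sup>2 * (norm (?D \<omega>))\<^sup>2)" and I4: "integrable M (\<lambda>\<omega>. K\<eta> ^ 4 * norm (?D \<omega>) ^ 4)"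
    using N by auto
  show i2: "integrable M (\<lambda>\<omega>. (norm (G \<omega>))\<^sup>2)"
    by (rule Bochner_Integration.integrable_bound[OF I2])
      (use Gm G2 in \<open>auto intro!: AE_I2\<close>)
  show i4: "integrable M (\<lambda>\<omega>. norm (G \<omega>) ^ 4)"
    by (rule Bochner_Integration.integrable_bound[OF I4])
      (use Gm G4 in \<open>auto intro!: AE_I2\<close>)
  have "(\<integral>\<omega>. (norm (G \<omega>))\<^sup>2 \<partial>M) \<le> (\<integral>\<omega>. K\<eta>\<^sup>2 * (norm (?D \<omega>))\<^sup>2 \<partial>M)" by (intro integral_mono i2 I2 G2)
  also have "\<dots> = K\<eta>\<^sup>2 * real CARD('m) * (t - s)" using N by simp
  finally show "(\<integral>\<omega>. (norm (G \<omega>))\<^sup>2 \<partial>M) \<le> K\<eta>\<^sup>2 * real CARD('m) * (t - s)" .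
  have "(\<integral>\<omega>. norm (G \<omega>) ^ 4 \<partial>M) \<le> (\<integral>\<omega>. K\<eta> ^ 4 * norm (?D \<omega>) ^ 4 \<partial>M)" by (intro integral_mono i4 I4 G4)
  also have "\<dots> = K\<eta> ^ 4 * (\<integral>\<omega>. norm (?D \<omega>) ^ 4 \<partial>M)" using N by simp
  also have "\<dots> \<le> K\<eta> ^ 4 * (3 * (real CARD('m))\<^sup>2 * (t - s)\<^sup>2)" using N K0 by (intro mult_left_mono) auto
  finally show "(\<integral>\<omega>. norm (G \<omega>) ^ 4 \<partial>M) \<le> K\<eta> ^ 4 * (3 * (real CARD('m))\<^sup>2) * (t - s)\<^sup>2" by (simp add: ac_simps)
qed

end

text \<open>An uncountable conjunction over times is measurable because, for continuous paths, it is equivalent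
to the conjunction over a countable dense set of times.\<close>

lemma (in wiener_process) path_constraint_in_F:
  assumes "a \<le> b" and Om: "Om \<in> sets (F b)"
    and meas: "\<And>r. r \<in> {a..b} \<Longrightarrow> \<psi> r \<in> borel_measurable (F b)"
    and cont: "\<And>\<omega>. \<omega> \<in> Om \<Longrightarrow> continuous_on {a..b} (\<lambda>r. \<psi> r \<omega> :: real)"
  shows "{\<omega>\<in>Om. \<forall>r\<in>{a..b}. \<psi> r \<omega> \<le> c} \<in> sets (F b)"
proof -
  obtain D where D: "countable D" "D \<subseteq> {a..b}" "{a..b} \<subseteq> closure D"
    using separable by metis
  have "(\<forall>r\<in>{a..b}. \<psi> r \<omega> \<le> c) \<longleftrightarrow> (\<forall>r\<in>D. \<psi> r \<omega> \<le> c)" if "\<omega> \<in> Om" for \<omega>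
  proof
    assume *: "\<forall>r\<in>D. \<psi> r \<omega> \<le> c"
    have "closed {r\<in>{a..b}. \<psi> r \<omega> \<le> c}"
      by (intro continuous_on_closed_Collect_le cont that closed_atLeastAtMost continuous_on_const)
    then have "closure D \<subseteq> {r\<in>{a..b}. \<psi> r \<omega> \<le> c}"
      using * D by (intro closure_minimal) auto
    then show "\<forall>r\<in>{a..b}. \<psi> r \<omega> \<le> c" using D by auto
  qed (use D in auto)
  then have "{\<omega>\<in>Om. \<forall>r\<in>{a..b}. \<psi> r \<omega> \<le> c} = Om \<inter> {\<omega>\<in>space (F b). \<forall>r\<in>D. \<psi> r \<omega> \<le> c}"
    using sets.sets_into_space[OF Om] by auto
  also have "\<dots> \<in> sets (F b)"
  proof (intro sets.Int Om sets.sets_Collect_countable_All' D(1))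
    fix r assume "r \<in> D"
    then have [measurable]: "\<psi> r \<in> borel_measurable (F b)" using meas D by auto
    show "{\<omega> \<in> space (F b). \<psi> r \<omega> \<le> c} \<in> sets (F b)" by measurable
  qed
  finally show ?thesis .
qed

lemma (in prob_space) prob_tendsto_1_if_eventually:
  assumes A: "\<And>n. A n \<in> events" and "AE \<omega> in M. \<forall>\<^sub>F n in sequentially. \<omega> \<in> A n"
  shows "(\<lambda>n. prob (A n)) \<longlonglongrightarrow> 1"
proof -
  have "(\<lambda>n. \<integral>\<omega>. indicator (A n) \<omega> \<partial>M) \<longlonglongrightarrow> (\<integral>\<omega>. (1::real) \<partial>M)"
  proof (rule integral_dominated_convergence[where w = "\<lambda>_. 1"])
    show "AE \<omega> in M. (\<lambda>n. indicator (A n) \<omega> :: real) \<longlonglongrightarrow> 1"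
      using assms(2)
    proof eventually_elim
      case (elim \<omega>)
      then have "\<forall>\<^sub>F n in sequentially. 1 = (indicator (A n) \<omega> :: real)"
        by eventually_elim simp
      then show ?case by (rule Lim_transform_eventually[OF tendsto_const])
    qed
  qed (use A in auto)
  then show ?thesis using A by (simp add: prob_space)
qed

section \<open>Lyapunov diffusions and their discretisation\<close>

text \<open>The setting of the expectation bound, free of any switching: a process with drift \<open>b\<close> and diffusion \<open>g (x)\<close>. The drift is only a
path-wise integrable function; its integral is adapted because it equals \<open>x - \<phi> - I\<close>. The event \<open>Om\<close> of
full probability collects the paths on which all path-wise statements hold; it belongs to \<open>F 0\<close>, so intersecting
with it preserves adaptedness.\<close>

locale lyapunov_diffusion = wiener_process M F W
  for M :: "'w measure" and F :: "real \<Rightarrow> 'w measure" and W :: "real \<Rightarrow> 'w \<Rightarrow> real^'m" +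
  fixes x I b :: "real \<Rightarrow> 'w \<Rightarrow> real^'n" and g :: "real^'n \<Rightarrow> real^'m^'n"
    and V :: "real^'n \<Rightarrow> real" and \<phi> :: "real^'n" and Om :: "'w set" and lam C c2 :: real
  assumes x_adapted: "adapted F x"
    and I_ito: "is_ito_integral M F W (\<lambda>s \<omega>. g (x s \<omega>)) I"
    and Om: "Om \<in> sets (F 0)" "AE \<omega> in M. \<omega> \<in> Om"
    and x_cont: "\<And>\<omega>. \<omega> \<in> Om \<Longrightarrow> continuous_on {0..} (\<lambda>t. x t \<omega>)"
    and drift_integrable: "\<And>\<omega> t. \<omega> \<in> Om \<Longrightarrow> 0 \<le> t \<Longrightarrow> set_integrable lborel {0..t} (\<lambda>s. b s \<omega>)"
    and equation: "\<And>\<omega> t. \<omega> \<in> Om \<Longrightarrow> 0 \<le> t \<Longrightarrow> x t \<omega> = \<phi> + (LINT s:{0..t}|lborel. b s \<omega>) + I t \<omega>"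
    and drift_bounded: "\<And>R. \<exists>B. \<forall>\<omega>\<in>Om. \<forall>t\<ge>0. norm (x t \<omega>) \<le> R \<longrightarrow> norm (b t \<omega>) \<le> B"
    and C2_V: "C2 V" and V_growth: "\<And>y. 0 \<le> V y \<and> V y \<le> c2 * (norm y)\<^sup>2"
    and g_cont: "continuous_on UNIV g" and lam: "lam > 0" and C: "C \<ge> 0"
    and generator_bound: "\<And>\<omega> t. \<omega> \<in> Om \<Longrightarrow> 0 \<le> t \<Longrightarrow>
      gradient V (x t \<omega>) \<bullet> b t \<omega> + trace (transpose (g (x t \<omega>)) ** hessian V (x t \<omega>) ** g (x t \<omega>)) / 2
        + lam * V (x t \<omega>) \<le> C * exp (- lam * t)"

text \<open>A simple integrand \<open>\<xi>\<close> with partition \<open>p\<close> and a grid \<open>q\<close> of \<open>{0..T}\<close> that refines it, together with the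
tolerances of the localisation: \<open>R\<close> bounds the path, \<open>\<delta>\<close> the distances, \<open>\<kappa>\<close> the accumulated mean-square error of the integrand.\<close>

locale grid_approximation = lyapunov_diffusion M F W x I b g V \<phi> Om lam C c2
  for M :: "'w measure" and F :: "real \<Rightarrow> 'w measure" and W :: "real \<Rightarrow> 'w \<Rightarrow> real^'m"
    and x I b :: "real \<Rightarrow> 'w \<Rightarrow> real^'n" and g :: "real^'n \<Rightarrow> real^'m^'n"
    and V :: "real^'n \<Rightarrow> real" and \<phi> :: "real^'n" and Om :: "'w set" and lam C c2 :: real +
  fixes L :: nat and p :: "nat \<Rightarrow> real" and \<xi> :: "nat \<Rightarrow> 'w \<Rightarrow> real^'m^'n"
    and N :: nat and q :: "nat \<Rightarrow> real" and T h R \<delta> \<kappa> :: real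
  assumes simple: "simple_integrand M F L p \<xi>"
    and q0: "q 0 = 0" and qN: "q N = T" and q_less: "\<And>j. j < N \<Longrightarrow> q j < q (Suc j)"
    and mesh: "\<And>j. j < N \<Longrightarrow> q (Suc j) - q j \<le> h"
    and refines: "\<And>i j. j < N \<Longrightarrow> i \<le> L \<Longrightarrow> p i \<le> q j \<or> q (Suc j) \<le> p i"
    and q_range: "\<And>j. j \<le> N \<Longrightarrow> q j \<in> {0..T}"
    and h: "0 \<le> h" "h \<le> 1" and \<delta>: "0 \<le> \<delta>" "\<delta> \<le> 1" and \<kappa>: "0 \<le> \<kappa>"
begin

text \<open>\<open>Y\<close> follows the drift of \<open>x\<close> and the noise of the simple integrand. On \<open>\<Gamma> j\<close> it is within \<open>\<delta>\<close> of \<open>x\<close> at the \<open>j\<close>-th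
grid time, because \<open>Y - x = J - I\<close>. The last two constraints of \<open>\<Gamma> j\<close> concern the cells before the
\<open>j\<close>-th grid time only: the \<open>j\<close>-th cell lies in the future, and is covered as soon as \<open>\<Gamma> (Suc j)\<close> is assumed.\<close>

definition "J t \<omega> = simple_integral W L p \<xi> t \<omega>"
definition "Y j \<omega> = x (q j) \<omega> - I (q j) \<omega> + J (q j) \<omega>"
definition "\<eta> j \<omega> = (\<Sum>i<L. if p i \<le> q j \<and> q (Suc j) \<le> p (Suc i) then \<xi> i \<omega> else 0)"
definition "\<Delta> j = q (Suc j) - q j"
definition "G j \<omega> = \<eta> j \<omega> *v (W (q (Suc j)) \<omega> - W (q j) \<omega>)"
definition "\<Gamma> j = {\<omega>\<in>Om. (\<forall>r\<in>{0..q j}. norm (x r \<omega>) \<le> R) \<and> (\<forall>i\<in>{..j}. norm (J (q i) \<omega> - I (q i) \<omega>) \<le> \<delta>) \<and>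
  (\<forall>i\<in>{..<j}. \<forall>r\<in>{q i..q (Suc i)}. dist (x r \<omega>) (x (q i) \<omega>) \<le> \<delta>) \<and>
  (\<Sum>i<j. (norm (\<eta> i \<omega> - g (x (q i) \<omega>)))\<^sup>2 * \<Delta> i) \<le> \<kappa>}"

lemma q_mono: "i \<le> j \<Longrightarrow> j \<le> N \<Longrightarrow> q i \<le> q j"
proof (induction j)
  case (Suc j)
  then show ?case using q_less[of j] by (cases "i = Suc j") auto
qed simp

lemma q_nonneg: "j \<le> N \<Longrightarrow> 0 \<le> q j"
  using q_range[of j] by simp

lemma \<Delta>: "j < N \<Longrightarrow> 0 < \<Delta> j" "j < N \<Longrightarrow> \<Delta> j \<le> h" "j < N \<Longrightarrow> \<Delta> j \<le> 1"
  using q_less mesh h unfolding \<Delta>_def by force+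

lemma sum_\<Delta>: "(\<Sum>j<N. \<Delta> j) = T"
  unfolding \<Delta>_def using sum_lessThan_telescope[of q N] q0 qN by simp

lemma p_props: "i < L \<Longrightarrow> p i \<le> p (Suc i)" "i \<le> L \<Longrightarrow> 0 \<le> p i"
proof -
  show *: "p i \<le> p (Suc i)" if "i < L" for i using simple that unfolding simple_integrand_def by auto
  show "0 \<le> p i" if "i \<le> L"
    using that
  proof (induction i)
    case 0 then show ?case using simple unfolding simple_integrand_def by auto
  next
    case (Suc i) then show ?case using *[of i] by auto
  qed
qed

lemma \<xi>_measurable: "i < L \<Longrightarrow> \<xi> i \<in> borel_measurable (F (p i))"
  using simple unfolding simple_integrand_def by auto

lemma \<eta>_measurable: "\<eta> j \<in> borel_measurable (F (q j))"
  unfolding \<eta>_def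
proof (rule borel_measurable_sum)
  fix i assume "i \<in> {..<L}"
  then show "(\<lambda>\<omega>. if p i \<le> q j \<and> q (Suc j) \<le> p (Suc i) then \<xi> i \<omega> else 0) \<in> borel_measurable (F (q j))"
    using measurable_F_mono[OF _ \<xi>_measurable, of i "q j"] by (cases "p i \<le> q j") auto
qed

lemma \<eta>_bounded:
  assumes "\<And>i. i < L \<Longrightarrow> norm (\<xi> i \<omega>) \<le> B i"
  shows "norm (\<eta> j \<omega>) \<le> (\<Sum>i<L. \<bar>B i\<bar>)"
  unfolding \<eta>_def using assms
  by (intro order_trans[OF norm_sum] sum_mono) (auto intro: order_trans[OF _ abs_ge_self])

lemma J_increment: "j < N \<Longrightarrow> J (q (Suc j)) \<omega> - J (q j) \<omega> = G j \<omega>"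
  unfolding J_def G_def \<eta>_def
  by (intro simple_integrand_on_cell(1) refines p_props q_less) auto

lemma simple_process_on_cell:
  "j < N \<Longrightarrow> q j < r \<Longrightarrow> r \<le> q (Suc j) \<Longrightarrow> simple_process L p \<xi> r \<omega> = \<eta> j \<omega>"
  unfolding \<eta>_def
  by (intro simple_integrand_on_cell(2) refines p_props q_less) auto

lemma J_0: "J 0 \<omega> = 0"
  unfolding J_def simple_integral_def using p_props(2) by (intro sum.neutral) auto

lemma J_measurable: "j \<le> N \<Longrightarrow> J (q j) \<in> borel_measurable (F (q j))"
proof (induction j)
  case 0
  then show ?case using J_0 q0 by (simp add: fun_eq_iff cong: measurable_cong)
next
  case (Suc j)
  have eq: "J (q (Suc j)) = (\<lambda>\<omega>. J (q j) \<omega> + G j \<omega>)"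
    using J_increment[of j] Suc by (auto simp: fun_eq_iff algebra_simps)
  have le: "q j \<le> q (Suc j)" using q_less[of j] Suc by simp
  have W: "W t \<in> borel_measurable (F t)" if "0 \<le> t" for t using W_adapted that unfolding adapted_def by blast
  have [measurable]: "J (q j) \<in> borel_measurable (F (q (Suc j)))" "\<eta> j \<in> borel_measurable (F (q (Suc j)))"
    "W (q j) \<in> borel_measurable (F (q (Suc j)))" "W (q (Suc j)) \<in> borel_measurable (F (q (Suc j)))"
    using Suc measurable_F_mono[OF le] \<eta>_measurable W[of "q j"] W[of "q (Suc j)"] q_nonneg[of j] q_nonneg[of "Suc j"] by auto
  show ?case unfolding eq G_def by measurable
qed

lemma x_I_measurable:
  assumes "0 \<le> r" "r \<le> t"
  shows "x r \<in> borel_measurable (F t)" "I r \<in> borel_measurable (F t)"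
  using x_adapted I_ito assms measurable_F_mono unfolding adapted_def is_ito_integral_def by blast+

lemma Y_measurable: "j \<le> N \<Longrightarrow> Y j \<in> borel_measurable (F (q j))"
  unfolding Y_def using J_measurable[of j] x_I_measurable[of "q j" "q j"] q_nonneg[of j] by measurable

lemma Om_in_F: "0 \<le> t \<Longrightarrow> Om \<in> sets (F t)"
  using Om(1) sets_F_mono[of 0 t] by auto

lemma Om_space: "Om \<subseteq> space M"
  using sets.sets_into_space[OF Om(1)] space_F by simp

lemma path_cont: "\<omega> \<in> Om \<Longrightarrow> 0 \<le> a \<Longrightarrow> continuous_on {a..b'} (\<lambda>r. x r \<omega>)"
  using x_cont[of \<omega>] by (rule continuous_on_subset) auto

lemma cell_osc_in_F:
  assumes "i < N"
  shows "{\<omega>\<in>Om. \<forall>r\<in>{q i..q (Suc i)}. dist (x r \<omega>) (x (q i) \<omega>) \<le> \<delta>} \<in> sets (F (q (Suc i)))"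
proof (rule path_constraint_in_F)
  have qi: "q i \<le> q (Suc i)" "0 \<le> q i" using q_less[of i] q_nonneg[of i] assms by auto
  then show "q i \<le> q (Suc i)" "Om \<in> sets (F (q (Suc i)))" by (auto intro: Om_in_F)
  fix r assume "r \<in> {q i..q (Suc i)}"
  then have [measurable]: "x r \<in> borel_measurable (F (q (Suc i)))" "x (q i) \<in> borel_measurable (F (q (Suc i)))"
    using x_I_measurable[of r "q (Suc i)"] x_I_measurable[of "q i" "q (Suc i)"] qi by auto
  show "(\<lambda>\<omega>. dist (x r \<omega>) (x (q i) \<omega>)) \<in> borel_measurable (F (q (Suc i)))" by measurable
qed (use q_nonneg[of i] assms in \<open>auto intro!: continuous_intros path_cont\<close>)

lemma \<Gamma>_in_F:
  assumes j: "j \<le> N"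
  shows "\<Gamma> j \<in> sets (F (q j))"
proof -
  have qj: "0 \<le> q j" using q_nonneg j by auto
  have 1: "{\<omega>\<in>Om. \<forall>r\<in>{0..q j}. norm (x r \<omega>) \<le> R} \<in> sets (F (q j))"
  proof (rule path_constraint_in_F)
    fix r assume "r \<in> {0..q j}"
    then have [measurable]: "x r \<in> borel_measurable (F (q j))" using x_I_measurable[of r "q j"] by auto
    show "(\<lambda>\<omega>. norm (x r \<omega>)) \<in> borel_measurable (F (q j))" by measurable
  qed (auto intro!: continuous_intros path_cont Om_in_F qj)
  have 2: "{\<omega>\<in>Om. \<forall>r\<in>{q i..q (Suc i)}. dist (x r \<omega>) (x (q i) \<omega>) \<le> \<delta>} \<in> sets (F (q j))" if "i < j" for i
    using cell_osc_in_F[of i] sets_F_mono[of "q (Suc i)" "q j"] q_mono[of "Suc i" j] that j by auto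
  have 3: "{\<omega>\<in>space (F (q j)). norm (J (q i) \<omega> - I (q i) \<omega>) \<le> \<delta>} \<in> sets (F (q j))" if "i \<le> j" for i
  proof -
    have qi: "0 \<le> q i" "q i \<le> q j" using q_mono[of i j] q_nonneg[of i] that j by auto
    have [measurable]: "J (q i) \<in> borel_measurable (F (q j))" "I (q i) \<in> borel_measurable (F (q j))"
      using x_I_measurable[OF qi] measurable_F_mono[OF qi(2) J_measurable] that j by auto
    show ?thesis by measurable
  qed
  have 4: "{\<omega>\<in>space (F (q j)). (\<Sum>i<j. (norm (\<eta> i \<omega> - g (x (q i) \<omega>)))\<^sup>2 * \<Delta> i) \<le> \<kappa>} \<in> sets (F (q j))"
  proof -
    have [measurable]: "\<eta> i \<in> borel_measurable (F (q j))" "x (q i) \<in> borel_measurable (F (q j))" if "i < j" for i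
      using x_I_measurable[of "q i" "q j"] measurable_F_mono[OF _ \<eta>_measurable] q_mono[of i j] q_nonneg[of i] that j by auto
    have [measurable]: "g \<in> borel_measurable borel" using g_cont by (rule borel_measurable_continuous_onI)
    have "(\<lambda>\<omega>. \<Sum>i<j. (norm (\<eta> i \<omega> - g (x (q i) \<omega>)))\<^sup>2 * \<Delta> i) \<in> borel_measurable (F (q j))"
      by (intro borel_measurable_sum) (auto intro!: borel_measurable_times borel_measurable_power borel_measurable_norm borel_measurable_diff measurable_compose[of "x _" _ borel g])
    then show ?thesis by measurable
  qed
  have "\<Gamma> j = {\<omega>\<in>Om. \<forall>r\<in>{0..q j}. norm (x r \<omega>) \<le> R}
      \<inter> {\<omega>\<in>space (F (q j)). \<forall>i\<in>{..j}. norm (J (q i) \<omega> - I (q i) \<omega>) \<le> \<delta>}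
      \<inter> {\<omega>\<in>space (F (q j)). \<forall>i\<in>{..<j}. \<omega> \<in> {\<omega>\<in>Om. \<forall>r\<in>{q i..q (Suc i)}. dist (x r \<omega>) (x (q i) \<omega>) \<le> \<delta>}}
      \<inter> {\<omega>\<in>space (F (q j)). (\<Sum>i<j. (norm (\<eta> i \<omega> - g (x (q i) \<omega>)))\<^sup>2 * \<Delta> i) \<le> \<kappa>}"
    unfolding \<Gamma>_def using Om_space space_F[of "q j"] by auto
  also have "\<dots> \<in> sets (F (q j))"
  proof (intro sets.Int 1 4)
    show "{\<omega>\<in>space (F (q j)). \<forall>i\<in>{..j}. norm (J (q i) \<omega> - I (q i) \<omega>) \<le> \<delta>} \<in> sets (F (q j))"
      by (intro sets.sets_Collect_finite_All' 3) auto
    show "{\<omega>\<in>space (F (q j)). \<forall>i\<in>{..<j}. \<omega> \<in> {\<omega>\<in>Om. \<forall>r\<in>{q i..q (Suc i)}. dist (x r \<omega>) (x (q i) \<omega>) \<le> \<delta>}} \<in> sets (F (q j))"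
    proof (intro sets.sets_Collect_countable_All' countable_finite finite_lessThan)
      fix i assume "i \<in> {..<j}"
      moreover have "{\<omega>\<in>space (F (q j)). \<omega> \<in> {\<omega>\<in>Om. \<forall>r\<in>{q i..q (Suc i)}. dist (x r \<omega>) (x (q i) \<omega>) \<le> \<delta>}}
          = {\<omega>\<in>Om. \<forall>r\<in>{q i..q (Suc i)}. dist (x r \<omega>) (x (q i) \<omega>) \<le> \<delta>}"
        using Om_space space_F[of "q j"] by auto
      ultimately show "{\<omega>\<in>space (F (q j)). \<omega> \<in> {\<omega>\<in>Om. \<forall>r\<in>{q i..q (Suc i)}. dist (x r \<omega>) (x (q i) \<omega>) \<le> \<delta>}} \<in> sets (F (q j))"
        using 2[of i] by simp
    qed
  qed
  finally show ?thesis .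
qed

lemma \<Gamma>_in_M: "j \<le> N \<Longrightarrow> \<Gamma> j \<in> sets M"
  using \<Gamma>_in_F[of j] sets_F_subset[of "q j"] q_nonneg[of j] by auto

lemma \<Gamma>_antimono: "j < N \<Longrightarrow> \<Gamma> (Suc j) \<subseteq> \<Gamma> j"
proof
  fix \<omega> assume j: "j < N" and \<omega>: "\<omega> \<in> \<Gamma> (Suc j)"
  have "(\<Sum>i<j. (norm (\<eta> i \<omega> - g (x (q i) \<omega>)))\<^sup>2 * \<Delta> i) \<le> (\<Sum>i<Suc j. (norm (\<eta> i \<omega> - g (x (q i) \<omega>)))\<^sup>2 * \<Delta> i)"
    using \<Delta>(1)[OF j] by simp
  then show "\<omega> \<in> \<Gamma> j" using \<omega> q_less[OF j] unfolding \<Gamma>_def by fastforce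
qed

lemma \<Gamma>D:
  assumes "\<omega> \<in> \<Gamma> j" "j \<le> N"
  shows "\<omega> \<in> Om" "norm (x (q j) \<omega>) \<le> R" "dist (Y j \<omega>) (x (q j) \<omega>) \<le> \<delta>" "norm (Y j \<omega>) \<le> R + 1"
proof -
  show "\<omega> \<in> Om" and xR: "norm (x (q j) \<omega>) \<le> R" using assms q_nonneg[of j] unfolding \<Gamma>_def by auto
  show d: "dist (Y j \<omega>) (x (q j) \<omega>) \<le> \<delta>"
    using assms unfolding \<Gamma>_def Y_def by (auto simp: dist_norm algebra_simps)
  show "norm (Y j \<omega>) \<le> R + 1"
    using norm_triangle_ineq[of "x (q j) \<omega>" "Y j \<omega> - x (q j) \<omega>"] d xR \<delta> by (simp add: dist_norm)
qed

end

section \<open>One step of the discretised Lyapunov function\<close>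

context grid_approximation
begin

text \<open>The drift is integrated over a cell, whereas the noise enters through the single value \<open>\<eta> j\<close>.\<close>

lemma Y_step:
  assumes j: "j < N" and \<omega>: "\<omega> \<in> Om"
  shows "Y (Suc j) \<omega> = Y j \<omega> + (LINT s:{q j<..q (Suc j)}|lborel. b s \<omega>) + G j \<omega>"
proof -
  have qj: "0 \<le> q j" "q j \<le> q (Suc j)" using q_nonneg[of j] q_less[of j] j by auto
  have int: "set_integrable lborel {0..q (Suc j)} (\<lambda>s. b s \<omega>)" using drift_integrable \<omega> qj by simp
  have "{0..q (Suc j)} = {0..q j} \<union> {q j<..q (Suc j)}" using qj by auto
  moreover have "(LINT s:{0..q j} \<union> {q j<..q (Suc j)}|lborel. b s \<omega>)
      = (LINT s:{0..q j}|lborel. b s \<omega>) + (LINT s:{q j<..q (Suc j)}|lborel. b s \<omega>)"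
    using qj by (intro set_integral_Un set_integrable_subset[OF int]) auto
  ultimately show ?thesis
    using equation[OF \<omega>, of "q j"] equation[OF \<omega>, of "q (Suc j)"] J_increment[OF j, of \<omega>] qj
    unfolding Y_def by (simp add: algebra_simps)
qed

lemma drift_increment:
  assumes j: "j < N" and \<omega>: "\<omega> \<in> Om"
  shows "(\<And>r. r \<in> {q j..q (Suc j)} \<Longrightarrow> norm (b r \<omega>) \<le> B) \<Longrightarrow>
      norm (LINT s:{q j<..q (Suc j)}|lborel. b s \<omega>) \<le> B * \<Delta> j"
    and "(\<And>r. r \<in> {q j..q (Suc j)} \<Longrightarrow> v \<bullet> b r \<omega> \<le> c) \<Longrightarrow>
      v \<bullet> (LINT s:{q j<..q (Suc j)}|lborel. b s \<omega>) \<le> c * \<Delta> j"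
proof -
  let ?A = "{q j<..q (Suc j)}"
  have qj: "0 \<le> q j" "q j \<le> q (Suc j)" using q_nonneg[of j] q_less[of j] j by auto
  have int: "set_integrable lborel ?A (\<lambda>s. b s \<omega>)"
    by (rule set_integrable_subset[OF drift_integrable[OF \<omega>, of "q (Suc j)"]]) (use qj in auto)
  have const: "(LINT s:?A|lborel. c) = c * \<Delta> j" "set_integrable lborel ?A (\<lambda>_. c)" for c :: real
    using qj by (auto simp: set_integral_const \<Delta>_def set_integrable_def)
  show "norm (LINT s:?A|lborel. b s \<omega>) \<le> B * \<Delta> j"
    if "\<And>r. r \<in> {q j..q (Suc j)} \<Longrightarrow> norm (b r \<omega>) \<le> B"
  proof -
    have "norm (LINT s:?A|lborel. b s \<omega>) \<le> (LINT s:?A|lborel. norm (b s \<omega>))" by (rule set_integral_norm_bound[OF int])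
    also have "\<dots> \<le> (LINT s:?A|lborel. B)"
      using that by (intro set_integral_mono set_integrable_norm int const) auto
    finally show ?thesis unfolding const .
  qed
  show "v \<bullet> (LINT s:?A|lborel. b s \<omega>) \<le> c * \<Delta> j"
    if "\<And>r. r \<in> {q j..q (Suc j)} \<Longrightarrow> v \<bullet> b r \<omega> \<le> c"
  proof -
    have int': "integrable lborel (\<lambda>s. indicator ?A s *\<^sub>R b s \<omega>)" using int unfolding set_integrable_def .
    have intv: "set_integrable lborel ?A (\<lambda>s. v \<bullet> b s \<omega>)"
      using integrable_inner_right[of v lborel, OF int'] unfolding set_integrable_def by simp
    have "v \<bullet> (LINT s:?A|lborel. b s \<omega>) = (LINT s:?A|lborel. v \<bullet> b s \<omega>)"
      unfolding set_lebesgue_integral_def using integral_inner_right[of v lborel, OF int'] by simp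
    also have "\<dots> \<le> (LINT s:?A|lborel. c)"
      using that by (intro set_integral_mono intv const) auto
    finally show ?thesis unfolding const .
  qed
qed

end

text \<open>The constants of the Taylor and continuity estimates at scale \<open>R\<close>. They are fixed here as parameters because they have to
be chosen before the mesh \<open>h\<close>: \<open>K\<eta>\<close> depends on the simple integrand only, \<open>\<epsilon>\<close> may depend on \<open>K\<eta>\<close>, and \<open>K1\<close> on \<open>\<epsilon>\<close>.\<close>

locale grid_estimate = grid_approximation M F W x I b g V \<phi> Om lam C c2 L p \<xi> N q T h R \<delta> \<kappa>
  for M :: "'w measure" and F :: "real \<Rightarrow> 'w measure" and W :: "real \<Rightarrow> 'w \<Rightarrow> real^'m"
    and x I b :: "real \<Rightarrow> 'w \<Rightarrow> real^'n" and g :: "real^'n \<Rightarrow> real^'m^'n"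
    and V :: "real^'n \<Rightarrow> real" and \<phi> :: "real^'n" and Om :: "'w set" and lam C c2 :: real
    and L :: nat and p :: "nat \<Rightarrow> real" and \<xi> :: "nat \<Rightarrow> 'w \<Rightarrow> real^'m^'n"
    and N :: nat and q :: "nat \<Rightarrow> real" and T h R \<delta> \<kappa> :: real +
  fixes B \<epsilon> \<epsilon>' K1 K2 K3 K\<eta> :: real
  assumes drift_le_B: "\<And>\<omega> t. \<omega> \<in> Om \<Longrightarrow> 0 \<le> t \<Longrightarrow> norm (x t \<omega>) \<le> R \<Longrightarrow> norm (b t \<omega>) \<le> B"
    and const_nonneg: "B \<ge> 0" "\<epsilon> \<ge> 0" "\<epsilon>' \<ge> 0" "K1 \<ge> 0" "K2 \<ge> 0" "K3 \<ge> 0" "K\<eta> \<ge> 0"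
    and taylor: "\<And>y d G D. norm y \<le> R + 1 \<Longrightarrow> 0 \<le> D \<Longrightarrow> D \<le> 1 \<Longrightarrow> norm d \<le> B * D \<Longrightarrow>
      V (y + d + G) \<le> V y + gradient V y \<bullet> d + gradient V y \<bullet> G + (G \<bullet> (hessian V y *v G)) / 2
        + \<epsilon> * (norm G)\<^sup>2 + K1 * norm G ^ 4 + K1 * D\<^sup>2"
    and close: "\<And>x y z b \<eta>. norm x \<le> R \<Longrightarrow> norm z \<le> R \<Longrightarrow> dist y z \<le> \<delta> \<Longrightarrow> dist x z \<le> \<delta> \<Longrightarrow> norm b \<le> B \<Longrightarrow>
      gradient V y \<bullet> b + trace (transpose \<eta> ** hessian V y ** \<eta>) / 2 + lam * V y
      \<le> gradient V x \<bullet> b + trace (transpose (g x) ** hessian V x ** g x) / 2 + lam * V x + \<epsilon>' + K2 * (norm (\<eta> - g z))\<^sup>2"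
    and \<eta>_le: "\<And>j \<omega>. \<omega> \<in> space M \<Longrightarrow> norm (\<eta> j \<omega>) \<le> K\<eta>"
    and K3: "\<And>y (A :: real^'m^'n). norm y \<le> R + 1 \<Longrightarrow> norm A \<le> K\<eta> \<Longrightarrow> trace (transpose A ** hessian V y ** A) / 2 + lam * V y \<le> K3"
begin

text \<open>Multiplying gradient and Hessian by the indicator \<open>alive\<close> makes them bounded and keeps them known at the \<open>j\<close>-th grid time. The
\<open>defect\<close> is the contribution of a cell to the mean-square error of the integrand.\<close>

definition "alive j \<omega> = (indicator (\<Gamma> j) \<omega> :: real)"
definition "Z j \<omega> = alive j \<omega> * V (Y j \<omega>)"
definition "grad j \<omega> = alive j \<omega> *\<^sub>R gradient V (Y j \<omega>)"
definition "hess j \<omega> = alive j \<omega> *\<^sub>R hessian V (Y j \<omega>)"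
definition "defect j \<omega> = (norm (\<eta> j \<omega> - g (x (q j) \<omega>)))\<^sup>2 * \<Delta> j"

text \<open>The linear and quadratic noise terms are multiplied by \<open>alive j\<close>, which is known before the noise of the cell. The drift
can be controlled only if the path survives the cell, so it comes with \<open>alive (Suc j)\<close>. The generator term
left over when a path dies in the cell is absorbed by \<open>K3\<close> times the loss \<open>alive j - alive (Suc j)\<close>, which telescopes.\<close>

lemma step_pointwise:
  assumes j: "j < N" and \<omega>: "\<omega> \<in> space M"
  shows "Z (Suc j) \<omega> \<le> (1 - lam * \<Delta> j) * Z j \<omega> + grad j \<omega> \<bullet> G j \<omega>
    + ((G j \<omega> \<bullet> (hess j \<omega> *v G j \<omega>)) / 2 - \<Delta> j * trace (transpose (\<eta> j \<omega>) ** hess j \<omega> ** \<eta> j \<omega>) / 2)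
    + (\<epsilon> * (norm (G j \<omega>))\<^sup>2 + K1 * norm (G j \<omega>) ^ 4 + K1 * (\<Delta> j)\<^sup>2)
    + (alive (Suc j) \<omega> * \<Delta> j * (C * exp (- lam * q j) + \<epsilon>') + K2 * (alive (Suc j) \<omega> * defect j \<omega>))
    + (alive j \<omega> - alive (Suc j) \<omega>) * \<Delta> j * K3"
proof -
  let ?y = "Y j \<omega>" and ?G = "G j \<omega>" and ?D = "\<Delta> j"
  let ?tr = "trace (transpose (\<eta> j \<omega>) ** hessian V ?y ** \<eta> j \<omega>)"
  have D: "0 \<le> ?D" "?D \<le> 1" using \<Delta>[OF j] by auto
  have tr: "trace (transpose (\<eta> j \<omega>) ** hess j \<omega> ** \<eta> j \<omega>) = alive j \<omega> * ?tr"
    unfolding hess_def trace_quadratic_eq_columns by (simp add: scaleR_matrix_vector_assoc[symmetric] sum_distrib_left)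
  have hG: "?G \<bullet> (hess j \<omega> *v ?G) = alive j \<omega> * (?G \<bullet> (hessian V ?y *v ?G))"
    unfolding hess_def by (simp add: scaleR_matrix_vector_assoc[symmetric])
  have rest: "0 \<le> \<epsilon> * (norm ?G)\<^sup>2 + K1 * norm ?G ^ 4 + K1 * ?D\<^sup>2" using const_nonneg by auto
  consider "\<omega> \<notin> \<Gamma> j" | "\<omega> \<in> \<Gamma> j" "\<omega> \<notin> \<Gamma> (Suc j)" | "\<omega> \<in> \<Gamma> (Suc j)" "\<omega> \<in> \<Gamma> j"
    using \<Gamma>_antimono[OF j] by blast
  then show ?thesis
  proof cases
    case 1
    then have "alive j \<omega> = 0" "alive (Suc j) \<omega> = 0" using \<Gamma>_antimono[OF j] unfolding alive_def indicator_def by auto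
    then show ?thesis unfolding tr hG using rest by (simp add: Z_def grad_def)
  next
    case 2
    then have alive: "alive j \<omega> = 1" "alive (Suc j) \<omega> = 0" unfolding alive_def by auto
    have y: "norm ?y \<le> R + 1" using \<Gamma>D(4)[OF 2(1)] j by simp
    \<comment> \<open>the path dies in this cell: the left-hand side vanishes and the Taylor bound without drift shows that the right-hand side is nonnegative\<close>
    have "0 \<le> V (?y + 0 + ?G)" using V_growth by blast
    also have "\<dots> \<le> V ?y + gradient V ?y \<bullet> ?G + (?G \<bullet> (hessian V ?y *v ?G)) / 2
        + (\<epsilon> * (norm ?G)\<^sup>2 + K1 * norm ?G ^ 4 + K1 * ?D\<^sup>2)"
      using taylor[OF y D, of 0 ?G] const_nonneg D by (simp add: algebra_simps)
    finally have *: "0 \<le> \<dots>" .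
    have "?D * (?tr / 2 + lam * V ?y) \<le> ?D * K3" by (rule mult_left_mono[OF K3[OF y \<eta>_le[OF \<omega>]] D(1)])
    with * show ?thesis unfolding tr hG by (simp add: alive Z_def grad_def algebra_simps)
  next
    case 3
    then have alive: "alive j \<omega> = 1" "alive (Suc j) \<omega> = 1" unfolding alive_def by auto
    have y: "norm ?y \<le> R + 1" and Om: "\<omega> \<in> Om" and yz: "dist ?y (x (q j) \<omega>) \<le> \<delta>" and zR: "norm (x (q j) \<omega>) \<le> R"
      using \<Gamma>D[OF 3(2)] j by auto
    let ?d = "LINT s:{q j<..q (Suc j)}|lborel. b s \<omega>"
    have cell: "0 \<le> r" "norm (x r \<omega>) \<le> R" "dist (x r \<omega>) (x (q j) \<omega>) \<le> \<delta>" if "r \<in> {q j..q (Suc j)}" for r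
      using 3(1) that q_nonneg[of j] j unfolding \<Gamma>_def by auto
    have d: "norm ?d \<le> B * ?D" by (rule drift_increment(1)[OF j Om]) (use drift_le_B Om cell in auto)
    \<comment> \<open>the bound is constant on the cell, so integrating it requires no regularity in time of the terms on which it rests\<close>
    let ?c = "C * exp (- lam * q j) + \<epsilon>' + K2 * (norm (\<eta> j \<omega> - g (x (q j) \<omega>)))\<^sup>2 - ?tr / 2 - lam * V ?y"
    have "gradient V ?y \<bullet> ?d \<le> ?c * ?D"
    proof (rule drift_increment(2)[OF j Om])
      fix r assume r: "r \<in> {q j..q (Suc j)}"
      have "C * exp (- lam * r) \<le> C * exp (- lam * q j)" using r lam C by (intro mult_left_mono) auto
      then show "gradient V ?y \<bullet> b r \<omega> \<le> ?c"
        using close[OF cell(2)[OF r] zR yz cell(3)[OF r] drift_le_B[OF Om cell(1,2)[OF r]], of "\<eta> j \<omega>"]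
          generator_bound[OF Om cell(1)[OF r]] by linarith
    qed
    then have gd: "gradient V ?y \<bullet> ?d \<le> C * exp (- lam * q j) * ?D + \<epsilon>' * ?D + K2 * defect j \<omega> - ?tr / 2 * ?D - lam * V ?y * ?D"
      unfolding defect_def by (simp add: algebra_simps)
    have "V (Y (Suc j) \<omega>) = V (?y + ?d + ?G)" using Y_step[OF j Om] by simp
    also have "\<dots> \<le> V ?y + gradient V ?y \<bullet> ?d + gradient V ?y \<bullet> ?G + (?G \<bullet> (hessian V ?y *v ?G)) / 2
        + \<epsilon> * (norm ?G)\<^sup>2 + K1 * norm ?G ^ 4 + K1 * ?D\<^sup>2"
      by (rule taylor[OF y D d])
    finally show ?thesis using gd unfolding tr hG by (simp add: alive Z_def grad_def algebra_simps)
  qed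
qed

lemma alive_props: "0 \<le> alive j \<omega>" "alive j \<omega> \<le> 1"
  unfolding alive_def by (auto simp: indicator_def)

lemma alive_measurable: "j \<le> N \<Longrightarrow> alive j \<in> borel_measurable (F (q j))"
  unfolding alive_def using \<Gamma>_in_F by auto

lemma truncated_bounded:
  assumes "j \<le> N"
  shows "\<exists>K\<ge>0. \<forall>\<omega>. norm (Z j \<omega>) \<le> K \<and> norm (grad j \<omega>) \<le> K \<and> norm (hess j \<omega>) \<le> K"
proof -
  obtain K where K: "K \<ge> 0" "\<And>y. norm y \<le> R + 1 \<Longrightarrow>
      norm (V y) \<le> K \<and> norm (gradient V y) \<le> K \<and> norm (hessian V y) \<le> K"
    using C2_bounded_on_cball[OF C2_V] by metis
  have "norm (Z j \<omega>) \<le> K \<and> norm (grad j \<omega>) \<le> K \<and> norm (hess j \<omega>) \<le> K" for \<omega>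
    using K \<Gamma>D(4)[of \<omega> j] assms unfolding Z_def grad_def hess_def alive_def by (cases "\<omega> \<in> \<Gamma> j") auto
  with K(1) show ?thesis by blast
qed

lemma truncated_measurable:
  assumes "j \<le> N"
  shows "Z j \<in> borel_measurable (F (q j))" "grad j \<in> borel_measurable (F (q j))" "hess j \<in> borel_measurable (F (q j))"
proof -
  have [measurable]: "V \<in> borel_measurable borel" "gradient V \<in> borel_measurable borel" "hessian V \<in> borel_measurable borel"
    by (intro borel_measurable_continuous_onI C2_continuous[OF C2_V])+
  note [measurable] = Y_measurable[OF assms] alive_measurable[OF assms]
  show "Z j \<in> borel_measurable (F (q j))" "grad j \<in> borel_measurable (F (q j))" "hess j \<in> borel_measurable (F (q j))"
    unfolding Z_def grad_def hess_def by measurable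
qed

lemma Z_integrable:
  assumes j: "j \<le> N"
  shows "integrable M (Z j)"
proof -
  obtain K where "\<And>\<omega>. norm (Z j \<omega>) \<le> K" using truncated_bounded[OF j] by blast
  then show ?thesis
    using measurable_F_imp_M[OF q_nonneg truncated_measurable(1)] j
    by (intro integrable_const_bound[of _ K] AE_I2) auto
qed

lemma alive_integrable: "j \<le> N \<Longrightarrow> integrable M (alive j)" "j \<le> N \<Longrightarrow> (\<integral>\<omega>. alive j \<omega> \<partial>M) = prob (\<Gamma> j)"
  using \<Gamma>_in_M[of j] unfolding alive_def by (auto intro!: integrable_const_bound[of _ 1])

text \<open>Up to the last index at which the path is alive, the sum is the one bounded in the definition of \<open>\<Gamma>\<close>, and all later terms vanish.\<close>

lemma sum_defect_le: "n \<le> N \<Longrightarrow> (\<Sum>j<n. alive (Suc j) \<omega> * defect j \<omega>) \<le> \<kappa>"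
proof (induction n)
  case 0
  then show ?case using \<kappa> by simp
next
  case (Suc n)
  show ?case
  proof (cases "\<omega> \<in> \<Gamma> (Suc n)")
    case True
    have "(\<Sum>j<Suc n. alive (Suc j) \<omega> * defect j \<omega>) \<le> (\<Sum>j<Suc n. defect j \<omega>)"
      using \<Delta>(1) Suc.prems alive_props unfolding defect_def
      by (intro sum_mono mult_left_le_one_le mult_nonneg_nonneg) (auto intro: less_imp_le)
    also have "\<dots> \<le> \<kappa>" using True unfolding \<Gamma>_def defect_def by auto
    finally show ?thesis .
  next
    case False
    then show ?thesis using Suc by (simp add: alive_def)
  qed
qed

lemma defect_integrable: "j < N \<Longrightarrow> integrable M (\<lambda>\<omega>. alive (Suc j) \<omega> * defect j \<omega>)"
proof (rule integrable_const_bound[of _ \<kappa>])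
  assume j: "j < N"
  have nn: "0 \<le> alive (Suc i) \<omega> * defect i \<omega>" if "i < N" for i \<omega>
    using \<Delta>(1)[OF that] alive_props unfolding defect_def by auto
  have "alive (Suc j) \<omega> * defect j \<omega> \<le> \<kappa>" for \<omega>
  proof -
    have "alive (Suc j) \<omega> * defect j \<omega> \<le> (\<Sum>i<N. alive (Suc i) \<omega> * defect i \<omega>)"
      using j nn by (intro member_le_sum) auto
    also have "\<dots> \<le> \<kappa>" by (rule sum_defect_le) simp
    finally show ?thesis .
  qed
  then show "AE \<omega> in M. norm (alive (Suc j) \<omega> * defect j \<omega>) \<le> \<kappa>" using nn[OF j] by auto
  have [measurable]: "g \<in> borel_measurable borel" using g_cont by (rule borel_measurable_continuous_onI)
  have [measurable]: "\<eta> j \<in> borel_measurable M" "x (q j) \<in> borel_measurable M" "alive (Suc j) \<in> borel_measurable M"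
    using measurable_F_imp_M[OF _ \<eta>_measurable[of j]] measurable_F_imp_M[OF _ x_I_measurable(1)[of "q j" "q j"]]
      measurable_F_imp_M[OF _ alive_measurable[of "Suc j"]] q_nonneg[of j] q_nonneg[of "Suc j"] j by auto
  show "(\<lambda>\<omega>. alive (Suc j) \<omega> * defect j \<omega>) \<in> borel_measurable M" unfolding defect_def by measurable
qed

text \<open>In order: the Taylor error on the noise, terms of second order in the cell length, the generator error at
nearby points, the integrand error, and the loss from paths that die in the cell.\<close>

definition "step_error j = \<Delta> j * (\<epsilon> * (K\<eta>\<^sup>2 * real CARD('m))) + (\<Delta> j)\<^sup>2 * (K1 * (K\<eta> ^ 4 * (3 * (real CARD('m))\<^sup>2)) + K1)
  + \<epsilon>' * \<Delta> j + K2 * (\<integral>\<omega>. alive (Suc j) \<omega> * defect j \<omega> \<partial>M) + \<Delta> j * K3 * (prob (\<Gamma> j) - prob (\<Gamma> (Suc j)))"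

text \<open>The means of the quadratic noise term and of the trace term cancel, which is the whole content of Ito's correction.\<close>

lemma step_expectation:
  assumes j: "j < N"
  shows "(\<integral>\<omega>. Z (Suc j) \<omega> \<partial>M) \<le> (1 - lam * \<Delta> j) * (\<integral>\<omega>. Z j \<omega> \<partial>M) + C * \<Delta> j * exp (- lam * q j) + step_error j"
proof -
  obtain K where K: "K \<ge> 0" "\<And>\<omega>. norm (grad j \<omega>) \<le> K" "\<And>\<omega>. norm (hess j \<omega>) \<le> K"
    using truncated_bounded[of j] j by auto
  have qj: "0 \<le> q j" "q j < q (Suc j)" using q_nonneg[of j] q_less[of j] j by auto
  note tm = truncated_measurable[of j, OF less_imp_le[OF j]]
  note E = noise_step_expectations[OF qj tm(2) \<eta>_measurable tm(3) K(2) \<eta>_le K(3),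
      folded G_def, folded \<Delta>_def]
  have D: "0 \<le> \<Delta> j" "\<Delta> j \<le> 1" using \<Delta>[OF j] by auto
  note I = Z_integrable[of j] Z_integrable[of "Suc j"] alive_integrable(1)[of j] alive_integrable(1)[of "Suc j"] defect_integrable[OF j]
  let ?A = "\<lambda>\<omega>. (1 - lam * \<Delta> j) * Z j \<omega> + grad j \<omega> \<bullet> G j \<omega>
    + ((G j \<omega> \<bullet> (hess j \<omega> *v G j \<omega>)) / 2 - \<Delta> j * trace (transpose (\<eta> j \<omega>) ** hess j \<omega> ** \<eta> j \<omega>) / 2)
    + (\<epsilon> * (norm (G j \<omega>))\<^sup>2 + K1 * norm (G j \<omega>) ^ 4 + K1 * (\<Delta> j)\<^sup>2)
    + (alive (Suc j) \<omega> * \<Delta> j * (C * exp (- lam * q j) + \<epsilon>') + K2 * (alive (Suc j) \<omega> * defect j \<omega>))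
    + (alive j \<omega> - alive (Suc j) \<omega>) * \<Delta> j * K3"
  let ?tr = "\<integral>\<omega>. trace (transpose (\<eta> j \<omega>) ** hess j \<omega> ** \<eta> j \<omega>) \<partial>M"
  have e: "\<epsilon> * (\<integral>\<omega>. (norm (G j \<omega>))\<^sup>2 \<partial>M) \<le> \<epsilon> * (K\<eta>\<^sup>2 * real CARD('m) * \<Delta> j)"
    "K1 * (\<integral>\<omega>. norm (G j \<omega>) ^ 4 \<partial>M) \<le> K1 * (K\<eta> ^ 4 * (3 * (real CARD('m))\<^sup>2) * (\<Delta> j)\<^sup>2)"
    "prob (\<Gamma> (Suc j)) * \<Delta> j * (C * exp (- lam * q j) + \<epsilon>') \<le> 1 * \<Delta> j * (C * exp (- lam * q j) + \<epsilon>')"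
    "\<Delta> j * ?tr / 2 - \<Delta> j * ?tr / 2 \<le> 0"
    using E(7,9) const_nonneg C D by (auto intro!: mult_left_mono mult_right_mono mult_left_le_one_le)
  have intA: "integrable M ?A" using E I j by auto
  have "(\<integral>\<omega>. Z (Suc j) \<omega> \<partial>M) \<le> (\<integral>\<omega>. ?A \<omega> \<partial>M)"
    using I j by (intro integral_mono intA step_pointwise) auto
  also have "\<dots> = (1 - lam * \<Delta> j) * (\<integral>\<omega>. Z j \<omega> \<partial>M) + 0
    + (\<Delta> j * (\<integral>\<omega>. trace (transpose (\<eta> j \<omega>) ** hess j \<omega> ** \<eta> j \<omega>) \<partial>M) / 2
       - \<Delta> j * (\<integral>\<omega>. trace (transpose (\<eta> j \<omega>) ** hess j \<omega> ** \<eta> j \<omega>) \<partial>M) / 2)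
    + (\<epsilon> * (\<integral>\<omega>. (norm (G j \<omega>))\<^sup>2 \<partial>M) + K1 * (\<integral>\<omega>. norm (G j \<omega>) ^ 4 \<partial>M) + K1 * (\<Delta> j)\<^sup>2)
    + (prob (\<Gamma> (Suc j)) * \<Delta> j * (C * exp (- lam * q j) + \<epsilon>') + K2 * (\<integral>\<omega>. alive (Suc j) \<omega> * defect j \<omega> \<partial>M))
    + (prob (\<Gamma> j) - prob (\<Gamma> (Suc j))) * \<Delta> j * K3"
    using E I j by (simp add: alive_integrable(2) prob_space)
  also have "\<dots> \<le> (1 - lam * \<Delta> j) * (\<integral>\<omega>. Z j \<omega> \<partial>M) + 0 + 0
    + (\<epsilon> * (K\<eta>\<^sup>2 * real CARD('m) * \<Delta> j) + K1 * (K\<eta> ^ 4 * (3 * (real CARD('m))\<^sup>2) * (\<Delta> j)\<^sup>2) + K1 * (\<Delta> j)\<^sup>2)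
    + (1 * \<Delta> j * (C * exp (- lam * q j) + \<epsilon>') + K2 * (\<integral>\<omega>. alive (Suc j) \<omega> * defect j \<omega> \<partial>M))
    + (prob (\<Gamma> j) - prob (\<Gamma> (Suc j))) * \<Delta> j * K3"
    by (intro add_mono order_refl e)
  also have "\<dots> = (1 - lam * \<Delta> j) * (\<integral>\<omega>. Z j \<omega> \<partial>M) + C * \<Delta> j * exp (- lam * q j) + step_error j"
    unfolding step_error_def by (simp add: algebra_simps)
  finally show ?thesis .
qed

lemma step_error_nonneg:
  assumes j: "j < N"
  shows "0 \<le> step_error j"
proof -
  have "prob (\<Gamma> (Suc j)) \<le> prob (\<Gamma> j)" using \<Gamma>_in_M[of j] \<Gamma>_antimono[OF j] j by (intro finite_measure_mono) auto
  moreover have "0 \<le> (\<integral>\<omega>. alive (Suc j) \<omega> * defect j \<omega> \<partial>M)"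
    using alive_props \<Delta>(1)[OF j] unfolding defect_def by (intro integral_nonneg_AE AE_I2) auto
  ultimately show ?thesis unfolding step_error_def using const_nonneg \<Delta>(1)[OF j] by (intro add_nonneg_nonneg mult_nonneg_nonneg) auto
qed

text \<open>Each group sums to a quantity that is small for a different reason: \<open>\<epsilon>\<close> and \<open>\<epsilon>'\<close> by choice, terms quadratic in
the cell length by the mesh, the integrand error by \<open>\<kappa>\<close>, and the losses by the mesh because the probabilities telescope.\<close>

lemma sum_step_error_le:
  "(\<Sum>j<N. step_error j) \<le> T * (\<epsilon> * (K\<eta>\<^sup>2 * real CARD('m)))
    + h * (T * (K1 * (K\<eta> ^ 4 * (3 * (real CARD('m))\<^sup>2)) + K1) + K3) + (\<epsilon>' * T + K2 * \<kappa>)"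
proof -
  let ?c = "K1 * (K\<eta> ^ 4 * (3 * (real CARD('m))\<^sup>2)) + K1"
  have c: "?c \<ge> 0" using const_nonneg by auto
  have "(\<Sum>j<N. (\<Delta> j)\<^sup>2 * ?c) \<le> (\<Sum>j<N. \<Delta> j * (h * ?c))"
  proof (rule sum_mono)
    fix j assume "j \<in> {..<N}"
    then have "\<Delta> j * (\<Delta> j * ?c) \<le> \<Delta> j * (h * ?c)"
      using \<Delta>[of j] c by (intro mult_left_mono[OF mult_right_mono]) auto
    then show "(\<Delta> j)\<^sup>2 * ?c \<le> \<Delta> j * (h * ?c)"
      by (metis mult.assoc power2_eq_square)
  qed
  also have "\<dots> = h * (T * ?c)" by (simp add: sum_distrib_right[symmetric] sum_\<Delta>)
  finally have 1: "(\<Sum>j<N. (\<Delta> j)\<^sup>2 * ?c) \<le> h * (T * ?c)" .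
  have "(\<Sum>j<N. \<Delta> j * K3 * (prob (\<Gamma> j) - prob (\<Gamma> (Suc j)))) \<le> (\<Sum>j<N. h * K3 * (prob (\<Gamma> j) - prob (\<Gamma> (Suc j))))"
  proof (intro sum_mono mult_right_mono)
    fix j assume j: "j \<in> {..<N}"
    have "prob (\<Gamma> (Suc j)) \<le> prob (\<Gamma> j)" using \<Gamma>_in_M[of j] \<Gamma>_antimono[of j] j by (intro finite_measure_mono) auto
    then show "0 \<le> prob (\<Gamma> j) - prob (\<Gamma> (Suc j))" by simp
  qed (use \<Delta> const_nonneg in auto)
  also have "\<dots> = h * K3 * (prob (\<Gamma> 0) - prob (\<Gamma> N))"
    using sum_lessThan_telescope'[of "\<lambda>j. prob (\<Gamma> j)" N] by (simp add: sum_distrib_left[symmetric])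
  also have "\<dots> \<le> h * K3 * 1"
  proof (rule mult_left_mono)
    show "prob (\<Gamma> 0) - prob (\<Gamma> N) \<le> 1"
      using prob_le_1[of "\<Gamma> 0"] measure_nonneg[of M "\<Gamma> N"] by linarith
  qed (use h const_nonneg in auto)
  finally have 2: "(\<Sum>j<N. \<Delta> j * K3 * (prob (\<Gamma> j) - prob (\<Gamma> (Suc j)))) \<le> h * K3" by simp
  have "(\<Sum>j<N. (\<integral>\<omega>. alive (Suc j) \<omega> * defect j \<omega> \<partial>M)) = (\<integral>\<omega>. (\<Sum>j<N. alive (Suc j) \<omega> * defect j \<omega>) \<partial>M)"
    using defect_integrable by (intro Bochner_Integration.integral_sum[symmetric]) auto
  also have "\<dots> \<le> (\<integral>\<omega>. \<kappa> \<partial>M)"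
    using defect_integrable sum_defect_le[of N] by (intro integral_mono) auto
  finally have "(\<Sum>j<N. (\<integral>\<omega>. alive (Suc j) \<omega> * defect j \<omega> \<partial>M)) \<le> \<kappa>" by (simp add: prob_space)
  then have 3: "K2 * (\<Sum>j<N. (\<integral>\<omega>. alive (Suc j) \<omega> * defect j \<omega> \<partial>M)) \<le> K2 * \<kappa>" using const_nonneg by (intro mult_left_mono) auto
  have "(\<Sum>j<N. step_error j) = T * (\<epsilon> * (K\<eta>\<^sup>2 * real CARD('m))) + (\<Sum>j<N. (\<Delta> j)\<^sup>2 * ?c) + \<epsilon>' * T
      + K2 * (\<Sum>j<N. (\<integral>\<omega>. alive (Suc j) \<omega> * defect j \<omega> \<partial>M)) + (\<Sum>j<N. \<Delta> j * K3 * (prob (\<Gamma> j) - prob (\<Gamma> (Suc j))))"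
    unfolding step_error_def by (simp only: sum.distrib sum_distrib_right[symmetric] sum_distrib_left[symmetric] sum_\<Delta>)
  with 1 2 3 show ?thesis by (simp add: distrib_left)
qed

lemma Y_0:
  assumes "\<omega> \<in> Om"
  shows "Y 0 \<omega> = \<phi>"
proof -
  have "(LINT s:{0..0}|lborel. b s \<omega>) = 0"
    unfolding set_lebesgue_integral_def
    by (rule integral_eq_zero_AE, rule eventually_mono[OF AE_lborel_singleton[of 0]]) auto
  then show ?thesis unfolding Y_def q0 J_0 using equation[OF assms, of 0] by simp
qed

lemma Z_expectation_bound:
  "(\<integral>\<omega>. Z N \<omega> \<partial>M) \<le> exp (- lam * T) * (V \<phi> + C * exp lam * T) + (T * (\<epsilon> * (K\<eta>\<^sup>2 * real CARD('m)))
    + h * (T * (K1 * (K\<eta> ^ 4 * (3 * (real CARD('m))\<^sup>2)) + K1) + K3) + (\<epsilon>' * T + K2 * \<kappa>))"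
proof -
  have "exp (lam * q N) * (\<integral>\<omega>. Z N \<omega> \<partial>M)
      \<le> (\<integral>\<omega>. Z 0 \<omega> \<partial>M) + C * exp lam * q N + exp (lam * T) * (\<Sum>j<N. step_error j)"
  proof (rule discrete_gronwall[where N = N and D = \<Delta>])
    show "0 \<le> (\<integral>\<omega>. Z j \<omega> \<partial>M)" for j
      unfolding Z_def using alive_props V_growth by (intro integral_nonneg_AE AE_I2) auto
  qed (use step_expectation step_error_nonneg q0 q_range \<Delta> C lam in \<open>auto simp: \<Delta>_def intro: less_imp_le\<close>)
  also have "(\<integral>\<omega>. Z 0 \<omega> \<partial>M) \<le> (\<integral>\<omega>. V \<phi> \<partial>M)"
  proof (rule integral_mono)
    show "Z 0 \<omega> \<le> V \<phi>" for \<omega>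
      using Y_0[of \<omega>] \<Gamma>D(1)[of \<omega> 0] V_growth[of \<phi>] unfolding Z_def alive_def by (cases "\<omega> \<in> \<Gamma> 0") auto
  qed (use Z_integrable[of 0] in auto)
  finally have "exp (lam * T) * (\<integral>\<omega>. Z N \<omega> \<partial>M) \<le> V \<phi> + C * exp lam * T + exp (lam * T) * (\<Sum>j<N. step_error j)"
    by (simp add: prob_space qN)
  then have "exp (- lam * T) * (exp (lam * T) * (\<integral>\<omega>. Z N \<omega> \<partial>M))
      \<le> exp (- lam * T) * (V \<phi> + C * exp lam * T + exp (lam * T) * (\<Sum>j<N. step_error j))"
    by (rule mult_left_mono) simp
  then have "(\<integral>\<omega>. Z N \<omega> \<partial>M) \<le> exp (- lam * T) * (V \<phi> + C * exp lam * T) + (\<Sum>j<N. step_error j)"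
    by (simp add: distrib_left mult.assoc[symmetric] exp_add[symmetric])
  then show ?thesis using sum_step_error_le by linarith
qed

text \<open>The truncation at \<open>K0\<close> is what makes the paths outside \<open>\<Gamma> N\<close> harmless: no integrability of \<open>V (x T)\<close> is known at this stage.\<close>

lemma truncated_expectation_le:
  assumes V_close: "\<And>y z. norm y \<le> R + 1 \<Longrightarrow> norm z \<le> R + 1 \<Longrightarrow> dist y z \<le> \<delta> \<Longrightarrow> V z \<le> V y + \<epsilon>''" and "K0 \<ge> 0" "\<epsilon>'' \<ge> 0"
  shows "(\<integral>\<omega>. min (V (x T \<omega>)) K0 \<partial>M) \<le> (\<integral>\<omega>. Z N \<omega> \<partial>M) + \<epsilon>'' + K0 * (1 - prob (\<Gamma> N))"
proof -
  have [measurable]: "V \<in> borel_measurable borel"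
    by (intro borel_measurable_continuous_onI C2_continuous[OF C2_V])
  have T0: "0 \<le> T" using q_range[of N] by auto
  have [measurable]: "x T \<in> borel_measurable M" using measurable_F_imp_M[OF T0 x_I_measurable(1)[of T T]] T0 by simp
  have i: "integrable M (\<lambda>\<omega>. min (V (x T \<omega>)) K0)"
    using V_growth \<open>K0 \<ge> 0\<close> by (intro integrable_const_bound[of _ K0]) (auto simp: min_def)
  have "(\<integral>\<omega>. min (V (x T \<omega>)) K0 \<partial>M) \<le> (\<integral>\<omega>. Z N \<omega> + \<epsilon>'' + K0 * (1 - alive N \<omega>) \<partial>M)"
  proof (rule integral_mono[OF i])
    show "integrable M (\<lambda>\<omega>. Z N \<omega> + \<epsilon>'' + K0 * (1 - alive N \<omega>))"
      using Z_integrable[of N] alive_integrable(1)[of N] by auto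
    fix \<omega>
    show "min (V (x T \<omega>)) K0 \<le> Z N \<omega> + \<epsilon>'' + K0 * (1 - alive N \<omega>)"
    proof (cases "\<omega> \<in> \<Gamma> N")
      case True
      have "V (x T \<omega>) \<le> V (Y N \<omega>) + \<epsilon>''"
        using \<Gamma>D[OF True] V_close[of "Y N \<omega>" "x T \<omega>"] unfolding qN by auto
      then show ?thesis using True by (simp add: Z_def alive_def)
    next
      case False
      then show ?thesis using \<open>\<epsilon>'' \<ge> 0\<close> by (simp add: Z_def alive_def)
    qed
  qed
  also have "\<dots> = (\<integral>\<omega>. Z N \<omega> \<partial>M) + \<epsilon>'' + K0 * (1 - prob (\<Gamma> N))"
    using Z_integrable[of N] alive_integrable[of N] by (simp add: prob_space)
  finally show ?thesis .
qed

end

section \<open>Paths that survive to the final time\<close>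

context grid_approximation
begin

text \<open>The oscillation constraint of \<open>\<Gamma> N\<close> by itself; for fixed \<open>\<delta>\<close> its probability tends to 1 with vanishing mesh.\<close>

definition "small_osc = {\<omega>\<in>Om. \<forall>i\<in>{..<N}. \<forall>r\<in>{q i..q (Suc i)}. dist (x r \<omega>) (x (q i) \<omega>) \<le> \<delta>}"

lemma small_osc_in_M: "small_osc \<in> sets M"
proof -
  have cell: "{\<omega>\<in>Om. \<forall>r\<in>{q i..q (Suc i)}. dist (x r \<omega>) (x (q i) \<omega>) \<le> \<delta>} \<in> sets M" if "i < N" for i
    using cell_osc_in_F[OF that] sets_F_subset[of "q (Suc i)"] q_nonneg[of "Suc i"] that by auto
  have "small_osc = {\<omega>\<in>space M. \<omega> \<in> Om} \<inter> {\<omega>\<in>space M. \<forall>i\<in>{..<N}. \<omega> \<in> {\<omega>\<in>Om. \<forall>r\<in>{q i..q (Suc i)}. dist (x r \<omega>) (x (q i) \<omega>) \<le> \<delta>}}"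
    unfolding small_osc_def using Om_space by auto
  also have "\<dots> \<in> sets M"
  proof (intro sets.Int sets.sets_Collect_countable_All' countable_finite finite_lessThan)
    show "{\<omega>\<in>space M. \<omega> \<in> Om} \<in> sets M"
      using Om(1) sets_F_subset[of 0] Om_space by (simp add: Collect_conj_eq Int_absorb1 subset_iff)
    fix i assume "i \<in> {..<N}"
    moreover have "{\<omega>\<in>space M. \<omega> \<in> {\<omega>\<in>Om. \<forall>r\<in>{q i..q (Suc i)}. dist (x r \<omega>) (x (q i) \<omega>) \<le> \<delta>}}
        = {\<omega>\<in>Om. \<forall>r\<in>{q i..q (Suc i)}. dist (x r \<omega>) (x (q i) \<omega>) \<le> \<delta>}"
      using Om_space by auto
    ultimately show "{\<omega>\<in>space M. \<omega> \<in> {\<omega>\<in>Om. \<forall>r\<in>{q i..q (Suc i)}. dist (x r \<omega>) (x (q i) \<omega>) \<le> \<delta>}} \<in> sets M"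
      using cell[of i] by simp
  qed
  finally show ?thesis .
qed

text \<open>On a cell the simple integrand equals \<open>\<eta> i\<close>, so the defect is an integral of \<open>|\<eta> i - g (x (q i))|\<^sup>2\<close>, which differs from the
integrated error of the simple integrand only by the oscillation of \<open>g (x)\<close> on the cell. The factor 4 in both hypotheses leaves
half of \<open>\<kappa>\<close> for each part after the estimate of the squared sum by twice the sum of squares.\<close>

lemma sum_defect_le_of_integral:
  assumes g_close: "\<And>y z. norm y \<le> R \<Longrightarrow> norm z \<le> R \<Longrightarrow> dist y z \<le> \<delta> \<Longrightarrow> (norm (g y - g z))\<^sup>2 \<le> \<kappa> / (4 * (T + 1))"
    and osc: "\<omega> \<in> small_osc" and R: "\<And>r. r \<in> {0..T} \<Longrightarrow> norm (x r \<omega>) \<le> R"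
    and int: "(\<integral>\<^sup>+s\<in>{0..T}. ennreal ((norm (simple_process L p \<xi> s \<omega> - g (x s \<omega>)))\<^sup>2) \<partial>lborel) \<le> ennreal (\<kappa> / 4)"
  shows "(\<Sum>i<N. (norm (\<eta> i \<omega> - g (x (q i) \<omega>)))\<^sup>2 * \<Delta> i) \<le> \<kappa>"
proof -
  have T0: "0 \<le> T" using q_range[of N] by auto
  let ?A = "\<lambda>i. {q i<..q (Suc i)}"
  let ?gx = "\<lambda>s. indicator {0..T} s *\<^sub>R g (x s \<omega>)"
  let ?f = "\<lambda>s. ennreal ((norm (simple_process L p \<xi> s \<omega> - ?gx s))\<^sup>2) * indicator {0..T} s"
  let ?c = "\<kappa> / (2 * (T + 1))"
  have c: "?c \<ge> 0" using \<kappa> T0 by auto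
  have Om: "\<omega> \<in> Om" using osc unfolding small_osc_def by auto
  have "continuous_on {0..T} (\<lambda>s. g (x s \<omega>))"
    by (intro continuous_on_compose2[OF g_cont] path_cont Om) auto
  then have gx[measurable]: "?gx \<in> borel_measurable borel" by (intro borel_measurable_continuous_on_indicator) auto
  have sp[measurable]: "(\<lambda>s. simple_process L p \<xi> s \<omega>) \<in> borel_measurable borel"
    unfolding simple_process_def by measurable
  have f[measurable]: "?f \<in> borel_measurable borel" by measurable
  have "ennreal (\<Sum>i<N. (norm (\<eta> i \<omega> - g (x (q i) \<omega>)))\<^sup>2 * \<Delta> i) = (\<Sum>i<N. ennreal ((norm (\<eta> i \<omega> - g (x (q i) \<omega>)))\<^sup>2 * \<Delta> i))"
    using \<Delta>(1) by (intro sum_ennreal[symmetric] mult_nonneg_nonneg) (auto intro: less_imp_le)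
  also have "\<dots> \<le> (\<Sum>i<N. 2 * (\<integral>\<^sup>+s. ?f s * indicator (?A i) s \<partial>lborel) + ennreal (?c * \<Delta> i))"
  proof (rule sum_mono)
    fix i assume "i \<in> {..<N}"
    then have i: "i < N" by simp
    have qi: "0 \<le> q i" "q i < q (Suc i)" "q (Suc i) \<le> T"
      using q_less[OF i] q_nonneg[of i] q_range[of "Suc i"] i by auto
    have "ennreal ((norm (\<eta> i \<omega> - g (x (q i) \<omega>)))\<^sup>2 * \<Delta> i)
        = (\<integral>\<^sup>+s. ennreal ((norm (\<eta> i \<omega> - g (x (q i) \<omega>)))\<^sup>2) * indicator (?A i) s \<partial>lborel)"
      using qi by (simp add: nn_integral_cmult_indicator ennreal_mult \<Delta>_def)
    also have "\<dots> \<le> (\<integral>\<^sup>+s. 2 * (?f s * indicator (?A i) s) + ennreal ?c * indicator (?A i) s \<partial>lborel)"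
    proof (rule nn_integral_mono)
      fix s :: real
      show "ennreal ((norm (\<eta> i \<omega> - g (x (q i) \<omega>)))\<^sup>2) * indicator (?A i) s
          \<le> 2 * (?f s * indicator (?A i) s) + ennreal ?c * indicator (?A i) s"
      proof (cases "s \<in> ?A i")
        case True
        then have s: "s \<in> {0..T}" "s \<in> {q i..q (Suc i)}" using qi by auto
        let ?u = "\<eta> i \<omega> - g (x s \<omega>)" and ?v = "g (x s \<omega>) - g (x (q i) \<omega>)"
        have "dist (x s \<omega>) (x (q i) \<omega>) \<le> \<delta>" using osc s i unfolding small_osc_def by auto
        then have v: "(norm ?v)\<^sup>2 \<le> \<kappa> / (4 * (T + 1))" using g_close R[OF s(1)] R[of "q i"] qi by auto
        have "(norm (?u + ?v))\<^sup>2 \<le> (norm ?u + norm ?v)\<^sup>2" by (intro power_mono norm_triangle_ineq) auto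
        also have "\<dots> \<le> 2 * (norm ?u)\<^sup>2 + 2 * (norm ?v)\<^sup>2" using sum_squares_bound[of "norm ?u" "norm ?v"]
          by (simp add: power2_sum)
        also have "\<dots> \<le> 2 * (norm ?u)\<^sup>2 + ?c"
        proof -
          have "2 * (norm ?v)\<^sup>2 \<le> 2 * (\<kappa> / (4 * (T + 1)))" using v by (intro mult_left_mono) auto
          also have "\<dots> = ?c" using T0 by (simp add: field_simps)
          finally show ?thesis by (rule add_left_mono)
        qed
        finally have "(norm (\<eta> i \<omega> - g (x (q i) \<omega>)))\<^sup>2 \<le> 2 * (norm ?u)\<^sup>2 + ?c" by simp
        then have "ennreal ((norm (\<eta> i \<omega> - g (x (q i) \<omega>)))\<^sup>2) \<le> ennreal (2 * (norm ?u)\<^sup>2 + ?c)"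
          by (rule ennreal_leI)
        also have "\<dots> = ennreal (2 * (norm ?u)\<^sup>2) + ennreal ?c" using c by (intro ennreal_plus) auto
        also have "ennreal (2 * (norm ?u)\<^sup>2) = 2 * ennreal ((norm ?u)\<^sup>2)" by (simp add: ennreal_mult'')
        finally have "ennreal ((norm (\<eta> i \<omega> - g (x (q i) \<omega>)))\<^sup>2) \<le> 2 * ennreal ((norm ?u)\<^sup>2) + ennreal ?c" .
        then show ?thesis using True s simple_process_on_cell[OF i, of s \<omega>] by simp
      qed simp
    qed
    also have "\<dots> = 2 * (\<integral>\<^sup>+s. ?f s * indicator (?A i) s \<partial>lborel) + ennreal ?c * ennreal (\<Delta> i)"
      using qi by (simp add: nn_integral_add nn_integral_cmult nn_integral_cmult_indicator \<Delta>_def)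
    also have "ennreal ?c * ennreal (\<Delta> i) = ennreal (?c * \<Delta> i)"
      using c \<Delta>(1)[OF i] by (intro ennreal_mult[symmetric]) auto
    finally show "ennreal ((norm (\<eta> i \<omega> - g (x (q i) \<omega>)))\<^sup>2 * \<Delta> i)
        \<le> 2 * (\<integral>\<^sup>+s. ?f s * indicator (?A i) s \<partial>lborel) + ennreal (?c * \<Delta> i)" .
  qed
  also have "\<dots> = 2 * (\<Sum>i<N. \<integral>\<^sup>+s. ?f s * indicator (?A i) s \<partial>lborel) + ennreal (?c * T)"
  proof -
    have "(\<Sum>i<N. ennreal (?c * \<Delta> i)) = ennreal (\<Sum>i<N. ?c * \<Delta> i)"
      using c \<Delta>(1) by (intro sum_ennreal mult_nonneg_nonneg) (auto intro: less_imp_le)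
    also have "(\<Sum>i<N. ?c * \<Delta> i) = ?c * T" by (simp only: sum_distrib_left[symmetric] sum_\<Delta>)
    finally show ?thesis by (simp only: sum.distrib sum_distrib_left[symmetric])
  qed
  also have "(\<Sum>i<N. \<integral>\<^sup>+s. ?f s * indicator (?A i) s \<partial>lborel) = (\<integral>\<^sup>+s. (\<Sum>i<N. ?f s * indicator (?A i) s) \<partial>lborel)"
    by (rule nn_integral_sum[symmetric]) measurable
  also have "\<dots> \<le> (\<integral>\<^sup>+s. ?f s \<partial>lborel)"
  proof (rule nn_integral_mono)
    fix s :: real
    \<comment> \<open>the cells are disjoint: their indicators add up to that of \<open>{q 0<..q N}\<close>\<close>
    have "(\<Sum>i<N. indicator (?A i) s) \<le> (1::ennreal)"
    proof -
      have "(\<Sum>i<n. indicator (?A i) s) = (indicator {q 0<..q n} s :: ennreal)" if "n \<le> N" for n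
        using that
      proof (induction n)
        case (Suc n)
        have "q 0 \<le> q n" "q n \<le> q (Suc n)" using q_mono[of 0 n] q_mono[of n "Suc n"] Suc.prems by auto
        then show ?case using Suc by (auto simp: indicator_def)
      qed simp
      then show ?thesis by (simp add: indicator_def)
    qed
    then have "?f s * (\<Sum>i<N. indicator (?A i) s) \<le> ?f s * 1" by (intro mult_left_mono) auto
    then show "(\<Sum>i<N. ?f s * indicator (?A i) s) \<le> ?f s" by (simp add: sum_distrib_left)
  qed
  also have "(\<integral>\<^sup>+s. ?f s \<partial>lborel) = (\<integral>\<^sup>+s\<in>{0..T}. ennreal ((norm (simple_process L p \<xi> s \<omega> - g (x s \<omega>)))\<^sup>2) \<partial>lborel)"
    by (intro nn_integral_cong) (auto split: split_indicator)
  also note int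
  also have "2 * ennreal (\<kappa> / 4) + ennreal (?c * T) = ennreal (\<kappa> / 2 + ?c * T)"
    using \<kappa> c T0 by (subst ennreal_plus) (auto simp: ennreal_mult'' simp flip: ennreal_numeral ennreal_mult')
  also have "\<dots> \<le> ennreal \<kappa>"
  proof (rule ennreal_leI)
    have "?c * T \<le> \<kappa> / 2" using \<kappa> T0 by (simp add: field_simps)
    from add_left_mono[OF this, of "\<kappa> / 2"] show "\<kappa> / 2 + ?c * T \<le> \<kappa>"
      by (simp only: field_sum_of_halves)
  qed
  finally show ?thesis using \<kappa> by (simp add: ennreal_le_iff add_mono mult_left_mono)
qed

text \<open>The last localisation event contains four events whose probabilities can be controlled separately; the
two conditions on the simple integrand are those in the definition of the stochastic integral.\<close>

lemma \<Gamma>_N_superset: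
  assumes g_close: "\<And>y z. norm y \<le> R \<Longrightarrow> norm z \<le> R \<Longrightarrow> dist y z \<le> \<delta> \<Longrightarrow> (norm (g y - g z))\<^sup>2 \<le> \<kappa> / (4 * (T + 1))"
    and osc: "\<omega> \<in> small_osc" and R: "\<And>r. r \<in> {0..T} \<Longrightarrow> norm (x r \<omega>) \<le> R"
    and int: "(\<integral>\<^sup>+s\<in>{0..T}. ennreal ((norm (simple_process L p \<xi> s \<omega> - g (x s \<omega>)))\<^sup>2) \<partial>lborel) \<le> ennreal (\<kappa> / 4)"
    and sup: "(SUP t\<in>{0..T}. ennreal (norm (simple_integral W L p \<xi> t \<omega> - I t \<omega>))) \<le> ennreal \<delta>"
  shows "\<omega> \<in> \<Gamma> N"
proof -
  have "norm (J (q i) \<omega> - I (q i) \<omega>) \<le> \<delta>" if "i \<le> N" for i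
  proof -
    have "ennreal (norm (J (q i) \<omega> - I (q i) \<omega>)) \<le> (SUP t\<in>{0..T}. ennreal (norm (simple_integral W L p \<xi> t \<omega> - I t \<omega>)))"
      unfolding J_def using q_range[OF that] by (intro SUP_upper) auto
    also note sup
    finally show ?thesis using \<delta> by (simp add: ennreal_le_iff)
  qed
  then show ?thesis
    using osc R sum_defect_le_of_integral[OF g_close osc R int] unfolding \<Gamma>_def small_osc_def qN by auto
qed

end

section \<open>From the grid to the solution\<close>

context lyapunov_diffusion
begin

lemma prob_path_constraint_near_1:
  assumes T: "0 \<le> T" and "e > 0"
  shows "\<exists>R\<ge>0. {\<omega>\<in>Om. \<forall>r\<in>{0..T}. norm (x r \<omega>) \<le> R} \<in> events \<and>
    prob {\<omega>\<in>Om. \<forall>r\<in>{0..T}. norm (x r \<omega>) \<le> R} > 1 - e"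
proof -
  let ?A = "\<lambda>n::nat. {\<omega>\<in>Om. \<forall>r\<in>{0..T}. norm (x r \<omega>) \<le> real n}"
  have cont: "continuous_on {0..T} (\<lambda>r. norm (x r \<omega>))" if "\<omega> \<in> Om" for \<omega>
    using x_cont[OF that] by (intro continuous_on_norm) (auto intro: continuous_on_subset)
  have "?A n \<in> sets (F T)" for n
  proof (rule path_constraint_in_F[OF T])
    show "Om \<in> sets (F T)" using Om(1) sets_F_mono[OF T] by auto
    fix r assume "r \<in> {0..T}"
    then have [measurable]: "x r \<in> borel_measurable (F T)"
      using x_adapted measurable_F_mono[of r T] unfolding adapted_def by auto
    show "(\<lambda>\<omega>. norm (x r \<omega>)) \<in> borel_measurable (F T)" by measurable
  qed (rule cont)
  then have A: "?A n \<in> events" for n using sets_F_subset[OF T] by auto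
  have "AE \<omega> in M. \<forall>\<^sub>F n in sequentially. \<omega> \<in> ?A n"
    using Om(2)
  proof eventually_elim
    case (elim \<omega>)
    have "bounded ((\<lambda>r. norm (x r \<omega>)) ` {0..T})"
      by (intro compact_imp_bounded compact_continuous_image cont elim compact_Icc)
    then obtain K where "\<forall>y\<in>(\<lambda>r. norm (x r \<omega>)) ` {0..T}. norm y \<le> K" unfolding bounded_iff by metis
    then have K: "norm (x r \<omega>) \<le> K" if "r \<in> {0..T}" for r using that by auto
    obtain n0 :: nat where "K \<le> real n0" using real_arch_simple by blast
    then have "K \<le> real n" if "n \<ge> n0" for n using that by linarith
    then have "\<omega> \<in> ?A n" if "n \<ge> n0" for n using K elim that by (blast intro: order_trans)
    then show ?case by (auto simp: eventually_sequentially)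
  qed
  then have "(\<lambda>n. prob (?A n)) \<longlonglongrightarrow> 1" by (rule prob_tendsto_1_if_eventually[OF A])
  then have "\<forall>\<^sub>F n in sequentially. prob (?A n) > 1 - e" using \<open>e > 0\<close> by (intro order_tendstoD(1)) auto
  then obtain n where "prob (?A n) > 1 - e" using eventually_happens by force
  then show ?thesis using A[of n] by (intro exI[of _ "real n"]) auto
qed

text \<open>The constants are chosen so that each depends only on earlier ones: the truncation \<open>K0\<close> and the accuracy, the bound \<open>R\<close> on the path,
the constants of the continuity estimates on that ball, the tolerances \<open>\<kappa>\<close> and \<open>\<delta>\<close>, the simple integrand with its bound \<open>K\<eta>\<close>,
the Taylor accuracy \<open>\<epsilon>\<close> with its constant \<open>K1\<close>, and at last the mesh.\<close>

lemma truncated_bound: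
  assumes T: "0 \<le> T" and K0: "0 \<le> K0" and e: "e > 0"
  shows "(\<integral>\<omega>. min (V (x T \<omega>)) K0 \<partial>M) \<le> exp (- lam * T) * (V \<phi> + C * exp lam * T) + e"
proof -
  \<comment> \<open>five errors of size \<open>e1\<close>: Taylor, mesh, generator and integrand, passage from \<open>Y\<close> to \<open>x\<close>, and the four exceptional events of probability at most \<open>e2\<close> each\<close>
  define e1 where "e1 = e / 5"
  define e2 where "e2 = e1 / (4 * (K0 + 1))"
  define \<epsilon>' where "\<epsilon>' = e1 / (T + 1)"
  have e1: "e1 > 0" and e2: "e2 > 0" and \<epsilon>': "\<epsilon>' > 0"
    unfolding e1_def e2_def \<epsilon>'_def using e K0 T by auto
  obtain R where R: "R \<ge> 0" "{\<omega>\<in>Om. \<forall>r\<in>{0..T}. norm (x r \<omega>) \<le> R} \<in> events"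
    "prob {\<omega>\<in>Om. \<forall>r\<in>{0..T}. norm (x r \<omega>) \<le> R} > 1 - e2"
    using prob_path_constraint_near_1[OF T e2] by blast
  obtain B0 where B0: "\<And>\<omega> t. \<omega> \<in> Om \<Longrightarrow> 0 \<le> t \<Longrightarrow> norm (x t \<omega>) \<le> R \<Longrightarrow> norm (b t \<omega>) \<le> B0"
    using drift_bounded[of R] by blast
  define B where "B = max B0 0"
  have B: "B \<ge> 0" "\<And>\<omega> t. \<omega> \<in> Om \<Longrightarrow> 0 \<le> t \<Longrightarrow> norm (x t \<omega>) \<le> R \<Longrightarrow> norm (b t \<omega>) \<le> B"
    unfolding B_def using B0 by (auto simp: le_max_iff_disj)
  obtain \<delta>0 K2 where \<delta>0: "\<delta>0 > 0" and K2: "K2 \<ge> 0"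
    "\<And>x y z b \<eta>. norm x \<le> R \<Longrightarrow> norm z \<le> R \<Longrightarrow> dist y z \<le> \<delta>0 \<Longrightarrow> dist x z \<le> \<delta>0 \<Longrightarrow> norm b \<le> B \<Longrightarrow>
      gradient V y \<bullet> b + trace (transpose \<eta> ** hessian V y ** \<eta>) / 2 + lam * V y
      \<le> gradient V x \<bullet> b + trace (transpose (g x) ** hessian V x ** g x) / 2 + lam * V x + \<epsilon>' + K2 * (norm (\<eta> - g z))\<^sup>2"
    using generator_uniformly_close[OF C2_V g_cont \<epsilon>', of R B lam] by blast
  define \<kappa> where "\<kappa> = \<epsilon>' / (K2 + 1)"
  have \<kappa>: "\<kappa> > 0" "K2 * \<kappa> \<le> \<epsilon>'" unfolding \<kappa>_def using \<epsilon>' K2(1) by (auto simp: field_simps)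
  have "uniformly_continuous_on (cball 0 (R + 1)) V"
    by (intro compact_uniformly_continuous C2_continuous[OF C2_V] compact_cball)
  then obtain \<delta>1 where \<delta>1: "\<delta>1 > 0" "\<And>y z. norm y \<le> R + 1 \<Longrightarrow> norm z \<le> R + 1 \<Longrightarrow> dist z y < \<delta>1 \<Longrightarrow> dist (V z) (V y) < e1"
    using e1 unfolding uniformly_continuous_on_def by (auto simp: mem_cball_0)
  define \<rho> where "\<rho> = sqrt (\<kappa> / (4 * (T + 1)))"
  have \<rho>: "\<rho> > 0" "\<rho>\<^sup>2 = \<kappa> / (4 * (T + 1))" unfolding \<rho>_def using \<kappa> T by auto
  have "uniformly_continuous_on (cball 0 R) g"
    using g_cont by (intro compact_uniformly_continuous compact_cball) (auto intro: continuous_on_subset)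
  then obtain \<delta>2 where \<delta>2: "\<delta>2 > 0" "\<And>y z. norm y \<le> R \<Longrightarrow> norm z \<le> R \<Longrightarrow> dist y z < \<delta>2 \<Longrightarrow> dist (g y) (g z) < \<rho>"
    using \<rho>(1) unfolding uniformly_continuous_on_def by (auto simp: mem_cball_0)
  define \<delta> where "\<delta> = min (min \<delta>0 1) (min (\<delta>1 / 2) (\<delta>2 / 2))"
  have \<delta>: "\<delta> > 0" "\<delta> \<le> 1" "\<delta> \<le> \<delta>0" "\<delta> < \<delta>1" "\<delta> < \<delta>2" unfolding \<delta>_def using \<delta>0 \<delta>1 \<delta>2 by auto
  have V_close: "V z \<le> V y + e1" if "norm y \<le> R + 1" "norm z \<le> R + 1" "dist y z \<le> \<delta>" for y z
  proof -
    have "dist (V z) (V y) < e1" using \<delta>1(2)[OF that(1,2)] that(3) \<delta> by (simp add: dist_commute)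
    then show ?thesis unfolding dist_real_def by linarith
  qed
  have g_close: "(norm (g y - g z))\<^sup>2 \<le> \<kappa> / (4 * (T + 1))" if "norm y \<le> R" "norm z \<le> R" "dist y z \<le> \<delta>" for y z
  proof -
    have "norm (g y - g z) \<le> \<rho>" using \<delta>2(2)[OF that(1,2)] that(3) \<delta> by (simp add: dist_norm)
    then show ?thesis unfolding \<rho>(2)[symmetric] by (intro power_mono) auto
  qed
  obtain LL pp \<xi>\<xi> where ito: "\<And>k. simple_integrand M F (LL k) (pp k) (\<xi>\<xi> k)"
    "tendsto_0_in_prob M (\<lambda>k \<omega>. \<integral>\<^sup>+s\<in>{0..T}. ennreal ((norm (simple_process (LL k) (pp k) (\<xi>\<xi> k) s \<omega> - g (x s \<omega>)))\<^sup>2) \<partial>lborel)"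
    "tendsto_0_in_prob M (\<lambda>k \<omega>. SUP t\<in>{0..T}. ennreal (norm (simple_integral W (LL k) (pp k) (\<xi>\<xi> k) t \<omega> - I t \<omega>)))"
    using I_ito T unfolding is_ito_integral_def by blast
  let ?Q = "\<lambda>k \<omega>. \<integral>\<^sup>+s\<in>{0..T}. ennreal ((norm (simple_process (LL k) (pp k) (\<xi>\<xi> k) s \<omega> - g (x s \<omega>)))\<^sup>2) \<partial>lborel"
  let ?S = "\<lambda>k \<omega>. SUP t\<in>{0..T}. ennreal (norm (simple_integral W (LL k) (pp k) (\<xi>\<xi> k) t \<omega> - I t \<omega>))"
  have "\<forall>\<^sub>F k in sequentially. prob {\<omega>\<in>space M. ?Q k \<omega> > ennreal (\<kappa> / 4)} < e2"
    using ito(2) \<kappa> e2 unfolding tendsto_0_in_prob_def by (intro order_tendstoD(2)) auto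
  moreover have "\<forall>\<^sub>F k in sequentially. prob {\<omega>\<in>space M. ?S k \<omega> > ennreal \<delta>} < e2"
    using ito(3) \<delta> e2 unfolding tendsto_0_in_prob_def by (intro order_tendstoD(2)) auto
  ultimately have "\<forall>\<^sub>F k in sequentially. prob {\<omega>\<in>space M. ?Q k \<omega> > ennreal (\<kappa> / 4)} < e2 \<and> prob {\<omega>\<in>space M. ?S k \<omega> > ennreal \<delta>} < e2"
    by (rule eventually_conj)
  then obtain k where k: "prob {\<omega>\<in>space M. ?Q k \<omega> > ennreal (\<kappa> / 4)} < e2" "prob {\<omega>\<in>space M. ?S k \<omega> > ennreal \<delta>} < e2"
    using eventually_happens by force
  have QS: "{\<omega>\<in>space M. ?Q k \<omega> > ennreal (\<kappa> / 4)} \<in> events" "{\<omega>\<in>space M. ?S k \<omega> > ennreal \<delta>} \<in> events"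
    using ito(2,3) unfolding tendsto_0_in_prob_def by (auto intro: borel_measurable_less)
  define L p \<xi> where "L = LL k" and "p = pp k" and "\<xi> = \<xi>\<xi> k"
  have simple: "simple_integrand M F L p \<xi>" unfolding L_def p_def \<xi>_def by (rule ito)
  obtain Bd where Bd: "\<And>i \<omega>. i < L \<Longrightarrow> \<omega> \<in> space M \<Longrightarrow> norm (\<xi> i \<omega>) \<le> Bd i"
    using simple unfolding simple_integrand_def by metis
  define K\<eta> where "K\<eta> = (\<Sum>i<L. \<bar>Bd i\<bar>)"
  have K\<eta>: "K\<eta> \<ge> 0" unfolding K\<eta>_def by (intro sum_nonneg) auto
  define m where "m = real CARD('m)"
  define \<epsilon> where "\<epsilon> = e1 / (T * (K\<eta>\<^sup>2 * m) + 1)"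
  have den: "T * (K\<eta>\<^sup>2 * m) \<ge> 0" unfolding m_def using T by auto
  have \<epsilon>: "\<epsilon> > 0" unfolding \<epsilon>_def using e1 den by auto
  have \<epsilon>_le: "T * (\<epsilon> * (K\<eta>\<^sup>2 * m)) \<le> e1"
  proof -
    have "T * (\<epsilon> * (K\<eta>\<^sup>2 * m)) = e1 * (T * (K\<eta>\<^sup>2 * m) / (T * (K\<eta>\<^sup>2 * m) + 1))" unfolding \<epsilon>_def by simp
    also have "\<dots> \<le> e1 * 1" using den e1 by (intro mult_left_mono) (auto simp: divide_le_eq)
    finally show ?thesis by simp
  qed
  obtain K1 where K1: "K1 \<ge> 0" "\<And>y d G D. norm y \<le> R + 1 \<Longrightarrow> 0 \<le> D \<Longrightarrow> D \<le> 1 \<Longrightarrow> norm d \<le> B * D \<Longrightarrow>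
      V (y + d + G) \<le> V y + gradient V y \<bullet> d + gradient V y \<bullet> G + (G \<bullet> (hessian V y *v G)) / 2
        + \<epsilon> * (norm G)\<^sup>2 + K1 * norm G ^ 4 + K1 * D\<^sup>2"
    using C2_Taylor_drift_noise[OF C2_V V_growth \<epsilon> B(1), of "R + 1"] by blast
  obtain bV where bV: "bV \<ge> 0" "\<And>y. norm y \<le> R + 1 \<Longrightarrow>
      norm (V y) \<le> bV \<and> norm (gradient V y) \<le> bV \<and> norm (hessian V y) \<le> bV"
    using C2_bounded_on_cball[OF C2_V] by metis
  define K3 where "K3 = m * (bV * K\<eta>\<^sup>2) / 2 + lam * bV"
  have K3_nonneg: "K3 \<ge> 0" unfolding K3_def m_def using bV lam by auto
  have K3: "trace (transpose A ** hessian V y ** A) / 2 + lam * V y \<le> K3"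
    if "norm y \<le> R + 1" "norm A \<le> K\<eta>" for y and A :: "real^'m^'n"
  proof -
    have "trace (transpose A ** hessian V y ** A) \<le> m * (norm (hessian V y) * (norm A)\<^sup>2)"
      using abs_trace_quadratic_le[of A "hessian V y"] unfolding m_def by linarith
    also have "\<dots> \<le> m * (bV * K\<eta>\<^sup>2)"
      using bV that unfolding m_def by (intro mult_left_mono mult_mono power_mono) auto
    finally have "trace (transpose A ** hessian V y ** A) \<le> m * (bV * K\<eta>\<^sup>2)" .
    moreover have "lam * V y \<le> lam * bV" using bV(2)[OF that(1)] lam by (intro mult_left_mono) auto
    ultimately show ?thesis unfolding K3_def by linarith
  qed
  define H where "H = T * (K1 * (K\<eta> ^ 4 * (3 * m\<^sup>2)) + K1) + K3"
  have H: "H \<ge> 0" unfolding H_def m_def using T K1 K3_nonneg by auto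
  define hh where "hh n = 1 / real (Suc n)" for n
  have hh: "0 < hh n" "hh n \<le> 1" for n unfolding hh_def by auto
  have hh_lim: "hh \<longlonglongrightarrow> 0"
    unfolding hh_def using LIMSEQ_inverse_real_of_nat by (simp only: inverse_eq_divide)
  have "\<exists>N q. q 0 = 0 \<and> q N = T \<and> (\<forall>j<N. q j < q (Suc j)) \<and> (\<forall>j<N. q (Suc j) - q j \<le> hh n) \<and>
    (\<forall>i j. j < N \<longrightarrow> i \<le> L \<longrightarrow> p i \<le> q j \<or> q (Suc j) \<le> p i) \<and> (\<forall>j\<le>N. q j \<in> {0..T})" for n
    by (rule refining_grid_exists[OF T hh(1), of "p ` {..L}" n]) (simp, blast)
  then obtain N q where grid: "\<And>n. q n 0 = (0::real)" "\<And>n. q n (N n) = T"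
    "\<And>n j. j < N n \<Longrightarrow> q n j < q n (Suc j)" "\<And>n j. j < N n \<Longrightarrow> q n (Suc j) - q n j \<le> hh n"
    "\<And>n i j. j < N n \<Longrightarrow> i \<le> L \<Longrightarrow> p i \<le> q n j \<or> q n (Suc j) \<le> p i" "\<And>n j. j \<le> N n \<Longrightarrow> q n j \<in> {0..T}"
    by metis
  have gr: "grid_approximation M F W x I b g V \<phi> Om lam C c2 L p \<xi> (N n) (q n) T (hh n) \<delta> \<kappa>" for n
    by unfold_locales (use simple grid hh[of n] \<delta> \<kappa> in \<open>auto intro: less_imp_le\<close>)
  let ?osc = "\<lambda>n. grid_approximation.small_osc x Om (N n) (q n) \<delta>"
  have osc_in: "?osc n \<in> events" for n using grid_approximation.small_osc_in_M[OF gr] .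
  have "AE \<omega> in M. \<forall>\<^sub>F n in sequentially. \<omega> \<in> ?osc n"
    using Om(2)
  proof eventually_elim
    case (elim \<omega>)
    have "uniformly_continuous_on {0..T} (\<lambda>r. x r \<omega>)"
      using x_cont[OF elim] by (intro compact_uniformly_continuous compact_Icc) (auto intro: continuous_on_subset)
    then obtain d where d: "d > 0" "\<And>r s. r \<in> {0..T} \<Longrightarrow> s \<in> {0..T} \<Longrightarrow> dist r s < d \<Longrightarrow> dist (x r \<omega>) (x s \<omega>) < \<delta>"
      using \<delta>(1) unfolding uniformly_continuous_on_def by metis
    have "\<forall>\<^sub>F n in sequentially. hh n < d" using d(1) hh_lim by (intro order_tendstoD(2)) auto
    then show ?case
    proof eventually_elim
      case (elim n)
      show ?case unfolding grid_approximation.small_osc_def[OF gr]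
      proof (intro CollectI conjI ballI)
        fix i r assume i: "i \<in> {..<N n}" and r: "r \<in> {q n i..q n (Suc i)}"
        have "q n i \<in> {0..T}" "q n (Suc i) \<in> {0..T}" using grid(6)[of i n] grid(6)[of "Suc i" n] i by auto
        moreover have "dist r (q n i) < d" using grid(4)[of i n] i r elim by (auto simp: dist_real_def)
        ultimately show "dist (x r \<omega>) (x (q n i) \<omega>) \<le> \<delta>" using r d(2)[of r "q n i"] by auto
      qed (use \<open>\<omega> \<in> Om\<close> in auto)
    qed
  qed
  then have "(\<lambda>n. prob (?osc n)) \<longlonglongrightarrow> 1" by (rule prob_tendsto_1_if_eventually[OF osc_in])
  then have "\<forall>\<^sub>F n in sequentially. prob (?osc n) > 1 - e2" using e2 by (intro order_tendstoD(1)) auto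
  moreover have "\<forall>\<^sub>F n in sequentially. hh n * H < e1"
  proof -
    have "(\<lambda>n. hh n * H) \<longlonglongrightarrow> 0 * H" by (intro tendsto_mult tendsto_const hh_lim)
    then show ?thesis using e1 by (intro order_tendstoD(2)) auto
  qed
  ultimately have "\<forall>\<^sub>F n in sequentially. prob (?osc n) > 1 - e2 \<and> hh n * H < e1" by (rule eventually_conj)
  then obtain n where n: "prob (?osc n) > 1 - e2" "hh n * H < e1" using eventually_happens by force
  interpret A: grid_approximation M F W x I b g V \<phi> Om lam C c2 L p \<xi> "N n" "q n" T "hh n" R \<delta> \<kappa>
    by unfold_locales (use simple grid hh[of n] \<delta> \<kappa> in \<open>auto intro: less_imp_le\<close>)
  interpret A: grid_estimate M F W x I b g V \<phi> Om lam C c2 L p \<xi> "N n" "q n" T "hh n" R \<delta> \<kappa> B \<epsilon> \<epsilon>' K1 K2 K3 K\<eta>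
  proof unfold_locales
    show "norm (A.\<eta> j \<omega>) \<le> K\<eta>" if "\<omega> \<in> space M" for j \<omega>
      unfolding K\<eta>_def using Bd that by (intro A.\<eta>_bounded) auto
  qed (use B \<epsilon> \<epsilon>' K1 K2 K3 K3_nonneg K\<eta> \<delta> in auto)
  let ?E = "{\<omega>\<in>Om. \<forall>r\<in>{0..T}. norm (x r \<omega>) \<le> R}" and ?Qs = "{\<omega>\<in>space M. ?Q k \<omega> > ennreal (\<kappa> / 4)}"
    and ?Ss = "{\<omega>\<in>space M. ?S k \<omega> > ennreal \<delta>}"
  have sub: "space M - A.\<Gamma> (N n) \<subseteq> (space M - ?E) \<union> (space M - ?osc n) \<union> ?Qs \<union> ?Ss"
  proof
    fix \<omega> assume \<omega>: "\<omega> \<in> space M - A.\<Gamma> (N n)"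
    show "\<omega> \<in> (space M - ?E) \<union> (space M - ?osc n) \<union> ?Qs \<union> ?Ss"
    proof (rule ccontr)
      assume no: "\<omega> \<notin> (space M - ?E) \<union> (space M - ?osc n) \<union> ?Qs \<union> ?Ss"
      have "\<omega> \<in> A.\<Gamma> (N n)"
        by (rule A.\<Gamma>_N_superset[OF g_close]) (use no \<omega> in \<open>auto simp: L_def p_def \<xi>_def not_less\<close>)
      with \<omega> show False by simp
    qed
  qed
  have \<Gamma>: "A.\<Gamma> (N n) \<in> events" by (rule A.\<Gamma>_in_M) simp
  have "1 - prob (A.\<Gamma> (N n)) = prob (space M - A.\<Gamma> (N n))" using \<Gamma> by (simp add: prob_compl)
  also have "\<dots> \<le> prob ((space M - ?E) \<union> (space M - ?osc n) \<union> ?Qs \<union> ?Ss)"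
    using R(2) osc_in QS by (intro finite_measure_mono sub) auto
  also have "\<dots> \<le> prob (space M - ?E) + prob (space M - ?osc n) + prob ?Qs + prob ?Ss"
    using R(2) osc_in QS by (intro order_trans[OF measure_Un_le] add_mono order_refl) auto
  also have "\<dots> \<le> 4 * e2" using k n R osc_in[of n] by (simp add: prob_compl)
  finally have "K0 * (1 - prob (A.\<Gamma> (N n))) \<le> K0 * (4 * e2)" using K0 by (rule mult_left_mono)
  also have "\<dots> \<le> e1"
  proof -
    have "K0 * (4 * e2) = e1 * (K0 / (K0 + 1))" unfolding e2_def using K0 by (simp add: field_simps)
    also have "\<dots> \<le> e1 * 1" using K0 e1 by (intro mult_left_mono) auto
    finally show ?thesis by simp
  qed
  finally have P: "K0 * (1 - prob (A.\<Gamma> (N n))) \<le> e1" .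
  have "\<epsilon>' * T + K2 * \<kappa> \<le> \<epsilon>' * (T + 1)" using \<kappa> by (simp add: distrib_left)
  also have "\<dots> = e1" unfolding \<epsilon>'_def using T by simp
  finally have E: "\<epsilon>' * T + K2 * \<kappa> \<le> e1" .
  have "(\<integral>\<omega>. min (V (x T \<omega>)) K0 \<partial>M) \<le> (\<integral>\<omega>. A.Z (N n) \<omega> \<partial>M) + e1 + K0 * (1 - prob (A.\<Gamma> (N n)))"
    using V_close K0 e1 by (intro A.truncated_expectation_le) auto
  also have "\<dots> \<le> exp (- lam * T) * (V \<phi> + C * exp lam * T) + (e1 + e1 + e1) + e1 + e1"
    using A.Z_expectation_bound[folded m_def, folded H_def] \<epsilon>_le n(2) E P by linarith
  also have "\<dots> = exp (- lam * T) * (V \<phi> + C * exp lam * T) + e" unfolding e1_def by simp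
  finally show ?thesis .
qed

text \<open>The bound on the truncated means is uniform in the truncation, so monotone convergence yields integrability along with the bound.\<close>

theorem lyapunov_expectation_bound:
  assumes T: "0 \<le> T"
  shows "integrable M (\<lambda>\<omega>. V (x T \<omega>))"
    and "(\<integral>\<omega>. V (x T \<omega>) \<partial>M) \<le> exp (- lam * T) * (V \<phi> + C * exp lam * T)"
proof -
  let ?K = "exp (- lam * T) * (V \<phi> + C * exp lam * T)"
  have [measurable]: "V \<in> borel_measurable borel"
    by (intro borel_measurable_continuous_onI C2_continuous[OF C2_V])
  have [measurable]: "x T \<in> borel_measurable M"
    using measurable_F_imp_M[OF T] x_adapted T unfolding adapted_def by blast
  have K: "?K \<ge> 0" using V_growth[of \<phi>] C T by auto
  have bound: "(\<integral>\<^sup>+\<omega>. ennreal (min (V (x T \<omega>)) (real n)) \<partial>M) \<le> ennreal ?K" for n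
  proof -
    have "(\<integral>\<omega>. min (V (x T \<omega>)) (real n) \<partial>M) \<le> ?K"
      by (rule field_le_epsilon) (rule truncated_bound[OF T], auto)
    moreover have "integrable M (\<lambda>\<omega>. min (V (x T \<omega>)) (real n))"
      using V_growth by (intro integrable_const_bound[of _ "real n"]) (auto simp: min_def)
    ultimately show ?thesis
      using V_growth by (subst nn_integral_eq_integral) (auto intro!: ennreal_leI)
  qed
  have "(\<integral>\<^sup>+\<omega>. ennreal (V (x T \<omega>)) \<partial>M) = (\<integral>\<^sup>+\<omega>. (SUP n::nat. ennreal (min (V (x T \<omega>)) (real n))) \<partial>M)"
  proof (rule nn_integral_cong)
    fix \<omega>
    obtain n :: nat where n: "V (x T \<omega>) \<le> real n" using real_arch_simple by blast
    show "ennreal (V (x T \<omega>)) = (SUP n::nat. ennreal (min (V (x T \<omega>)) (real n)))"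
    proof (rule antisym)
      show "ennreal (V (x T \<omega>)) \<le> (SUP n::nat. ennreal (min (V (x T \<omega>)) (real n)))"
        using n by (intro SUP_upper2[of n]) auto
      show "(SUP n::nat. ennreal (min (V (x T \<omega>)) (real n))) \<le> ennreal (V (x T \<omega>))"
        by (intro SUP_least ennreal_leI) auto
    qed
  qed
  also have "\<dots> = (SUP n::nat. \<integral>\<^sup>+\<omega>. ennreal (min (V (x T \<omega>)) (real n)) \<partial>M)"
    by (intro nn_integral_monotone_convergence_SUP) (auto simp: incseq_def le_fun_def intro!: ennreal_leI min.mono)
  also have "\<dots> \<le> ennreal ?K" by (intro SUP_least bound)
  finally have fin: "(\<integral>\<^sup>+\<omega>. ennreal (V (x T \<omega>)) \<partial>M) \<le> ennreal ?K" .
  then show int: "integrable M (\<lambda>\<omega>. V (x T \<omega>))"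
    using V_growth by (intro integrableI_bounded) (auto intro: le_less_trans)
  show "(\<integral>\<omega>. V (x T \<omega>) \<partial>M) \<le> ?K"
    using fin int V_growth K by (simp add: nn_integral_eq_integral ennreal_le_iff)
qed

end

section \<open>Mean square exponential stabilisation\<close>

text \<open>The linear factor costs half of the rate, by \<open>s \<le> exp s\<close> at \<open>s = lam * T / 2\<close>.\<close>

lemma linear_times_exp_le:
  fixes T lam :: real
  assumes "lam > 0" "T \<ge> 0" "a \<ge> 0" "c \<ge> 0"
  shows "exp (- lam * T) * (a + c * T) \<le> (a + c * (2 / lam)) * exp (- (lam / 2) * T)"
proof -
  have "lam * T / 2 \<le> exp (lam * T / 2)" using exp_ge_add_one_self[of "lam * T / 2"] by linarith
  then have "T \<le> 2 / lam * exp (lam * T / 2)" using assms by (simp add: field_simps)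
  then have "c * T \<le> c * (2 / lam) * exp (lam * T / 2)" using assms mult_left_mono by fastforce
  moreover have "a \<le> a * exp (lam * T / 2)" using assms by (simp add: mult_le_cancel_left1)
  ultimately have "a + c * T \<le> (a + c * (2 / lam)) * exp (lam * T / 2)" by (simp add: distrib_right)
  then have "exp (- lam * T) * (a + c * T) \<le> exp (- lam * T) * ((a + c * (2 / lam)) * exp (lam * T / 2))"
    by (rule mult_left_mono) simp
  also have "\<dots> = (a + c * (2 / lam)) * (exp (- lam * T) * exp (lam * T / 2))" by simp
  also have "exp (- lam * T) * exp (lam * T / 2) = exp (- (lam / 2) * T)" by (simp add: exp_add[symmetric])
  finally show ?thesis .
qed

theorem theorem1:
  fixes M :: "'w measure" and F :: "real \<Rightarrow> 'w measure"
    and W :: "real \<Rightarrow> 'w \<Rightarrow> real^'m"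
    and U :: "(real^'l) set"
    and f :: "real^'n \<Rightarrow> real^'l \<Rightarrow> real^'n" and g :: "real^'n \<Rightarrow> real^'m^'n"
    and k1 k2 :: "real^'n \<Rightarrow> real^'l"
    and V :: "real^'n \<Rightarrow> real"
    and \<phi> :: "real^'n" and x :: "real \<Rightarrow> 'w \<Rightarrow> real^'n"
    and \<tau> lam M1 M2 c1 c2 c3 \<mu> Mbar lbar :: real
  assumes W: "wiener_process M F W"
    and U: "compact U" "0 \<in> U"
    and f: "continuous_on UNIV (\<lambda>(x, u). f x u)" "locally_lipschitz (\<lambda>(x, u). f x u)" "f 0 0 = 0"
    and g: "continuous_on UNIV g" "locally_lipschitz g" "g 0 = 0"
    and trigger: "\<tau> > 0" "lam > 0" "0 < M2" "M2 \<le> M1" "M2 < (norm \<phi>)\<^sup>2"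
    and solution: "closed_loop_solution M F W f g \<phi> k1 k2 \<tau> lam M1 M2 x"
    and unique: "\<And>y. closed_loop_solution M F W f g \<phi> k1 k2 \<tau> lam M1 M2 y \<Longrightarrow>
      AE \<omega> in M. \<forall>t\<ge>0. y t \<omega> = x t \<omega>"
    and A1: "C2 V" "\<forall>x. V x \<ge> 0" "c1 > 0" "c2 > 0"
      "\<forall>x. c1 * (norm x)\<^sup>2 \<le> V x \<and> V x \<le> c2 * (norm x)\<^sup>2"
    and A2: "\<forall>x. k1 x \<in> U" "\<forall>x. k2 x \<in> U" "locally_lipschitz k1" "locally_lipschitz k2"
      "k1 0 = 0" "k2 0 = 0"
      "\<mu> > 0" "Mbar \<ge> 0" "lbar < \<mu> / c2"
      "\<forall>x. \<forall>t\<ge>0. ito_operator f g V x (k1 x) \<le> - \<mu> * (norm x)\<^sup>2 + Mbar * exp (- lbar * t)"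
      "\<forall>x. ito_operator f g V x (k2 x) \<le> c3 * (norm x)\<^sup>2"
    and A3: "Mbar > 0 \<Longrightarrow> lam < lbar \<and> lbar < \<mu> / c2" "Mbar = 0 \<Longrightarrow> lam < \<mu> / c2"
  shows "mean_square_exp_stable M x"
proof -
  interpret wiener_process M F W by fact
  obtain u I where u: "switching_control M k1 k2 \<tau> lam M1 M2 x u"
    and x: "adapted F x" "as_continuous M x"
      "AE \<omega> in M. \<forall>t\<ge>0. set_integrable lborel {0..t} (\<lambda>s. f (x s \<omega>) (u s \<omega>))"
    and I: "is_ito_integral M F W (\<lambda>s \<omega>. g (x s \<omega>)) I"
      "AE \<omega> in M. \<forall>t\<ge>0. x t \<omega> = \<phi> + (LINT s:{0..t}|lborel. f (x s \<omega>) (u s \<omega>)) + I t \<omega>"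
    using solution unfolding closed_loop_solution_def sde_solution_def by blast
  have "AE \<omega> in M. continuous_on {0..} (\<lambda>t. x t \<omega>)
      \<and> (\<forall>t\<ge>0. set_integrable lborel {0..t} (\<lambda>s. f (x s \<omega>) (u s \<omega>)))
      \<and> (\<forall>t\<ge>0. x t \<omega> = \<phi> + (LINT s:{0..t}|lborel. f (x s \<omega>) (u s \<omega>)) + I t \<omega>)"
    using x(2,3) I(2) unfolding as_continuous_def by eventually_elim auto
  then obtain Null where Null: "Null \<in> null_sets M"
    and good: "\<And>\<omega>. \<omega> \<in> space M - Null \<Longrightarrow> continuous_on {0..} (\<lambda>t. x t \<omega>)
      \<and> (\<forall>t\<ge>0. set_integrable lborel {0..t} (\<lambda>s. f (x s \<omega>) (u s \<omega>)))
      \<and> (\<forall>t\<ge>0. x t \<omega> = \<phi> + (LINT s:{0..t}|lborel. f (x s \<omega>) (u s \<omega>)) + I t \<omega>)"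
    by (rule AE_E3) blast
  \<comment> \<open>null sets belong to \<open>F 0\<close>, hence so does the event on which all path properties hold\<close>
  define Om where "Om = space M - Null"
  define C where "C = Mbar + (\<bar>c3\<bar> + \<mu>) * \<bar>M1\<bar>"
  have C: "C \<ge> 0" unfolding C_def using A2 by auto
  have rate: "lam \<le> \<mu> / c2" "Mbar > 0 \<Longrightarrow> lam \<le> lbar"
    using A3 A2(8) by (cases "Mbar = 0"; force)+
  have gen: "ito_operator f g V (x t \<omega>) (u t \<omega>) + lam * V (x t \<omega>) \<le> C * exp (- lam * t)"
    and mode: "u t \<omega> = k1 (x t \<omega>) \<or> u t \<omega> = k2 (x t \<omega>)" if "\<omega> \<in> Om" "0 \<le> t" for t \<omega>
  proof -
    have "\<omega> \<in> space M" "continuous_on {0..} (\<lambda>t. x t \<omega>)" using that good unfolding Om_def by auto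
    note * = closed_loop_generator_bound[where y = "\<lambda>t. x t \<omega>" and v = "u t \<omega>", OF trigger(1,4) this(2) that(2) _ _
        A1(4) _ _ A2(7,8) rate(2,1), where ?k1.0 = k1 and ?k2.0 = k2 and ?c3.0 = c3 and f = f and g = g and V = V]
    show "ito_operator f g V (x t \<omega>) (u t \<omega>) + lam * V (x t \<omega>) \<le> C * exp (- lam * t)"
      unfolding C_def
      by (rule *(1)) (use u that \<open>\<omega> \<in> space M\<close> A1 A2 in \<open>auto simp: switching_control_def Let_def\<close>)
    show "u t \<omega> = k1 (x t \<omega>) \<or> u t \<omega> = k2 (x t \<omega>)"
      by (rule *(2)) (use u that \<open>\<omega> \<in> space M\<close> A1 A2 in \<open>auto simp: switching_control_def Let_def\<close>)
  qed
  interpret lyapunov_diffusion M F W x I "\<lambda>t \<omega>. f (x t \<omega>) (u t \<omega>)" g V \<phi> Om lam C c2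
  proof unfold_locales
    show "Om \<in> sets (F 0)"
      using null_sets_F0 Null space_F[of 0] sets.top[of "F 0"] unfolding Om_def by auto
    show "AE \<omega> in M. \<omega> \<in> Om"
      using AE_not_in[OF Null] unfolding Om_def by auto
    show "\<exists>B. \<forall>\<omega>\<in>Om. \<forall>t\<ge>0. norm (x t \<omega>) \<le> R \<longrightarrow> norm (f (x t \<omega>) (u t \<omega>)) \<le> B" for R
    proof -
      have "bounded ((\<lambda>(x, u). f x u) ` (cball 0 R \<times> U))"
        using f(1) U(1) by (intro compact_imp_bounded compact_continuous_image compact_Times compact_cball)
          (auto intro: continuous_on_subset)
      then obtain B where "\<forall>z\<in>(\<lambda>(x, u). f x u) ` (cball 0 R \<times> U). norm z \<le> B" unfolding bounded_iff by metis
      then have "norm (f y v) \<le> B" if "norm y \<le> R" "v \<in> U" for y v using that by force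
      moreover have "u t \<omega> \<in> U" if "\<omega> \<in> Om" "0 \<le> t" for t \<omega> using mode[OF that] A2(1,2) by auto
      ultimately show ?thesis by blast
    qed
    show "gradient V (x t \<omega>) \<bullet> f (x t \<omega>) (u t \<omega>)
        + trace (transpose (g (x t \<omega>)) ** hessian V (x t \<omega>) ** g (x t \<omega>)) / 2 + lam * V (x t \<omega>) \<le> C * exp (- lam * t)"
      if "\<omega> \<in> Om" "0 \<le> t" for \<omega> t
      using gen[OF that] unfolding ito_operator_def by simp
  qed (use x I good A1 A2 g trigger C in \<open>auto simp: Om_def\<close>)
  \<comment> \<open>the summand 1 makes \<open>K\<close> strictly positive\<close>
  define K where "K = (V \<phi> + C * exp lam * (2 / lam)) / c1 + 1"
  have nonneg: "V \<phi> + C * exp lam * (2 / lam) \<ge> 0" using A1 C trigger by auto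
  have K: "K > 0" unfolding K_def using nonneg A1(3) by (intro add_nonneg_pos) auto
  have "integrable M (\<lambda>\<omega>. (norm (x t \<omega>))\<^sup>2) \<and>
      (\<integral>\<omega>. (norm (x t \<omega>))\<^sup>2 \<partial>M) \<le> K * exp (- (lam / 2) * t)" if t: "0 \<le> t" for t
  proof
    have [measurable]: "x t \<in> borel_measurable M"
      using measurable_F_imp_M[OF t] x(1) t unfolding adapted_def by blast
    note V = lyapunov_expectation_bound[OF t]
    have le: "(norm (x t \<omega>))\<^sup>2 \<le> V (x t \<omega>) / c1" for \<omega>
      using A1(3,5) by (simp add: pos_le_divide_eq mult.commute)
    have iV: "integrable M (\<lambda>\<omega>. V (x t \<omega>) / c1)" using V(1) by simp
    show i: "integrable M (\<lambda>\<omega>. (norm (x t \<omega>))\<^sup>2)"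
      by (rule Bochner_Integration.integrable_bound[OF iV])
        (use le A1(2,3) in \<open>auto intro!: AE_I2\<close>)
    have "(\<integral>\<omega>. (norm (x t \<omega>))\<^sup>2 \<partial>M) \<le> (\<integral>\<omega>. V (x t \<omega>) / c1 \<partial>M)" by (intro integral_mono i iV le)
    also have "\<dots> = (\<integral>\<omega>. V (x t \<omega>) \<partial>M) / c1" by simp
    also have "\<dots> \<le> exp (- lam * t) * (V \<phi> + C * exp lam * t) / c1"
      using V(2) A1(3) by (intro divide_right_mono) auto
    also have "\<dots> \<le> (V \<phi> + C * exp lam * (2 / lam)) * exp (- (lam / 2) * t) / c1"
      using linear_times_exp_le[of lam t "V \<phi>" "C * exp lam"] trigger(2) t A1 C by (intro divide_right_mono) auto
    also have "\<dots> \<le> K * exp (- (lam / 2) * t)" unfolding K_def by (simp add: distrib_right)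
    finally show "(\<integral>\<omega>. (norm (x t \<omega>))\<^sup>2 \<partial>M) \<le> K * exp (- (lam / 2) * t)" .
  qed
  then show ?thesis
    unfolding mean_square_exp_stable_def using K trigger(2) by (intro exI[of _ K] conjI exI[of _ "lam / 2"]) auto
qed

end
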